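(* Let $\beta>\beta_*=1.85722\ldots$ be fixed. As $\eta\to0^+$, $$r(\beta,\eta)=r_0(\beta)+\mathcal{A}(\beta)\,\eta+O(\eta^2),$$ where $r_0=r_0(\beta)$ is defined implicitly as the minimal positive solution of $$D_{r_0}'(-\beta)=\sqrt{\beta^2/4-r_0}\;D_{r_0}(-\beta),$$ and $$\mathcal{A}(\beta)=\frac12\,\frac{\beta-\sqrt{\beta^2-4r_0}}{\beta^2-4r_0}\,D_{r_0}(-\beta)\left[\frac{\partial\tilde{\mathcal{V}}}{\partial p}(p,\beta)\Big|_{p=r_0(\beta)}\right]^{-1},$$ with $\tilde{\mathcal{V}}(p,\beta)=D_p'(-\beta)-D_p(-\beta)\sqrt{\beta^2/4-p}$. Moreover $\mathcal{A}(\beta)>0$, so that $r(\beta,\eta)-r_0(\beta)$ is positive for sufficiently small $\eta>0$.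
   Context: For $\beta\in\mathbb{R}$, $\eta>0$, consider the Markov diffusion process on $\mathbb{R}$ whose transition density $p$ satisfies $\partial_t p=-\partial_x[a(x)p]+\partial_x^2p$, with $a(x)=-\beta-\eta x$ for $x\ge0$ and $a(x)=-\beta-x$ for $x\le 0$, $p(x,0)=\delta(x-x_0)$, $p$ and $\partial_xp$ continuous at $x=0$, and decay as $x\to\pm\infty$. Its spectral gap $r(\beta,\eta)$ is the smallest strictly positive $\lambda$ for which $-\psi''+V\psi=(\lambda+\frac12)\psi$ on $\mathbb{R}$ has a nonzero solution $\psi\in L^2(\mathbb{R})$ with $\psi,\psi'$ continuous at $0$, where $V(x)=\frac14(\beta+x)^2$ for $x<0$ and $V(x)=\frac14(\beta+\eta x)^2+\frac{1-\eta}2$ for $x>0$. $D_\nu(z)=\frac{1}{i\sqrt{2\pi}}e^{z^2/4}\int_{\mathrm{Br}}u^\nu e^{-zu}e^{u^2/2}du$ is the parabolic cylinder function ($\mathrm{Br}$ an upward vertical line with $\mathrm{Re}(u)>0$, principal branch of $u^\nu$), and $D_\nu'(z)=\frac{d}{dz}D_\nu(z)$. The constant $\beta_*$ is the smallest positive solution $\beta$ of $D'_{\beta^2/4}(-\beta)=0$, where $D'_{\beta^2/4}(-\beta)$ denotes $D'_\nu(z)$ evaluated at $\nu=\beta^2/4$, $z=-\beta$. *)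

theory Defs
  imports "HOL-Analysis.Analysis" "HOL-Library.Landau_Symbols"
begin

definition is_least_positive :: "(real \<Rightarrow> bool) \<Rightarrow> real \<Rightarrow> bool" where
  "is_least_positive P x \<longleftrightarrow> 0 < x \<and> P x \<and> (\<forall>y. 0 < y \<and> P y \<longrightarrow> x \<le> y)"

definition least_positive :: "(real \<Rightarrow> bool) \<Rightarrow> real" where
  "least_positive P = (THE x. is_least_positive P x)"

text \<open>
  The parabolic cylinder function. The vertical line is taken to be \<open>u = 1 + \<i>t\<close>,
  whence \<open>du = \<i> dt\<close>; by Cauchy's theorem any other abscissa \<open>Re u > 0\<close>
  gives the same value. On complex numbers \<open>powr\<close> is the principal branch.
\<close>

definition pcf :: "complex \<Rightarrow> complex \<Rightarrow> complex" where
  "pcf \<nu> z = 1 / (\<i> * of_real (sqrt (2 * pi))) * exp (z\<^sup>2 / 4) *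
     (LINT t|lborel. (let u = Complex 1 t in
        u powr \<nu> * exp (- z * u) * exp (u\<^sup>2 / 2) * \<i>))"

text \<open>
  For real index and argument the value is real (lemma \<open>of_real_pcD\<close> below), so taking
  the real part loses nothing.
\<close>

definition pcD :: "real \<Rightarrow> real \<Rightarrow> real" where
  "pcD \<nu> z = Re (pcf (of_real \<nu>) (of_real z))"

definition pcD' :: "real \<Rightarrow> real \<Rightarrow> real" where
  "pcD' \<nu> z = deriv (\<lambda>z. pcD \<nu> z) z"

lemma cnj_pcf_of_real: "cnj (pcf (of_real \<nu>) (of_real z)) = pcf (of_real \<nu>) (of_real z)"
proof -
  define f where "f t = (let u = Complex 1 t in
      u powr (of_real \<nu>) * exp (- (of_real z) * u) * exp (u\<^sup>2 / 2) :: complex)" for t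
  have f_cnj: "cnj (f t) = f (- t)" for t
  proof -
    have nr: "Complex 1 t \<notin> \<real>\<^sub>\<le>\<^sub>0"
      by (auto simp: complex_nonpos_Reals_iff)
    have c: "cnj (Complex 1 t) = Complex 1 (- t)"
      by (simp add: complex_eq_iff)
    show ?thesis
      unfolding f_def Let_def complex_cnj_mult exp_cnj
      using nr by (simp add: cnj_powr exp_cnj c)
  qed
  have "cnj (LINT t|lborel. f t) = (LINT t|lborel. cnj (f t))"
    by simp
  also have "\<dots> = (LINT t|lborel. f (- t))"
    by (simp add: f_cnj)
  also have "\<dots> = (LINT t|lborel. f t)"
    using lborel_integral_real_affine[of "-1" f 0] by simp
  finally have *: "cnj (LINT t|lborel. f t) = (LINT t|lborel. f t)" .
  have "pcf (of_real \<nu>) (of_real z)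
      = of_real (1 / sqrt (2 * pi)) * exp ((of_real z)\<^sup>2 / 4) * (LINT t|lborel. f t)"
    by (simp add: pcf_def f_def Let_def field_simps)
  then show ?thesis
    by (simp add: * exp_cnj)
qed

lemma of_real_pcD: "of_real (pcD \<nu> z) = pcf (of_real \<nu>) (of_real z)"
  using cnj_pcf_of_real[of \<nu> z] unfolding pcD_def
  by (metis Reals_cnj_iff of_real_Re)

definition beta_star :: real where
  "beta_star = least_positive (\<lambda>\<beta>. pcD' (\<beta>\<^sup>2 / 4) (- \<beta>) = 0)"

text \<open>The value of the potential at \<open>0\<close> is irrelevant, see below.\<close>

definition potential :: "real \<Rightarrow> real \<Rightarrow> real \<Rightarrow> real" where
  "potential \<beta> \<eta> x =
     (if x < 0 then (\<beta> + x)\<^sup>2 / 4 else (\<beta> + \<eta> * x)\<^sup>2 / 4 + (1 - \<eta>) / 2)"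

text \<open>
  The potential jumps at \<open>0\<close> when \<open>\<eta> \<noteq> 1\<close>, so the differential equation is
  required for \<open>x \<noteq> 0\<close>, together with continuity of \<open>\<psi>\<close> and
  \<open>\<psi>'\<close> at \<open>0\<close>.
\<close>

definition is_eigenvalue :: "real \<Rightarrow> real \<Rightarrow> real \<Rightarrow> bool" where
  "is_eigenvalue \<beta> \<eta> l \<longleftrightarrow>
     (\<exists>\<psi> \<psi>' \<psi>'' :: real \<Rightarrow> real.
        (\<forall>x. (\<psi> has_real_derivative \<psi>' x) (at x)) \<and>
        isCont \<psi> 0 \<and> isCont \<psi>' 0 \<and>
        (\<forall>x. x \<noteq> 0 \<longrightarrow> (\<psi>' has_real_derivative \<psi>'' x) (at x) \<and>
           - \<psi>'' x + potential \<beta> \<eta> x * \<psi> x = (l + 1 / 2) * \<psi> x) \<and>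
        integrable lborel (\<lambda>x. (\<psi> x)\<^sup>2) \<and>
        (\<exists>x. \<psi> x \<noteq> 0))"

definition spectral_gap :: "real \<Rightarrow> real \<Rightarrow> real" where
  "spectral_gap \<beta> \<eta> = least_positive (is_eigenvalue \<beta> \<eta>)"

text \<open>
  The bound \<open>p \<le> \<beta>\<^sup>2 / 4\<close> keeps the square root on its real domain;
  HOL's \<open>sqrt\<close> is total and odd.
\<close>

definition r0_equation :: "real \<Rightarrow> real \<Rightarrow> bool" where
  "r0_equation \<beta> p \<longleftrightarrow>
     p \<le> \<beta>\<^sup>2 / 4 \<and> pcD' p (- \<beta>) = sqrt (\<beta>\<^sup>2 / 4 - p) * pcD p (- \<beta>)"

definition r0 :: "real \<Rightarrow> real" where
  "r0 \<beta> = least_positive (r0_equation \<beta>)"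

definition V_tilde :: "real \<Rightarrow> real \<Rightarrow> real" where
  "V_tilde p \<beta> = pcD' p (- \<beta>) - pcD p (- \<beta>) * sqrt (\<beta>\<^sup>2 / 4 - p)"

definition A_coeff :: "real \<Rightarrow> real" where
  "A_coeff \<beta> =
     1 / 2 * ((\<beta> - sqrt (\<beta>\<^sup>2 - 4 * r0 \<beta>)) / (\<beta>\<^sup>2 - 4 * r0 \<beta>)) *
     pcD (r0 \<beta>) (- \<beta>) * inverse (deriv (\<lambda>p. V_tilde p \<beta>) (r0 \<beta>))"

end

theory Submission
  imports Defs "HOL-Complex_Analysis.Cauchy_Integral_Theorem" "HOL-Probability.Distributions"
    "HOL-Real_Asymp.Real_Asymp"
begin

text \<open>
  On the left half-line the only square-integrable solution is \<open>D\<^sub>l(- \<beta> - x)\<close>; on the right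
  half-line it is again a parabolic cylinder function, but all that matters is its slope \<open>M\<close> at
  \<open>0\<close>, so that \<open>l\<close> is an eigenvalue iff \<open>D\<^sub>l'(- \<beta>) = M D\<^sub>l(- \<beta>)\<close>. The slope solves a Riccati
  problem, and explicit WKB barriers give
  \<open>M = s + \<eta> (\<beta> - 2 s) / (8 s\<^sup>2) + O(\<eta>\<^sup>2)\<close> with \<open>s = sqrt (\<beta>\<^sup>2 / 4 - l)\<close>, uniformly in \<open>l\<close>.
  The Wronskian identity \<open>D\<^sub>p D\<^sub>q' - D\<^sub>q D\<^sub>p' = (q - p) \<integral> D\<^sub>p D\<^sub>q\<close> over \<open>[- \<beta>, \<infinity>)\<close> controls
  everything on the left: it shows that the limiting matching function has a simple zero at \<open>r0\<close>,
  gives its derivative there, and excludes eigenvalues near \<open>0\<close>.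
  For the existence of \<open>r0\<close> write \<open>(D, D')\<close> in polar coordinates with a continuous phase on the
  \<open>(\<nu>, z)\<close>-plane. Along the curve \<open>\<nu> = b\<^sup>2 / 4\<close>, \<open>z = - b\<close> the phase crosses multiples of \<open>\<pi>\<close>
  only upwards; it starts at \<open>0\<close>, reaches \<open>\<pi>\<close> at \<open>beta_star\<close> and exceeds \<open>\<pi>\<close> afterwards. For fixed
  \<open>\<beta> > beta_star\<close> it is below \<open>\<pi> / 2\<close> at \<open>\<nu> = 0\<close>, and the intermediate value theorem in \<open>\<nu>\<close>
  produces the root.
\<close>

section \<open>Contour integrals for the parabolic cylinder function\<close>

text \<open>Two obstacles shape the proof. On the right half-line both the index
  \<open>l / h\<close> and the argument \<open>b / sqrt h\<close> tend to infinity as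
  \<open>h\<close> tends to 0, so asymptotics of D at a fixed index say nothing there; Riccati
  comparison works instead because \<open>l\<close> is kept a fixed distance below
  \<open>b^2 / 4\<close>, which makes the coefficient nonnegative. On the left, smoothness of D in
  the index is awkward to extract from the integral; a Lipschitz bound suffices, since the Wronskian
  identity already gives the difference quotient of the matching function in closed form. Signs
  alone do not produce r0: D' on the curve may return to zero beyond \<open>beta_star\<close>, and
  only the phase remembers how many half-turns have been made. Moreover \<open>p = 0\<close> always
  solves the limiting equation, and 0 is always an eigenvalue (it belongs to the stationary
  density), so each minimality claim must first separate the positive roots from this trivial one.
  Finally, D is defined on the line Re u = 1, which hides its decay in z; the decay appears after
  moving the line to Re u = \<open>max 1 z\<close>, through the saddle point once z is at least
  1.\<close>

lemma exp_ge_power_over_fact: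
  fixes x :: real assumes "x \<ge> 0" shows "x ^ n / fact n \<le> exp x"
proof -
  have "(\<Sum>k\<in>{n}. x ^ k /\<^sub>R fact k) \<le> exp x"
    unfolding exp_def using assms by (intro sum_le_suminf summable_exp_generic) (auto simp: field_simps)
  then show ?thesis by (simp add: field_simps)
qed

lemma integrable_poly_exp_gauss:
  "integrable lborel (\<lambda>t::real. (1 + \<bar>t\<bar>) ^ n * exp (a * \<bar>t\<bar>) * exp (- t\<^sup>2 / 2))"
proof -
  define C where "C = fact n * exp 1 * exp ((1 + \<bar>a\<bar>)\<^sup>2)"
  have g: "integrable lborel (\<lambda>t::real. C * exp (- t\<^sup>2 / 4))"
  proof -
    have "integrable lborel (\<lambda>t. sqrt (2 * pi * 2) * normal_density 0 (sqrt 2) t)"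
      by (intro integrable_mult_right integrable_normal_density) simp
    then have "integrable lborel (\<lambda>t::real. exp (- t\<^sup>2 / 4))"
      by (simp add: normal_density_def)
    then show ?thesis by simp
  qed
  have bd: "(1 + \<bar>t\<bar>) ^ n * exp (a * \<bar>t\<bar>) * exp (- t\<^sup>2 / 2) \<le> C * exp (- t\<^sup>2 / 4)" for t :: real
  proof -
    have 1: "(1 + \<bar>t\<bar>) ^ n \<le> fact n * exp (1 + \<bar>t\<bar>)"
      using exp_ge_power_over_fact[of "1 + \<bar>t\<bar>" n] by (simp add: field_simps)
    have 2: "a * \<bar>t\<bar> \<le> \<bar>a\<bar> * \<bar>t\<bar>" by (simp add: mult_right_mono)
    \<comment> \<open>Expanding the square of
      \<open>(1 + \<bar>a\<bar>) - \<bar>t\<bar> / 2\<close>: half of the Gaussian exponent absorbs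
      the linear term.\<close>
    have 3: "(1 + \<bar>a\<bar>) * \<bar>t\<bar> \<le> (1 + \<bar>a\<bar>)\<^sup>2 + t\<^sup>2 / 4"
      using zero_le_power2[of "(1 + \<bar>a\<bar>) - \<bar>t\<bar> / 2"] by (simp add: power2_eq_square algebra_simps)
    have "(1 + \<bar>t\<bar>) ^ n * exp (a * \<bar>t\<bar>) * exp (- t\<^sup>2 / 2)
        \<le> fact n * exp (1 + \<bar>t\<bar>) * exp (\<bar>a\<bar> * \<bar>t\<bar>) * exp (- t\<^sup>2 / 2)"
      using 1 2 by (intro mult_right_mono mult_mono) auto
    also have "\<dots> = fact n * exp (1 + (1 + \<bar>a\<bar>) * \<bar>t\<bar> - t\<^sup>2 / 2)"
      unfolding mult.assoc exp_add[symmetric] by (simp add: algebra_simps)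
    also have "\<dots> \<le> fact n * exp (1 + (1 + \<bar>a\<bar>)\<^sup>2 - t\<^sup>2 / 4)"
      using 3 by simp
    also have "\<dots> = C * exp (- t\<^sup>2 / 4)"
      by (simp add: C_def mult.assoc flip: exp_add)
    finally show ?thesis .
  qed
  show ?thesis
    by (rule Bochner_Integration.integrable_bound[OF g])
       (auto simp: abs_mult C_def intro!: order.trans[OF bd, unfolded C_def, simplified] AE_I2)
qed

definition pc_kernel :: "real \<Rightarrow> real \<Rightarrow> complex \<Rightarrow> complex" where
  "pc_kernel \<nu> z u = u powr of_real \<nu> * exp (- of_real z * u) * exp (u\<^sup>2 / 2)"

text \<open>The factor i of \<open>du = i dt\<close> cancels the one in the prefactor of
  \<open>pcf\<close>. The abscissa \<open>c\<close> stays a parameter so that the line can be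
  adapted to \<open>z\<close>.\<close>

definition pc_int :: "real \<Rightarrow> real \<Rightarrow> real \<Rightarrow> complex" where
  "pc_int \<nu> z c = (LINT t|lborel. pc_kernel \<nu> z (Complex c t))"

lemma norm_cpowr_of_real: "(u::complex) \<noteq> 0 \<Longrightarrow> norm (u powr of_real \<nu>) = norm u powr \<nu>"
  by (simp add: powr_def)

lemma norm_pc_kernel:
  assumes "c > 0"
  shows "norm (pc_kernel \<nu> z (Complex c t)) =
    norm (Complex c t) powr \<nu> * exp (- z * c + c\<^sup>2 / 2) * exp (- t\<^sup>2 / 2)"
proof -
  have "Complex c t \<noteq> 0" using assms by (auto simp: complex_eq_iff)
  moreover have "Re ((Complex c t)\<^sup>2 / 2) = c\<^sup>2 / 2 - t\<^sup>2 / 2"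
    by (simp add: power2_eq_square diff_divide_distrib)
  ultimately show ?thesis
    by (simp add: pc_kernel_def norm_mult norm_cpowr_of_real norm_exp_eq_Re flip: exp_add)
qed

lemma norm_Complex_le:
  assumes "c \<ge> 1" shows "norm (Complex c t) \<le> c * (1 + \<bar>t\<bar>)" "1 \<le> norm (Complex c t)"
proof -
  have "norm (Complex c t) \<le> c + \<bar>t\<bar>" using cmod_le[of "Complex c t"] assms by simp
  also have "\<dots> \<le> c * (1 + \<bar>t\<bar>)" using assms by (simp add: algebra_simps mult_le_cancel_right1)
  finally show "norm (Complex c t) \<le> c * (1 + \<bar>t\<bar>)" .
  show "1 \<le> norm (Complex c t)"
    using abs_Re_le_cmod[of "Complex c t"] assms by simp
qed

text \<open>On a line with abscissa at least 1 the modulus of u is at least 1, so powers increase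
  with the exponent; one natural \<open>n\<close> then serves all indices up to \<open>n\<close>,
  negative ones included.\<close>

lemma norm_Complex_powr_le:
  assumes "c \<ge> 1" "\<nu> \<le> real n" shows "norm (Complex c t) powr \<nu> \<le> c ^ n * (1 + \<bar>t\<bar>) ^ n"
proof -
  note N = norm_Complex_le[OF assms(1), of t]
  have "norm (Complex c t) powr \<nu> \<le> norm (Complex c t) powr real n"
    using N assms by (intro powr_mono) auto
  also have "\<dots> = norm (Complex c t) ^ n"
    using N by (subst powr_realpow) auto
  also have "\<dots> \<le> (c * (1 + \<bar>t\<bar>)) ^ n"
    using N by (intro power_mono) auto
  finally show ?thesis by (simp add: power_mult_distrib)
qed

lemma norm_pc_kernel_le:
  assumes "c \<ge> 1" "\<nu> \<le> real n"
  shows "norm (pc_kernel \<nu> z (Complex c t)) \<le>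
    exp (- z * c + c\<^sup>2 / 2) * c ^ n * ((1 + \<bar>t\<bar>) ^ n * exp (- t\<^sup>2 / 2))"
proof -
  have "norm (pc_kernel \<nu> z (Complex c t)) =
      exp (- z * c + c\<^sup>2 / 2) * (norm (Complex c t) powr \<nu>) * exp (- t\<^sup>2 / 2)"
    using assms by (simp add: norm_pc_kernel)
  also have "\<dots> \<le> exp (- z * c + c\<^sup>2 / 2) * (c ^ n * (1 + \<bar>t\<bar>) ^ n) * exp (- t\<^sup>2 / 2)"
    using assms by (intro mult_right_mono mult_left_mono norm_Complex_powr_le) auto
  finally show ?thesis by (simp add: algebra_simps)
qed

lemma Complex_conv_line: "Complex c = (\<lambda>t. of_real c + \<i> * of_real t)"
  by (auto simp: complex_eq_iff)

lemma continuous_pc_kernel: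
  assumes "c > 0" shows "continuous_on UNIV (\<lambda>t. pc_kernel \<nu> z (Complex c t))"
  unfolding pc_kernel_def Complex_conv_line
  using assms by (intro continuous_intros) (auto simp: complex_nonpos_Reals_iff complex_eq_iff)

definition gauss_moment :: "nat \<Rightarrow> real" where
  "gauss_moment n = (LINT t|lborel. (1 + \<bar>t\<bar>) ^ n * exp (- t\<^sup>2 / 2))"

lemma integrable_gauss_moment: "integrable lborel (\<lambda>t::real. (1 + \<bar>t\<bar>) ^ n * exp (- t\<^sup>2 / 2))"
  using integrable_poly_exp_gauss[of n 0] by simp

lemma integrable_pc_kernel:
  assumes "c \<ge> 1" shows "integrable lborel (\<lambda>t. pc_kernel \<nu> z (Complex c t))"
proof -
  obtain n where n: "\<nu> \<le> real n" using real_arch_simple by blast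
  show ?thesis
    by (rule Bochner_Integration.integrable_bound[OF integrable_mult_right[OF integrable_gauss_moment[of n], of "exp (- z * c + c\<^sup>2 / 2) * c ^ n"]])
      (use assms norm_pc_kernel_le[OF assms n, of z]
        borel_measurable_continuous_onI[OF continuous_pc_kernel, of c] in auto)
qed

lemma norm_pc_int_le:
  assumes "c \<ge> 1" "\<nu> \<le> real n"
  shows "norm (pc_int \<nu> z c) \<le> exp (- z * c + c\<^sup>2 / 2) * c ^ n * gauss_moment n"
proof -
  have "norm (pc_int \<nu> z c) \<le> (LINT t|lborel. exp (- z * c + c\<^sup>2 / 2) * c ^ n * ((1 + \<bar>t\<bar>) ^ n * exp (- t\<^sup>2 / 2)))"
    unfolding pc_int_def
  proof (rule Bochner_Integration.integral_norm_bound_integral)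
    show "integrable lborel (\<lambda>t. exp (- z * c + c\<^sup>2 / 2) * c ^ n * ((1 + \<bar>t\<bar>) ^ n * exp (- t\<^sup>2 / 2)))"
      using integrable_gauss_moment by (rule integrable_mult_right)
  qed (use assms norm_pc_kernel_le integrable_pc_kernel in auto)
  then show ?thesis by (simp add: gauss_moment_def)
qed

lemma power_exp_gauss_tendsto_0:
  "(\<lambda>N. (1 + real N) ^ n * exp (- (real N)\<^sup>2 / 2)) \<longlonglongrightarrow> 0"
  by real_asymp

lemma LINT_eq_primitive_limit:
  fixes f F :: "real \<Rightarrow> complex"
  assumes int: "integrable lborel f" and cont: "continuous_on UNIV f"
    and F: "\<And>t. (F has_vector_derivative f t) (at t)"
  shows "(\<lambda>N. F (real N) - F (- real N)) \<longlonglongrightarrow> (LINT t|lborel. f t)"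
proof -
  have "(\<lambda>N. LINT t|lborel. indicator {- real N..real N} t *\<^sub>R f t) \<longlonglongrightarrow> (LINT t|lborel. f t)"
  proof (rule integral_dominated_convergence[where w="\<lambda>t. norm (f t)"])
    show "AE t in lborel. (\<lambda>N. indicator {- real N..real N} t *\<^sub>R f t) \<longlonglongrightarrow> f t"
    proof (intro AE_I2 tendsto_eventually)
      fix t :: real
      obtain N0 where "\<bar>t\<bar> \<le> real N0" using real_arch_simple by blast
      then show "\<forall>\<^sub>F N in sequentially. indicator {- real N..real N} t *\<^sub>R f t = f t"
        by (intro eventually_sequentiallyI[of N0]) (auto simp: indicator_def)
    qed
  qed (use int cont in \<open>auto simp: indicator_def\<close>)
  moreover have "(LINT t|lborel. indicator {- real N..real N} t *\<^sub>R f t) = F (real N) - F (- real N)" for N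
    by (rule integral_FTC_Icc)
       (use F cont in \<open>auto intro: has_vector_derivative_at_within continuous_on_subset\<close>)
  ultimately show ?thesis by simp
qed

lemma pc_kernel_holomorphic: "(pc_kernel \<nu> z) holomorphic_on {u. Re u > 0}"
  unfolding pc_kernel_def by (intro holomorphic_intros) (auto simp: complex_nonpos_Reals_iff)

lemma Complex_has_vector_derivative: "(Complex c has_vector_derivative \<i>) (at t)"
  unfolding Complex_conv_line by (auto intro!: derivative_eq_intros)

text \<open>Cauchy's theorem by way of a primitive \<open>G\<close> on the right half-plane: each
  line integral is a limit of increments of \<open>G\<close>. Two lines differ by horizontal
  segments at height \<open>N\<close> of length at most \<open>c\<close>, on which the kernel is of
  order \<open>N^n exp (- N^2 / 2)\<close>.\<close>

lemma pc_int_shift: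
  assumes c: "c \<ge> 1" shows "pc_int \<nu> z c = pc_int \<nu> z 1"
proof -
  define S where "S = {u::complex. Re u > 0}"
  have S: "convex S" "open S" unfolding S_def by (auto simp: convex_halfspace_Re_gt open_halfspace_Re_gt)
  obtain G where G: "\<And>u. u \<in> S \<Longrightarrow> (G has_field_derivative pc_kernel \<nu> z u) (at u)"
    using holomorphic_convex_primitive'[OF S(1) S(2) pc_kernel_holomorphic[of \<nu> z, folded S_def]] S
    by (metis at_within_open)
  have CS: "Complex d t \<in> S" if "d \<ge> 1" for d t using that by (simp add: S_def)
  have lim: "(\<lambda>N. - \<i> * G (Complex d (real N)) - - \<i> * G (Complex d (- real N))) \<longlonglongrightarrow> pc_int \<nu> z d"
    if d: "d \<ge> 1" for d
    unfolding pc_int_def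
  proof (rule LINT_eq_primitive_limit)
    show "continuous_on UNIV (\<lambda>t. pc_kernel \<nu> z (Complex d t))"
      using d by (intro continuous_pc_kernel) auto
    have "((\<lambda>t. G (Complex d t)) has_vector_derivative \<i> * pc_kernel \<nu> z (Complex d t)) (at t)" for t
      using field_vector_diff_chain_at[OF Complex_has_vector_derivative G[OF CS[OF d]]] by (simp add: o_def)
    from has_vector_derivative_mult_right[OF this, of "- \<i>"]
    show "((\<lambda>t. - \<i> * G (Complex d t)) has_vector_derivative pc_kernel \<nu> z (Complex d t)) (at t)" for t
      by (simp flip: mult.assoc)
  qed (use d integrable_pc_kernel in auto)
  obtain n where n: "\<nu> \<le> real n" using real_arch_simple by blast
  \<comment> \<open>\<open>K\<close> bounds the height-independent factor of the kernel for all
    abscissas in \<open>[1, c]\<close> at once and for either sign of \<open>z\<close>.\<close>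
  define K where "K = exp (\<bar>z\<bar> * c + c\<^sup>2 / 2) * c ^ n"
  define e where "e = (\<lambda>N. c * K * ((1 + real N) ^ n * exp (- (real N)\<^sup>2 / 2)))"
  have diff: "norm (G (Complex c s) - G (Complex 1 s)) \<le> e N" if s: "\<bar>s\<bar> = real N" for s N
  proof -
    define A where "A = closed_segment (Complex 1 s) (Complex c s)"
    have inA: "\<exists>d. 1 \<le> d \<and> d \<le> c \<and> u = Complex d s" if "u \<in> A" for u
    proof -
      from that obtain r where r: "0 \<le> r" "r \<le> 1" "u = (1 - r) *\<^sub>R Complex 1 s + r *\<^sub>R Complex c s"
        unfolding A_def closed_segment_def by auto
      have "u = Complex (1 + r * (c - 1)) s" using r by (simp add: complex_eq_iff algebra_simps)
      moreover have "r * (c - 1) \<le> 1 * (c - 1)" using r c by (intro mult_right_mono) auto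
      moreover have "0 \<le> r * (c - 1)" using r c by simp
      ultimately show ?thesis by (intro exI[of _ "1 + r * (c - 1)"]) auto
    qed
    have "norm (G (Complex c s) - G (Complex 1 s)) \<le> K * ((1 + real N) ^ n * exp (- (real N)\<^sup>2 / 2)) * norm (Complex c s - Complex 1 s)"
    proof (rule field_differentiable_bound)
      show "convex A" by (simp add: A_def)
      fix u assume "u \<in> A"
      then obtain d where d: "1 \<le> d" "d \<le> c" "u = Complex d s" using inA by blast
      show "(G has_field_derivative pc_kernel \<nu> z u) (at u within A)"
        using d has_field_derivative_at_within[OF G[of u]] by (simp add: S_def)
      have "exp (- z * d + d\<^sup>2 / 2) * d ^ n \<le> K"
      proof -
        have "- z * d \<le> \<bar>z\<bar> * d" using d by (intro mult_right_mono) auto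
        also have "\<dots> \<le> \<bar>z\<bar> * c" using d by (intro mult_left_mono) auto
        finally have "- z * d \<le> \<bar>z\<bar> * c" .
        moreover have "d\<^sup>2 \<le> c\<^sup>2" using d by (intro power_mono) auto
        moreover have "d ^ n \<le> c ^ n" using d by (intro power_mono) auto
        ultimately show ?thesis unfolding K_def using d by (intro mult_mono iffD2[OF exp_le_cancel_iff] add_mono divide_right_mono) auto
      qed
      then have "exp (- z * d + d\<^sup>2 / 2) * d ^ n * ((1 + \<bar>s\<bar>) ^ n * exp (- s\<^sup>2 / 2)) \<le> K * ((1 + \<bar>s\<bar>) ^ n * exp (- s\<^sup>2 / 2))"
        by (intro mult_right_mono) auto
      then have "norm (pc_kernel \<nu> z u) \<le> K * ((1 + \<bar>s\<bar>) ^ n * exp (- s\<^sup>2 / 2))"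
        unfolding d(3) by (rule order_trans[OF norm_pc_kernel_le[OF d(1) n]])
      then show "norm (pc_kernel \<nu> z u) \<le> K * ((1 + real N) ^ n * exp (- (real N)\<^sup>2 / 2))"
        using s by (metis power2_abs)
    qed (auto simp: A_def)
    also have "norm (Complex c s - Complex 1 s) = c - 1"
    proof -
      have "Complex c s - Complex 1 s = of_real (c - 1)" by (simp add: complex_eq_iff)
      then show ?thesis using c by (simp only: norm_of_real)
    qed
    also have "K * ((1 + real N) ^ n * exp (- (real N)\<^sup>2 / 2)) * (c - 1) \<le> e N"
      unfolding e_def K_def using c by (simp add: algebra_simps)
    finally show ?thesis .
  qed
  have e0: "e \<longlonglongrightarrow> 0"
    unfolding e_def using tendsto_mult_right_zero[OF power_exp_gauss_tendsto_0] by blast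
  have "(\<lambda>N. (- \<i> * G (Complex c (real N)) - - \<i> * G (Complex c (- real N))) -
      (- \<i> * G (Complex 1 (real N)) - - \<i> * G (Complex 1 (- real N)))) \<longlonglongrightarrow> 0"
  proof (rule Lim_null_comparison)
    show "(\<lambda>N. 2 * e N) \<longlonglongrightarrow> 0" using tendsto_mult_right_zero[OF e0] by blast
    show "\<forall>\<^sub>F N in sequentially. norm ((- \<i> * G (Complex c (real N)) - - \<i> * G (Complex c (- real N))) -
      (- \<i> * G (Complex 1 (real N)) - - \<i> * G (Complex 1 (- real N)))) \<le> 2 * e N"
    proof (rule always_eventually, rule allI)
      fix N
      have "(- \<i> * G (Complex c (real N)) - - \<i> * G (Complex c (- real N))) -
        (- \<i> * G (Complex 1 (real N)) - - \<i> * G (Complex 1 (- real N))) =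
        - \<i> * ((G (Complex c (real N)) - G (Complex 1 (real N))) - (G (Complex c (- real N)) - G (Complex 1 (- real N))))"
        by (simp add: algebra_simps)
      also have "norm \<dots> \<le> norm (G (Complex c (real N)) - G (Complex 1 (real N))) + norm (G (Complex c (- real N)) - G (Complex 1 (- real N)))"
        unfolding norm_mult by (simp add: norm_triangle_ineq4)
      also have "\<dots> \<le> e N + e N" by (intro add_mono diff) auto
      finally show "norm ((- \<i> * G (Complex c (real N)) - - \<i> * G (Complex c (- real N))) -
        (- \<i> * G (Complex 1 (real N)) - - \<i> * G (Complex 1 (- real N)))) \<le> 2 * e N" by simp
    qed
  qed
  moreover have "(\<lambda>N. (- \<i> * G (Complex c (real N)) - - \<i> * G (Complex c (- real N))) -
      (- \<i> * G (Complex 1 (real N)) - - \<i> * G (Complex 1 (- real N)))) \<longlonglongrightarrow> pc_int \<nu> z c - pc_int \<nu> z 1"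
    by (intro tendsto_diff[OF lim[OF c] lim]) simp
  ultimately show ?thesis using LIMSEQ_unique by fastforce
qed

section \<open>Derivative in the argument, recurrence, and Weber's equation\<close>

lemma has_vector_derivative_quadratic:
  fixes f :: "real \<Rightarrow> 'a::real_normed_vector"
  assumes "\<And>h. \<bar>h\<bar> \<le> 1 \<Longrightarrow> norm (f (x + h) - f x - h *\<^sub>R f') \<le> K * h\<^sup>2"
  shows "(f has_vector_derivative f') (at x)"
proof -
  have "((\<lambda>h. norm (f (x + h) - f x - h *\<^sub>R f') / norm h) \<longlongrightarrow> 0) (at 0)"
  proof (rule Lim_null_comparison)
    show "\<forall>\<^sub>F h in at 0. norm (norm (f (x + h) - f x - h *\<^sub>R f') / norm h) \<le> K * \<bar>h\<bar>"
      unfolding eventually_at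
    proof (intro exI[of _ 1] conjI ballI impI)
      fix h :: real assume "h \<noteq> 0 \<and> dist h 0 < 1"
      then show "norm (norm (f (x + h) - f x - h *\<^sub>R f') / norm h) \<le> K * \<bar>h\<bar>"
        using assms[of h] by (simp add: divide_le_eq power2_eq_square mult.assoc)
    qed simp
    show "((\<lambda>h. K * \<bar>h\<bar>) \<longlongrightarrow> 0) (at (0::real))"
      by (auto intro!: tendsto_eq_intros)
  qed
  then show ?thesis
    by (simp add: has_vector_derivative_def has_derivative_at bounded_linear_scaleR_left)
qed

lemma pc_kernel_Suc: "u \<noteq> 0 \<Longrightarrow> pc_kernel (\<nu> + 1) z u = u * pc_kernel \<nu> z u"
  by (simp add: pc_kernel_def powr_add)

text \<open>Differentiating \<open>exp (- z u)\<close> brings down \<open>- u\<close>, which raises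
  the index by one. The second-order Taylor remainder costs two more powers of u, still integrable
  against the Gaussian.\<close>

lemma pc_int_has_vector_derivative:
  "((\<lambda>z. pc_int \<nu> z 1) has_vector_derivative - pc_int (\<nu> + 1) z 1) (at z)"
proof -
  obtain n where n: "\<nu> \<le> real n" using real_arch_simple by blast
  define K where "K = exp 1 * exp (- z + 1 / 2)"
  show ?thesis
  proof (rule has_vector_derivative_quadratic[where K="K * gauss_moment (n + 2)"])
    fix h :: real assume h: "\<bar>h\<bar> \<le> 1"
    define r where "r t = (pc_kernel \<nu> (z + h) (Complex 1 t) - pc_kernel \<nu> z (Complex 1 t)) +
        of_real h * pc_kernel (\<nu> + 1) z (Complex 1 t)" for t
    have int: "integrable lborel (\<lambda>t. pc_kernel \<mu> y (Complex 1 t))" for \<mu> y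
      by (rule integrable_pc_kernel) simp
    have "pc_int \<nu> (z + h) 1 - pc_int \<nu> z 1 - h *\<^sub>R - pc_int (\<nu> + 1) z 1 = (LINT t|lborel. r t)"
      unfolding r_def pc_int_def by (simp add: int scaleR_conv_of_real)
    also have "norm \<dots> \<le> (LINT t|lborel. (K * h\<^sup>2) * ((1 + \<bar>t\<bar>) ^ (n + 2) * exp (- t\<^sup>2 / 2)))"
    proof (rule Bochner_Integration.integral_norm_bound_integral)
      show "integrable lborel r" unfolding r_def by (simp add: int)
      show "integrable lborel (\<lambda>t. K * h\<^sup>2 * ((1 + \<bar>t\<bar>) ^ (n + 2) * exp (- t\<^sup>2 / 2)))"
        using integrable_gauss_moment by (rule integrable_mult_right)
      fix t :: real
      define u where "u = Complex 1 t"
      have u: "u \<noteq> 0" "Re u = 1" "norm u \<le> 1 + \<bar>t\<bar>"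
        using norm_Complex_le[of 1 t] by (auto simp: u_def complex_eq_iff)
      have "r t = pc_kernel \<nu> z u * (exp (- of_real h * u) - (1 + (- of_real h * u)))"
        unfolding r_def u_def[symmetric] pc_kernel_Suc[OF u(1)]
        by (simp add: pc_kernel_def algebra_simps flip: exp_add)
      moreover have "norm (exp (- of_real h * u) - (1 + (- of_real h * u))) \<le> exp 1 * (h\<^sup>2 * (1 + \<bar>t\<bar>)\<^sup>2)"
      proof -
        \<comment> \<open>The Taylor bound involves only the real part of the exponent, and Re u =
          1, so the exponential factor is at most \<open>exp 1\<close> uniformly in
          \<open>t\<close>.\<close>
        have "norm (exp (- of_real h * u) - (1 + (- of_real h * u))) \<le> exp \<bar>h\<bar> * (norm (of_real h * u))\<^sup>2"
          using Taylor_exp[of "- of_real h * u" 1] u(2) by (simp add: power2_eq_square)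
        also have "(norm (of_real h * u))\<^sup>2 = h\<^sup>2 * (norm u)\<^sup>2"
          by (simp add: norm_mult power_mult_distrib)
        also have "exp \<bar>h\<bar> * (h\<^sup>2 * (norm u)\<^sup>2) \<le> exp 1 * (h\<^sup>2 * (1 + \<bar>t\<bar>)\<^sup>2)"
          using h power_mono[OF u(3), of 2] by (intro mult_mono mult_left_mono) auto
        finally show ?thesis .
      qed
      moreover have "norm (pc_kernel \<nu> z u) \<le> exp (- z + 1 / 2) * ((1 + \<bar>t\<bar>) ^ n * exp (- t\<^sup>2 / 2))"
        using norm_pc_kernel_le[of 1 \<nu> n z t] n by (simp add: u_def)
      ultimately have "norm (r t) \<le> (exp (- z + 1 / 2) * ((1 + \<bar>t\<bar>) ^ n * exp (- t\<^sup>2 / 2))) * (exp 1 * (h\<^sup>2 * (1 + \<bar>t\<bar>)\<^sup>2))"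
        unfolding norm_mult by (simp only: norm_mult) (intro mult_mono; simp)
      also have "\<dots> = K * h\<^sup>2 * ((1 + \<bar>t\<bar>) ^ (n + 2) * exp (- t\<^sup>2 / 2))"
        by (simp only: K_def power_add mult_ac)
      finally show "norm (r t) \<le> K * h\<^sup>2 * ((1 + \<bar>t\<bar>) ^ (n + 2) * exp (- t\<^sup>2 / 2))" .
    qed
    also have "\<dots> = K * gauss_moment (n + 2) * h\<^sup>2"
      by (simp add: gauss_moment_def)
    finally show "norm (pc_int \<nu> (z + h) 1 - pc_int \<nu> z 1 - h *\<^sub>R - pc_int (\<nu> + 1) z 1) \<le> K * gauss_moment (n + 2) * h\<^sup>2" .
  qed
qed

text \<open>Integration by parts: the u-derivative of
  \<open>u^(\<nu>+1) exp (- z u + u^2 / 2)\<close> is the combination of the three kernels, and its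
  integral vanishes because the boundary values decay.\<close>

lemma pc_int_recurrence:
  "pc_int (\<nu> + 2) z 1 = of_real z * pc_int (\<nu> + 1) z 1 - of_real (\<nu> + 1) * pc_int \<nu> z 1"
proof -
  define f where "f t = (of_real (\<nu> + 1) * pc_kernel \<nu> z (Complex 1 t) - of_real z * pc_kernel (\<nu> + 1) z (Complex 1 t))
      + pc_kernel (\<nu> + 2) z (Complex 1 t)" for t
  define F where "F t = - \<i> * pc_kernel (\<nu> + 1) z (Complex 1 t)" for t
  have int: "integrable lborel (\<lambda>t. pc_kernel \<mu> y (Complex 1 t))" for \<mu> y
    by (rule integrable_pc_kernel) simp
  have lim: "(\<lambda>N. F (real N) - F (- real N)) \<longlonglongrightarrow> (LINT t|lborel. f t)"
  proof (rule LINT_eq_primitive_limit)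
    show "integrable lborel f" unfolding f_def by (simp add: int)
    show "continuous_on UNIV f"
      unfolding f_def by (intro continuous_intros continuous_pc_kernel) auto
    fix t
    define u where "u = Complex 1 t"
    have u0: "u \<noteq> 0" "u \<notin> \<real>\<^sub>\<le>\<^sub>0" by (auto simp: u_def complex_eq_iff complex_nonpos_Reals_iff)
    have p1: "pc_kernel (\<nu> + 1) z u = u * pc_kernel \<nu> z u" "pc_kernel (\<nu> + 2) z u = u * (u * pc_kernel \<nu> z u)"
      using pc_kernel_Suc[OF u0(1), of \<nu> z] pc_kernel_Suc[OF u0(1), of "\<nu> + 1" z] by (simp_all add: add.assoc)
    have "(pc_kernel (\<nu> + 1) z has_field_derivative f t) (at u)"
    proof -
      have pw: "u powr (of_real (\<nu> + 1) - 1) = u powr of_real \<nu>" "u powr of_real (\<nu> + 1) = u * u powr of_real \<nu>"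
        using u0 by (simp_all add: powr_add)
      have *: "(pc_kernel (\<nu> + 1) z has_field_derivative
          (of_real (\<nu> + 1) * u powr (of_real (\<nu> + 1) - 1)) * exp (- of_real z * u) * exp (u\<^sup>2 / 2)
          + u powr of_real (\<nu> + 1) * (exp (- of_real z * u) * (- of_real z)) * exp (u\<^sup>2 / 2)
          + u powr of_real (\<nu> + 1) * exp (- of_real z * u) * (exp (u\<^sup>2 / 2) * u)) (at u)"
        unfolding pc_kernel_def
        using u0 by (auto intro!: derivative_eq_intros has_field_derivative_powr simp: field_simps)
      show ?thesis
        by (rule DERIV_cong[OF *], unfold pw)
           (simp add: f_def p1 flip: u_def, simp add: pc_kernel_def algebra_simps)
    qed
    from field_vector_diff_chain_at[OF Complex_has_vector_derivative[of 1 t] this[unfolded u_def]]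
    have "((\<lambda>t. pc_kernel (\<nu> + 1) z (Complex 1 t)) has_vector_derivative \<i> * f t) (at t)"
      by (simp add: o_def)
    from has_vector_derivative_mult_right[OF this, of "- \<i>"]
    show "(F has_vector_derivative f t) (at t)"
      by (simp add: F_def[abs_def] flip: mult.assoc)
  qed
  obtain n where n: "\<nu> + 1 \<le> real n" using real_arch_simple by blast
  have F0: "(F \<circ> s) \<longlonglongrightarrow> 0" if s: "\<And>N. \<bar>s N\<bar> = real N" for s :: "nat \<Rightarrow> real"
  proof (rule Lim_null_comparison)
    show "(\<lambda>N. exp (- z + 1 / 2) * ((1 + real N) ^ n * exp (- (real N)\<^sup>2 / 2))) \<longlonglongrightarrow> 0"
      using tendsto_mult_right_zero[OF power_exp_gauss_tendsto_0] by blast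
    show "\<forall>\<^sub>F N in sequentially. norm ((F \<circ> s) N) \<le> exp (- z + 1 / 2) * ((1 + real N) ^ n * exp (- (real N)\<^sup>2 / 2))"
    proof (rule always_eventually, rule allI)
      fix N
      have "(s N)\<^sup>2 = (real N)\<^sup>2" using s by (metis power2_abs)
      then show "norm ((F \<circ> s) N) \<le> exp (- z + 1 / 2) * ((1 + real N) ^ n * exp (- (real N)\<^sup>2 / 2))"
        using norm_pc_kernel_le[of 1 "\<nu> + 1" n z "s N"] n s[of N] by (simp add: F_def norm_mult)
    qed
  qed
  have "(\<lambda>N. F (real N) - F (- real N)) \<longlonglongrightarrow> 0 - 0"
    using tendsto_diff[OF F0[of real] F0[of "\<lambda>N. - real N"]] by (simp add: o_def)
  then have "(LINT t|lborel. f t) = 0" using lim LIMSEQ_unique by fastforce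
  then have "of_real (\<nu> + 1) * pc_int \<nu> z 1 - of_real z * pc_int (\<nu> + 1) z 1 + pc_int (\<nu> + 2) z 1 = 0"
    unfolding f_def pc_int_def by (simp add: int)
  then show ?thesis by (simp add: algebra_simps)
qed

section \<open>Dependence on the index, decay in the argument, nontriviality\<close>

lemma norm_Ln_le_5:
  assumes "norm (u::complex) \<ge> 1" shows "norm (Ln u) \<le> 5 * norm u"
proof -
  have u: "u \<noteq> 0" using assms by auto
  have "norm (Ln u) \<le> \<bar>Re (Ln u)\<bar> + \<bar>Im (Ln u)\<bar>" by (rule cmod_le)
  moreover have "\<bar>Re (Ln u)\<bar> \<le> norm u"
    using u assms ln_le_minus_one[of "norm u"] by simp
  \<comment> \<open>The 5 is 1 for the real part plus 4 for the argument, which is at most pi <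
    4.\<close>
  moreover have "\<bar>Im (Ln u)\<bar> \<le> 4 * norm u"
    using mpi_less_Im_Ln[OF u] Im_Ln_le_pi[OF u] pi_less_4 assms by (auto simp: abs_le_iff)
  ultimately show ?thesis by linarith
qed

text \<open>The quotient of the kernels is \<open>exp w\<close> with
  \<open>w = (p - q) Ln u\<close>. Since \<open>\<bar>p - q\<bar> \<le> 1\<close>, the factor
  \<open>exp \<bar>Re w\<bar>\<close> costs one power of the modulus of u and \<open>Ln u\<close>
  another: the first is covered by \<open>q + 1 \<le> n\<close>, the second raises \<open>n\<close>
  to \<open>n + 1\<close>.\<close>

lemma norm_pc_int_diff_le:
  assumes c: "c \<ge> 1" and q: "q + 1 \<le> real n" and pq: "\<bar>p - q\<bar> \<le> 1"
  shows "norm (pc_int p z c - pc_int q z c) \<le>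
    5 * \<bar>p - q\<bar> * (exp (- z * c + c\<^sup>2 / 2) * c ^ (n + 1) * gauss_moment (n + 1))"
proof -
  have int: "integrable lborel (\<lambda>t. pc_kernel \<mu> y (Complex c t))" for \<mu> y
    by (rule integrable_pc_kernel) (use c in simp)
  define E where "E = 5 * \<bar>p - q\<bar> * (exp (- z * c + c\<^sup>2 / 2) * c ^ (n + 1))"
  have "pc_int p z c - pc_int q z c = (LINT t|lborel. pc_kernel p z (Complex c t) - pc_kernel q z (Complex c t))"
    unfolding pc_int_def by (simp add: int)
  also have "norm \<dots> \<le> (LINT t|lborel. E * ((1 + \<bar>t\<bar>) ^ (n + 1) * exp (- t\<^sup>2 / 2)))"
  proof (rule Bochner_Integration.integral_norm_bound_integral)
    show "integrable lborel (\<lambda>t. pc_kernel p z (Complex c t) - pc_kernel q z (Complex c t))" by (simp add: int)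
    show "integrable lborel (\<lambda>t. E * ((1 + \<bar>t\<bar>) ^ (n + 1) * exp (- t\<^sup>2 / 2)))"
      using integrable_gauss_moment by (rule integrable_mult_right)
    fix t
    define u where "u = Complex c t"
    have u: "u \<noteq> 0" "norm u \<ge> 1" "norm u \<le> c * (1 + \<bar>t\<bar>)"
      using norm_Complex_le[OF c, of t] c by (auto simp: u_def complex_eq_iff)
    define w where "w = of_real (p - q) * Ln u"
    have "pc_kernel p z u - pc_kernel q z u = pc_kernel q z u * (exp w - 1)"
      using u(1) by (simp add: pc_kernel_def powr_def w_def algebra_simps exp_diff)
    moreover have "norm (exp w - 1) \<le> norm u * (5 * \<bar>p - q\<bar> * norm u)"
    proof -
      have "norm (exp w - 1) \<le> exp \<bar>Re w\<bar> * norm w" using Taylor_exp[of w 0] by simp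
      also have "\<bar>Re w\<bar> \<le> ln (norm u)"
      proof -
        have "\<bar>Re w\<bar> = \<bar>p - q\<bar> * ln (norm u)" using u by (simp add: w_def abs_mult)
        also have "\<dots> \<le> 1 * ln (norm u)" using u pq by (intro mult_right_mono) auto
        finally show ?thesis by simp
      qed
      also have "exp (ln (norm u)) = norm u" using u by simp
      also have "norm w \<le> 5 * \<bar>p - q\<bar> * norm u"
        using mult_left_mono[OF norm_Ln_le_5[OF u(2)], of "\<bar>p - q\<bar>"] by (simp only: w_def norm_mult norm_of_real) (simp add: mult_ac)
      finally show ?thesis by (simp add: mult_right_mono mult_left_mono)
    qed
    ultimately have "norm (pc_kernel p z u - pc_kernel q z u) \<le> norm (pc_kernel q z u) * (norm u * (5 * \<bar>p - q\<bar> * norm u))"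
      by (simp only: norm_mult) (intro mult_left_mono; simp)
    also have "\<dots> = 5 * \<bar>p - q\<bar> * exp (- z * c + c\<^sup>2 / 2) * (norm u powr q * norm u powr 1) * norm u * exp (- t\<^sup>2 / 2)"
      using c u by (simp add: norm_pc_kernel u_def)
    also have "norm u powr q * norm u powr 1 = norm u powr (q + 1)" by (simp add: powr_add)
    also have "5 * \<bar>p - q\<bar> * exp (- z * c + c\<^sup>2 / 2) * norm u powr (q + 1) * norm u * exp (- t\<^sup>2 / 2)
       \<le> 5 * \<bar>p - q\<bar> * exp (- z * c + c\<^sup>2 / 2) * (c ^ n * (1 + \<bar>t\<bar>) ^ n) * (c * (1 + \<bar>t\<bar>)) * exp (- t\<^sup>2 / 2)"
      using norm_Complex_powr_le[OF c q, of t] u c by (intro mult_right_mono mult_mono) (auto simp: u_def)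
    also have "\<dots> = E * ((1 + \<bar>t\<bar>) ^ (n + 1) * exp (- t\<^sup>2 / 2))"
      by (simp add: E_def algebra_simps)
    finally show "norm (pc_kernel p z (Complex c t) - pc_kernel q z (Complex c t)) \<le> E * ((1 + \<bar>t\<bar>) ^ (n + 1) * exp (- t\<^sup>2 / 2))"
      by (simp add: u_def)
  qed
  also have "\<dots> = 5 * \<bar>p - q\<bar> * (exp (- z * c + c\<^sup>2 / 2) * c ^ (n + 1) * gauss_moment (n + 1))"
    by (simp add: gauss_moment_def E_def)
  finally show ?thesis .
qed

lemma pcD_eq_pc_int: "pcD \<nu> z = exp (z\<^sup>2 / 4) * Re (pc_int \<nu> z 1) / sqrt (2 * pi)"
proof -
  have "pcf (of_real \<nu>) (of_real z) = of_real (1 / sqrt (2 * pi)) * exp ((of_real z)\<^sup>2 / 4) * pc_int \<nu> z 1"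
    by (simp add: pcf_def pc_int_def pc_kernel_def Let_def field_simps)
  also have "exp ((of_real z)\<^sup>2 / 4) = (of_real (exp (z\<^sup>2 / 4)) :: complex)"
    by (simp flip: exp_of_real)
  finally show ?thesis by (simp add: pcD_def)
qed

lemma pcD_has_real_derivative:
  "(pcD \<nu> has_real_derivative z / 2 * pcD \<nu> z - pcD (\<nu> + 1) z) (at z)"
proof -
  have *: "((\<lambda>z. Re (pc_int \<nu> z 1)) has_real_derivative - Re (pc_int (\<nu> + 1) z 1)) (at z)"
    using bounded_linear.has_vector_derivative[OF bounded_linear_Re pc_int_has_vector_derivative]
    by (simp add: has_real_derivative_iff_has_vector_derivative)
  have "((\<lambda>z. exp (z\<^sup>2 / 4)) has_real_derivative z / 2 * exp (z\<^sup>2 / 4)) (at z)"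
    by (auto intro!: derivative_eq_intros)
  from DERIV_cdivide[OF DERIV_mult[OF this *], of "sqrt (2 * pi)"]
  have "((\<lambda>z. exp (z\<^sup>2 / 4) * Re (pc_int \<nu> z 1) / sqrt (2 * pi)) has_real_derivative
      z / 2 * pcD \<nu> z - pcD (\<nu> + 1) z) (at z)"
    by (rule DERIV_cong) (simp add: pcD_eq_pc_int diff_divide_distrib add_divide_distrib mult_ac)
  then show ?thesis by (simp add: pcD_eq_pc_int[abs_def])
qed

lemma pcD'_eq: "pcD' \<nu> z = z / 2 * pcD \<nu> z - pcD (\<nu> + 1) z"
  unfolding pcD'_def by (rule DERIV_imp_deriv[OF pcD_has_real_derivative])

lemma pcD_deriv: "(pcD \<nu> has_real_derivative pcD' \<nu> z) (at z)"
  unfolding pcD'_eq by (rule pcD_has_real_derivative)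

lemma pcD_recurrence: "pcD (\<nu> + 2) z = z * pcD (\<nu> + 1) z - (\<nu> + 1) * pcD \<nu> z"
  by (simp only: pcD_eq_pc_int pc_int_recurrence) (simp add: field_simps)

text \<open>Weber's equation: differentiating \<open>z / 2 * D_\<nu> - D_(\<nu>+1)\<close> produces
  index \<open>\<nu> + 2\<close>, which the recurrence removes.\<close>

lemma pcD'_deriv: "(pcD' \<nu> has_real_derivative (z\<^sup>2 / 4 - \<nu> - 1 / 2) * pcD \<nu> z) (at z)"
proof -
  have "((\<lambda>z. z / 2 * pcD \<nu> z - pcD (\<nu> + 1) z) has_real_derivative
     1 / 2 * pcD \<nu> z + z / 2 * (z / 2 * pcD \<nu> z - pcD (\<nu> + 1) z) - (z / 2 * pcD (\<nu> + 1) z - pcD (\<nu> + 1 + 1) z)) (at z)"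
    by (auto intro!: derivative_eq_intros pcD_has_real_derivative)
  moreover have "\<nu> + 1 + 1 = \<nu> + 2" by simp
  ultimately show ?thesis
    using pcD_recurrence[of \<nu> z]
    by (simp add: pcD'_eq[abs_def] algebra_simps power2_eq_square)
qed

text \<open>The exponent \<open>- z c + c^2 / 2\<close> is least at \<open>c = z\<close>, hence the
  abscissa \<open>max 1 z\<close>; for large z the left side is \<open>exp (- z^2 / 4) z^n\<close>.
  The weaker rate \<open>exp (- 2 z)\<close> is kept because it suffices: one exponential can later
  pay for a factor z, and the other still decays.\<close>

lemma exp_quadratic_weight_bound:
  "\<exists>C>0. \<forall>z\<ge>-b::real. exp (z\<^sup>2 / 4) * (exp (- z * max 1 z + (max 1 z)\<^sup>2 / 2) * max 1 z ^ n) \<le> C * exp (- 2 * z)"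
proof -
  define C where "C = max (fact n * exp 9) (exp ((b\<^sup>2 + 1) / 4 + 3 / 2))"
  have "exp (z\<^sup>2 / 4) * (exp (- z * max 1 z + (max 1 z)\<^sup>2 / 2) * max 1 z ^ n) \<le> C * exp (- 2 * z)" if z: "z \<ge> -b" for z :: real
  proof (cases "z \<ge> 1")
    case True
    then have m: "max 1 z = z" by simp
    have "exp (z\<^sup>2 / 4) * (exp (- z * z + z\<^sup>2 / 2) * z ^ n) = exp (- z\<^sup>2 / 4) * z ^ n"
      by (simp add: power2_eq_square flip: exp_add mult.assoc)
    \<comment> \<open>From the square of \<open>z / 2 - 3\<close>. Of the rate 3, one unit is spent
      on \<open>z^n \<le> n! exp z\<close>.\<close>
    also have "\<dots> \<le> exp (9 - 3 * z) * (fact n * exp z)"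
    proof (rule mult_mono)
      have "0 \<le> (z / 2 - 3)\<^sup>2" by simp
      then show "exp (- z\<^sup>2 / 4) \<le> exp (9 - 3 * z)" by (simp add: power2_eq_square algebra_simps)
      show "z ^ n \<le> fact n * exp z" using exp_ge_power_over_fact[of z n] True by (simp add: field_simps)
    qed (use True in auto)
    also have "\<dots> = fact n * exp 9 * exp (- 2 * z)" by (simp flip: exp_add)
    also have "\<dots> \<le> C * exp (- 2 * z)" unfolding C_def by (intro mult_right_mono) auto
    finally show ?thesis unfolding m .
  next
    case False
    then have m: "max 1 z = 1" by simp
    have "z\<^sup>2 \<le> b\<^sup>2 + 1"
    proof (cases "z \<ge> 0")
      case True then have "z\<^sup>2 \<le> 1\<^sup>2" using False by (intro power_mono) auto
      then show ?thesis by (simp add: add_increasing)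
    next
      case F: False then have "(-z)\<^sup>2 \<le> b\<^sup>2" using z by (intro power_mono) auto
      then show ?thesis by simp
    qed
    then have "z\<^sup>2 / 4 \<le> (b\<^sup>2 + 1) / 4" by (rule divide_right_mono) simp
    then have "exp (z\<^sup>2 / 4 + z + 1 / 2) \<le> exp ((b\<^sup>2 + 1) / 4 + 3 / 2)"
      using False by (intro iffD2[OF exp_le_cancel_iff] order_trans[OF add_mono[OF add_mono[of _ "(b\<^sup>2 + 1) / 4" z 1] order_refl]]) simp_all
    also have "\<dots> \<le> C" by (simp add: C_def)
    finally have "exp (z\<^sup>2 / 4 + z + 1 / 2) * exp (- 2 * z) \<le> C * exp (- 2 * z)" by (intro mult_right_mono) auto
    then show ?thesis unfolding m by (simp add: add_diff_eq flip: exp_add)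
  qed
  moreover have "C > 0" by (simp add: C_def less_max_iff_disj)
  ultimately show ?thesis by blast
qed

lemma gauss_moment_nonneg: "gauss_moment n \<ge> 0"
  unfolding gauss_moment_def by (intro integral_nonneg_AE) auto

lemma pcD_bound:
  "\<exists>C>0. \<forall>\<nu> z. \<nu> \<le> real n \<longrightarrow> z \<ge> -b \<longrightarrow> \<bar>pcD \<nu> z\<bar> \<le> C * exp (- 2 * z)"
proof -
  obtain C where C: "C > 0" "\<And>z. z \<ge> -b \<Longrightarrow>
    exp (z\<^sup>2 / 4) * (exp (- z * max 1 z + (max 1 z)\<^sup>2 / 2) * max 1 z ^ n) \<le> C * exp (- 2 * z)"
    using exp_quadratic_weight_bound[of b n] by blast
  define K where "K = C * (gauss_moment n + 1) / sqrt (2 * pi)"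
  have "\<bar>pcD \<nu> z\<bar> \<le> K * exp (- 2 * z)" if h: "\<nu> \<le> real n" "z \<ge> -b" for \<nu> z
  proof -
    define m where "m = max 1 z"
    have "\<bar>Re (pc_int \<nu> z 1)\<bar> \<le> norm (pc_int \<nu> z m)"
      using pc_int_shift[of m \<nu> z] abs_Re_le_cmod by (simp add: m_def)
    also have "\<dots> \<le> exp (- z * m + m\<^sup>2 / 2) * m ^ n * (gauss_moment n + 1)"
      by (rule order_trans[OF norm_pc_int_le[OF _ h(1)]]) (auto simp: m_def intro!: mult_left_mono)
    finally have "exp (z\<^sup>2 / 4) * \<bar>Re (pc_int \<nu> z 1)\<bar> \<le> exp (z\<^sup>2 / 4) * (exp (- z * m + m\<^sup>2 / 2) * m ^ n * (gauss_moment n + 1))"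
      by (rule mult_left_mono) simp
    also have "\<dots> = exp (z\<^sup>2 / 4) * (exp (- z * m + m\<^sup>2 / 2) * m ^ n) * (gauss_moment n + 1)" by simp
    also have "\<dots> \<le> C * exp (- 2 * z) * (gauss_moment n + 1)"
      using C(2)[OF h(2)] gauss_moment_nonneg[of n] by (intro mult_right_mono) (auto simp: m_def)
    finally show ?thesis
      by (simp add: pcD_eq_pc_int K_def abs_mult divide_right_mono field_simps)
  qed
  moreover have "K > 0" using C(1) gauss_moment_nonneg[of n] by (simp add: K_def)
  ultimately show ?thesis by blast
qed

text \<open>All later regularity in the index comes from here. The weight \<open>exp (- 2 z)\<close>
  makes the estimate integrable over a half-line, as needed for \<open>pc_inner\<close>.\<close>

lemma pcD_lipschitz_index:
  "\<exists>C>0. \<forall>p q z. q + 1 \<le> real n \<longrightarrow> \<bar>p - q\<bar> \<le> 1 \<longrightarrow> z \<ge> -b \<longrightarrow>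
     \<bar>pcD p z - pcD q z\<bar> \<le> C * \<bar>p - q\<bar> * exp (- 2 * z)"
proof -
  obtain C where C: "C > 0" "\<And>z. z \<ge> -b \<Longrightarrow>
    exp (z\<^sup>2 / 4) * (exp (- z * max 1 z + (max 1 z)\<^sup>2 / 2) * max 1 z ^ (n + 1)) \<le> C * exp (- 2 * z)"
    using exp_quadratic_weight_bound[of b "n + 1"] by blast
  define K where "K = 5 * C * (gauss_moment (n + 1) + 1) / sqrt (2 * pi)"
  have "\<bar>pcD p z - pcD q z\<bar> \<le> K * \<bar>p - q\<bar> * exp (- 2 * z)" if h: "q + 1 \<le> real n" "\<bar>p - q\<bar> \<le> 1" "z \<ge> -b" for p q z
  proof -
    define m where "m = max 1 z"
    have "\<bar>Re (pc_int p z 1) - Re (pc_int q z 1)\<bar> \<le> norm (pc_int p z m - pc_int q z m)"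
      using pc_int_shift[of m p z] pc_int_shift[of m q z] abs_Re_le_cmod[of "pc_int p z m - pc_int q z m"] by (simp add: m_def)
    also have "\<dots> \<le> 5 * \<bar>p - q\<bar> * (exp (- z * m + m\<^sup>2 / 2) * m ^ (n + 1) * (gauss_moment (n + 1) + 1))"
      by (rule order_trans[OF norm_pc_int_diff_le[OF _ h(1,2)]]) (auto simp: m_def simp del: power_Suc intro!: mult_left_mono)
    finally have "exp (z\<^sup>2 / 4) * \<bar>Re (pc_int p z 1) - Re (pc_int q z 1)\<bar> \<le>
        exp (z\<^sup>2 / 4) * (5 * \<bar>p - q\<bar> * (exp (- z * m + m\<^sup>2 / 2) * m ^ (n + 1) * (gauss_moment (n + 1) + 1)))"
      by (rule mult_left_mono) simp
    also have "\<dots> = exp (z\<^sup>2 / 4) * (exp (- z * m + m\<^sup>2 / 2) * m ^ (n + 1)) * (5 * \<bar>p - q\<bar> * (gauss_moment (n + 1) + 1))"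
      by (simp only: mult_ac)
    also have "\<dots> \<le> C * exp (- 2 * z) * (5 * \<bar>p - q\<bar> * (gauss_moment (n + 1) + 1))"
      using C(2)[OF h(3)] gauss_moment_nonneg[of "n + 1"] by (intro mult_right_mono) (auto simp: m_def simp del: power_Suc)
    finally have *: "exp (z\<^sup>2 / 4) * \<bar>Re (pc_int p z 1) - Re (pc_int q z 1)\<bar> \<le> C * exp (- 2 * z) * (5 * \<bar>p - q\<bar> * (gauss_moment (n + 1) + 1))" .
    have "pcD p z - pcD q z = exp (z\<^sup>2 / 4) * (Re (pc_int p z 1) - Re (pc_int q z 1)) / sqrt (2 * pi)"
      by (simp add: pcD_eq_pc_int diff_divide_distrib right_diff_distrib)
    then have "\<bar>pcD p z - pcD q z\<bar> = exp (z\<^sup>2 / 4) * \<bar>Re (pc_int p z 1) - Re (pc_int q z 1)\<bar> / sqrt (2 * pi)"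
      by (simp add: abs_mult)
    also have "\<dots> \<le> C * exp (- 2 * z) * (5 * \<bar>p - q\<bar> * (gauss_moment (n + 1) + 1)) / sqrt (2 * pi)"
      by (rule divide_right_mono[OF *]) simp
    also have "\<dots> = K * \<bar>p - q\<bar> * exp (- 2 * z)" by (simp add: K_def field_simps)
    finally show ?thesis .
  qed
  moreover have "K > 0" using C(1) gauss_moment_nonneg[of "n + 1"] by (simp add: K_def)
  ultimately show ?thesis by blast
qed

lemma gauss_integral_pos: "(LINT t|lborel. exp (- t\<^sup>2 / 2) :: real) > 0"
proof -
  have "(\<lambda>t::real. exp (- t\<^sup>2 / 2)) = (\<lambda>t. sqrt (2 * pi) * normal_density 0 1 t)"
    by (simp add: normal_density_def)
  moreover have "(LINT t|lborel. sqrt (2 * pi) * normal_density 0 1 t) = sqrt (2 * pi)"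
    by (simp add: integral_normal_density)
  ultimately show ?thesis by simp
qed

text \<open>Leading asymptotics at infinity: with \<open>z = c\<close> and the line through the
  saddle point c, the exponent is exactly \<open>- c^2 / 2 - t^2 / 2\<close>. After removing
  \<open>c^\<nu> exp (- c^2 / 2)\<close> there remains the integral of
  \<open>(1 + i t / c)^\<nu> exp (- t^2 / 2)\<close>, which tends to the positive Gauss
  integral.\<close>

lemma pcD_nontrivial: "\<exists>z>0. pcD \<nu> z \<noteq> 0"
proof -
  define s where "s N t = (Complex 1 (t / (real N + 1))) powr (of_real \<nu>) * of_real (exp (- t\<^sup>2 / 2))" for N t
  obtain n where n: "\<nu> \<le> real n" using real_arch_simple by blast
  have "(\<lambda>N. LINT t|lborel. s N t) \<longlonglongrightarrow> (LINT t|lborel. of_real (exp (- t\<^sup>2 / 2)))"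
  proof (rule integral_dominated_convergence[where w="\<lambda>t. (1 + \<bar>t\<bar>) ^ n * exp (- t\<^sup>2 / 2)"])
    show "integrable lborel (\<lambda>t. (1 + \<bar>t\<bar>) ^ n * exp (- t\<^sup>2 / 2) :: real)" by (rule integrable_gauss_moment)
    show "s N \<in> borel_measurable lborel" for N
    proof -
      have "continuous_on UNIV (s N)"
        unfolding s_def Complex_conv_line
        by (intro continuous_intros) (auto simp: complex_nonpos_Reals_iff complex_eq_iff)
      then show ?thesis by (simp add: borel_measurable_continuous_onI)
    qed
    show "AE t in lborel. (\<lambda>N. s N t) \<longlonglongrightarrow> of_real (exp (- t\<^sup>2 / 2))"
    proof (rule AE_I2)
      fix t :: real
      have "(\<lambda>N. t / (real N + 1)) \<longlonglongrightarrow> 0" by real_asymp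
      then have "(\<lambda>N. Complex 1 (t / (real N + 1))) \<longlonglongrightarrow> Complex 1 0" by (intro tendsto_Complex tendsto_const)
      then have "(\<lambda>N. s N t) \<longlonglongrightarrow> Complex 1 0 powr (of_real \<nu>) * of_real (exp (- t\<^sup>2 / 2))"
        unfolding s_def by (intro tendsto_mult tendsto_powr_complex tendsto_const) (auto simp: complex_nonpos_Reals_iff)
      moreover have "Complex 1 0 = 1" by (simp add: complex_eq_iff)
      ultimately show "(\<lambda>N. s N t) \<longlonglongrightarrow> of_real (exp (- t\<^sup>2 / 2))" by simp
    qed
    show "AE t in lborel. norm (s N t) \<le> (1 + \<bar>t\<bar>) ^ n * exp (- t\<^sup>2 / 2)" for N
    proof (rule AE_I2)
      fix t :: real
      have "norm (s N t) = norm (Complex 1 (t / (real N + 1))) powr \<nu> * exp (- t\<^sup>2 / 2)"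
        unfolding s_def norm_mult by (subst norm_cpowr_of_real) (auto simp: complex_eq_iff)
      also have "\<dots> \<le> (1 + \<bar>t / (real N + 1)\<bar>) ^ n * exp (- t\<^sup>2 / 2)"
        using norm_Complex_powr_le[of 1 \<nu> n "t / (real N + 1)"] n by (intro mult_right_mono) auto
      also have "\<dots> \<le> (1 + \<bar>t\<bar>) ^ n * exp (- t\<^sup>2 / 2)"
      proof (intro mult_right_mono power_mono add_left_mono)
        show "\<bar>t / (real N + 1)\<bar> \<le> \<bar>t\<bar>" by (simp add: divide_le_eq mult_left_le algebra_simps)
      qed auto
      finally show "norm (s N t) \<le> (1 + \<bar>t\<bar>) ^ n * exp (- t\<^sup>2 / 2)" .
    qed
  qed auto
  then have lim: "(\<lambda>N. Re (LINT t|lborel. s N t)) \<longlonglongrightarrow> (LINT t|lborel. exp (- t\<^sup>2 / 2))"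
    using tendsto_Re by fastforce
  have "\<forall>\<^sub>F N in sequentially. Re (LINT t|lborel. s N t) > 0"
    using order_tendstoD(1)[OF lim gauss_integral_pos] .
  then obtain N where N: "Re (LINT t|lborel. s N t) > 0"
    using eventually_happens'[OF sequentially_bot] by blast
  define c where "c = real N + 1"
  have c: "c \<ge> 1" "c > 0" by (auto simp: c_def)
  have "pc_kernel \<nu> c (Complex c t) = of_real (c powr \<nu> * exp (- c\<^sup>2 / 2)) * s N t" for t
  proof -
    have 1: "Complex c t = of_real c * Complex 1 (t / c)" using c by (simp add: complex_eq_iff)
    have 2: "Complex c t powr of_real \<nu> = of_real (c powr \<nu>) * Complex 1 (t / c) powr of_real \<nu>"
      unfolding 1 using c by (simp add: powr_times_real_left powr_of_real)
    have 3: "- of_real c * Complex c t + (Complex c t)\<^sup>2 / 2 = of_real (- c\<^sup>2 / 2 + - t\<^sup>2 / 2)"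
      by (simp add: complex_eq_iff power2_eq_square diff_divide_distrib)
    have "pc_kernel \<nu> c (Complex c t) = Complex c t powr of_real \<nu> * exp (- of_real c * Complex c t + (Complex c t)\<^sup>2 / 2)"
      unfolding pc_kernel_def exp_add by simp
    also have "exp (- of_real c * Complex c t + (Complex c t)\<^sup>2 / 2) = of_real (exp (- c\<^sup>2 / 2) * exp (- t\<^sup>2 / 2))"
      unfolding 3 exp_of_real exp_add ..
    finally show ?thesis unfolding 2 by (simp add: s_def c_def)
  qed
  then have "pc_int \<nu> c 1 = of_real (c powr \<nu> * exp (- c\<^sup>2 / 2)) * (LINT t|lborel. s N t)"
    using pc_int_shift[OF c(1), of \<nu> c] by (simp add: pc_int_def)
  then have "Re (pc_int \<nu> c 1) = (c powr \<nu> * exp (- c\<^sup>2 / 2)) * Re (LINT t|lborel. s N t)"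
    by simp
  then have "Re (pc_int \<nu> c 1) > 0" using N c by simp
  then have "pcD \<nu> c \<noteq> 0" by (simp add: pcD_eq_pc_int)
  then show ?thesis using c by blast
qed

section \<open>Second order linear equations on a half-line\<close>

text \<open>Gronwall for the energy \<open>f^2 + f'^2\<close>, which grows at rate at most
  \<open>1 + K\<close>. Derivatives are required only in the open interval, because the second
  derivative of an eigenfunction may jump at the endpoint 0.\<close>

lemma ode2_zero_forward:
  fixes f f' Q :: "real \<Rightarrow> real"
  assumes "a \<le> b" "continuous_on {a..b} f" "continuous_on {a..b} f'"
    and der: "\<And>x. a < x \<Longrightarrow> x < b \<Longrightarrow> (f has_real_derivative f' x) (at x)"
      "\<And>x. a < x \<Longrightarrow> x < b \<Longrightarrow> (f' has_real_derivative Q x * f x) (at x)"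
    and Q: "\<And>x. a < x \<Longrightarrow> x < b \<Longrightarrow> \<bar>Q x\<bar> \<le> K"
    and "f a = 0" "f' a = 0"
  shows "f b = 0" "f' b = 0"
proof -
  define G where "G x = ((f x)\<^sup>2 + (f' x)\<^sup>2) * exp (- (1 + K) * x)" for x
  have "G b \<le> G a"
  proof (rule DERIV_nonpos_imp_decreasing_open[where f=G])
    fix x assume x: "a < x" "x < b"
    define E where "E = 2 * f x * f' x * (1 + Q x) - (1 + K) * ((f x)\<^sup>2 + (f' x)\<^sup>2)"
    have "(G has_real_derivative E * exp (- (1 + K) * x)) (at x)"
      unfolding G_def E_def using der[OF x]
      by (auto intro!: derivative_eq_intros simp: algebra_simps power2_eq_square)
    moreover have "E \<le> 0"
    proof -
      have "2 * f x * f' x * (1 + Q x) \<le> \<bar>2 * f x * f' x\<bar> * \<bar>1 + Q x\<bar>"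
        by (metis abs_ge_self abs_mult)
      also have "\<dots> \<le> ((f x)\<^sup>2 + (f' x)\<^sup>2) * (1 + K)"
      proof (rule mult_mono)
        have "0 \<le> (f x - f' x)\<^sup>2" "0 \<le> (f x + f' x)\<^sup>2" by auto
        then show "\<bar>2 * f x * f' x\<bar> \<le> (f x)\<^sup>2 + (f' x)\<^sup>2"
          by (auto simp: power2_eq_square algebra_simps abs_le_iff)
        show "\<bar>1 + Q x\<bar> \<le> 1 + K" using Q[OF x] by auto
      qed auto
      finally show ?thesis by (simp add: E_def algebra_simps)
    qed
    ultimately show "\<exists>y. (G has_real_derivative y) (at x) \<and> y \<le> 0"
      by (auto intro!: mult_nonpos_nonneg)
  qed (use assms in \<open>auto simp: G_def intro!: continuous_intros\<close>)
  then have "((f b)\<^sup>2 + (f' b)\<^sup>2) * exp (- (1 + K) * b) \<le> 0" using assms by (simp add: G_def)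
  then have "(f b)\<^sup>2 + (f' b)\<^sup>2 \<le> 0" using mult_le_cancel_right_pos[of "exp (- (1 + K) * b)" _ 0] by simp
  then show "f b = 0" "f' b = 0"
    by (smt (verit) zero_le_power2 zero_eq_power2)+
qed

lemma ode2_zero_backward:
  fixes f f' Q :: "real \<Rightarrow> real"
  assumes "a \<le> b" "continuous_on {a..b} f" "continuous_on {a..b} f'"
    and der: "\<And>x. a < x \<Longrightarrow> x < b \<Longrightarrow> (f has_real_derivative f' x) (at x)"
      "\<And>x. a < x \<Longrightarrow> x < b \<Longrightarrow> (f' has_real_derivative Q x * f x) (at x)"
    and Q: "\<And>x. a < x \<Longrightarrow> x < b \<Longrightarrow> \<bar>Q x\<bar> \<le> K"
    and "f b = 0" "f' b = 0"
  shows "f a = 0" "f' a = 0"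
proof -
  have cont: "continuous_on {-b..-a} (\<lambda>x. f (- x))" "continuous_on {-b..-a} (\<lambda>x. - f' (- x))"
    by (rule continuous_on_compose2[OF assms(2)] continuous_on_minus[OF continuous_on_compose2[OF assms(3)]],
        (intro continuous_intros)[1], force)+
  have neg: "(uminus has_real_derivative -1) (at x)" for x :: real
    by (auto intro!: derivative_eq_intros)
  have 1: "((\<lambda>x. f (- x)) has_real_derivative - f' (- x)) (at x)" if "-b < x" "x < -a" for x
    using DERIV_chain2[OF der(1)[of "- x"] neg] that by simp
  have 2: "((\<lambda>x. - f' (- x)) has_real_derivative Q (- x) * f (- x)) (at x)" if "-b < x" "x < -a" for x
    using DERIV_minus[OF DERIV_chain2[OF der(2)[of "- x"] neg]] that by simp
  from ode2_zero_forward[OF _ cont 1 2, of K] assms(1,7,8) Q[of "- _"]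
  show "f a = 0" "f' a = 0" by auto
qed

text \<open>A common zero would force D to vanish identically by uniqueness. Hence polar coordinates
  for \<open>(D, D')\<close> exist, and D cannot vanish at a root of a matching equation.\<close>

lemma pcD_or_pcD'_nonzero: "pcD \<nu> z \<noteq> 0 \<or> pcD' \<nu> z \<noteq> 0"
proof (rule ccontr)
  assume "\<not> ?thesis"
  then have z0: "pcD \<nu> z = 0" "pcD' \<nu> z = 0" by auto
  obtain y where y: "pcD \<nu> y \<noteq> 0" using pcD_nontrivial by blast
  have cont: "continuous_on S (pcD \<nu>)" "continuous_on S (pcD' \<nu>)" for S
    by (auto intro!: DERIV_continuous_on has_field_derivative_at_within[OF pcD_deriv] has_field_derivative_at_within[OF pcD'_deriv])
  obtain K where K: "\<And>x. x \<in> {min y z..max y z} \<Longrightarrow> \<bar>x\<^sup>2 / 4 - \<nu> - 1 / 2\<bar> \<le> K"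
  proof -
    have "compact ((\<lambda>x. x\<^sup>2 / 4 - \<nu> - 1 / 2) ` {min y z..max y z})"
      by (intro compact_continuous_image continuous_intros) auto
    from compact_imp_bounded[OF this] show ?thesis
      using that unfolding bounded_iff by fastforce
  qed
  show False
  proof (cases "z \<le> y")
    case True
    from ode2_zero_forward(1)[OF True cont pcD_deriv pcD'_deriv _ z0, of K] K True y show False by auto
  next
    case False
    then have "y \<le> z" by simp
    from ode2_zero_backward(1)[OF this cont pcD_deriv pcD'_deriv _ z0, of K] K False y show False by auto
  qed
qed

lemma not_integrable_bounded_below:
  fixes g :: "real \<Rightarrow> real"
  assumes "integrable lborel g" "\<And>x. g x \<ge> 0" "\<And>x. x \<ge> a \<Longrightarrow> g x \<ge> c" "c > 0"
  shows False
proof -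
  obtain N :: nat where N: "(LINT x|lborel. g x) < real N * c"
    using reals_Archimedean3[OF assms(4)] by blast
  have "(LINT x|lborel. c * indicator {a..a + real N} x) \<le> (LINT x|lborel. g x)"
  proof (rule integral_mono)
    show "integrable lborel (\<lambda>x. c * indicator {a..a + real N} x)"
      by (intro integrable_mult_right integrable_real_indicator) auto
    show "c * indicator {a..a + real N} x \<le> g x" for x
      using assms(2,3)[of x] by (simp add: indicator_def)
  qed (rule assms(1))
  then show False using N by (simp add: mult.commute)
qed

text \<open>Since \<open>f f'\<close> has derivative \<open>f'^2 + Q f^2 \<ge> 0\<close>, a positive
  value would persist and make \<open>f^2\<close> nondecreasing from there on, against
  integrability. So \<open>f f' \<le> 0\<close>, and this makes both \<open>f^2\<close> and
  \<open>f'^2\<close> nonincreasing.\<close>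

lemma ode2_L2_bounded:
  fixes f f' Q :: "real \<Rightarrow> real"
  assumes cont: "continuous_on {a..} f" "continuous_on {a..} f'"
    and der: "\<And>x. a < x \<Longrightarrow> (f has_real_derivative f' x) (at x)"
      "\<And>x. a < x \<Longrightarrow> (f' has_real_derivative Q x * f x) (at x)"
    and Q: "\<And>x. a < x \<Longrightarrow> Q x \<ge> 0"
    and int: "integrable lborel (\<lambda>x. indicator {a..} x * (f x)\<^sup>2)"
    and x: "x \<ge> a"
  shows "(f x)\<^sup>2 \<le> (f a)\<^sup>2" "(f' x)\<^sup>2 \<le> (f' a)\<^sup>2"
proof -
  define g where "g x = f x * f' x" for x
  have cont': "continuous_on {u..v} f" "continuous_on {u..v} f'" if "a \<le> u" for u v
    using cont that by (auto elim!: continuous_on_subset)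
  have g: "g u \<le> g v" if "a \<le> u" "u \<le> v" for u v
  proof (rule DERIV_nonneg_imp_increasing_open[OF that(2), where f=g])
    fix y assume "u < y" "y < v"
    then have y: "a < y" using that by simp
    have "(g has_real_derivative (f' y)\<^sup>2 + Q y * (f y)\<^sup>2) (at y)"
      unfolding g_def using der[OF y] by (auto intro!: derivative_eq_intros simp: power2_eq_square algebra_simps)
    then show "\<exists>w. (g has_real_derivative w) (at y) \<and> 0 \<le> w" using Q[OF y] by auto
  qed (use cont'[OF that(1)] in \<open>auto simp: g_def intro!: continuous_intros\<close>)
  have f2: "((\<lambda>x. (f x)\<^sup>2) has_real_derivative 2 * g y) (at y)" if "a < y" for y
    unfolding g_def using der(1)[OF that] by (auto intro!: derivative_eq_intros)
  have g0: "g y \<le> 0" if y: "a \<le> y" for y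
  proof (rule ccontr)
    assume n: "\<not> g y \<le> 0"
    then have "(f y)\<^sup>2 > 0" by (auto simp: g_def)
    moreover have "(f y)\<^sup>2 \<le> (f v)\<^sup>2" if v: "y \<le> v" for v
    proof (rule DERIV_nonneg_imp_increasing_open[OF v, where f="\<lambda>x. (f x)\<^sup>2"])
      fix t assume t: "y < t" "t < v"
      then have "g t \<ge> 0" using n g[of y t] y by auto
      then show "\<exists>w. ((\<lambda>x. (f x)\<^sup>2) has_real_derivative w) (at t) \<and> 0 \<le> w"
        using f2[of t] t y by (intro exI[of _ "2 * g t"]) auto
    qed (use cont'[OF y] in \<open>auto intro!: continuous_intros\<close>)
    ultimately show False
      using y by (intro not_integrable_bounded_below[OF int, of y "(f y)\<^sup>2"]) auto
  qed
  show "(f x)\<^sup>2 \<le> (f a)\<^sup>2"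
  proof (rule DERIV_nonpos_imp_decreasing_open[OF x, where f="\<lambda>x. (f x)\<^sup>2"])
    fix t assume t: "a < t" "t < x"
    then show "\<exists>w. ((\<lambda>x. (f x)\<^sup>2) has_real_derivative w) (at t) \<and> w \<le> 0"
      using f2[of t] g0[of t] by (intro exI[of _ "2 * g t"]) auto
  qed (use cont' in \<open>auto intro!: continuous_intros\<close>)
  show "(f' x)\<^sup>2 \<le> (f' a)\<^sup>2"
  proof (rule DERIV_nonpos_imp_decreasing_open[OF x, where f="\<lambda>x. (f' x)\<^sup>2"])
    fix t assume t: "a < t" "t < x"
    have "((\<lambda>x. (f' x)\<^sup>2) has_real_derivative 2 * (Q t * g t)) (at t)"
      unfolding g_def using der(2)[OF t(1)] by (auto intro!: derivative_eq_intros)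
    moreover have "Q t * g t \<le> 0" using g0[of t] Q[OF t(1)] t by (simp add: mult_nonneg_nonpos)
    ultimately show "\<exists>w. ((\<lambda>x. (f' x)\<^sup>2) has_real_derivative w) (at t) \<and> w \<le> 0"
      by (intro exI[of _ "2 * (Q t * g t)"]) auto
  qed (use cont' in \<open>auto intro!: continuous_intros\<close>)
qed

lemma ode2_wronskian_constant:
  fixes f f' h h' Q :: "real \<Rightarrow> real"
  assumes "continuous_on {a..} f" "continuous_on {a..} f'" "continuous_on {a..} h" "continuous_on {a..} h'"
    and "\<And>x. a < x \<Longrightarrow> (f has_real_derivative f' x) (at x)"
      "\<And>x. a < x \<Longrightarrow> (f' has_real_derivative Q x * f x) (at x)"
      "\<And>x. a < x \<Longrightarrow> (h has_real_derivative h' x) (at x)"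
      "\<And>x. a < x \<Longrightarrow> (h' has_real_derivative Q x * h x) (at x)"
    and "x \<ge> a"
  shows "f x * h' x - f' x * h x = f a * h' a - f' a * h a"
proof (cases "x = a")
  case False
  then have "a < x" using assms by simp
  then show ?thesis
  proof (rule DERIV_isconst_end[where f="\<lambda>x. f x * h' x - f' x * h x"])
    show "continuous_on {a..x} (\<lambda>x. f x * h' x - f' x * h x)"
      using assms(1-4) by (intro continuous_intros) (auto elim!: continuous_on_subset)
    fix y assume "a < y" "y < x"
    then show "((\<lambda>x. f x * h' x - f' x * h x) has_real_derivative 0) (at y)"
      using assms(5-8)[of y] by (auto intro!: derivative_eq_intros)
  qed
qed auto

text \<open>The Wronskian is constant and tends to 0: beyond \<open>b\<close>, where
  \<open>Q \<ge> 0\<close>, the square-integrable solution and its derivative are bounded, while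
  \<open>h\<close> and \<open>h'\<close> decay. Thus one known decaying solution fixes the
  logarithmic derivative of every square-integrable one.\<close>

lemma ode2_L2_wronskian_eq_0:
  fixes f f' h h' Q :: "real \<Rightarrow> real"
  assumes cont: "continuous_on {a..} f" "continuous_on {a..} f'" "continuous_on {a..} h" "continuous_on {a..} h'"
    and der: "\<And>x. a < x \<Longrightarrow> (f has_real_derivative f' x) (at x)"
      "\<And>x. a < x \<Longrightarrow> (f' has_real_derivative Q x * f x) (at x)"
      "\<And>x. a < x \<Longrightarrow> (h has_real_derivative h' x) (at x)"
      "\<And>x. a < x \<Longrightarrow> (h' has_real_derivative Q x * h x) (at x)"
    and int: "integrable lborel (\<lambda>x. indicator {a..} x * (f x)\<^sup>2)"
    and lim: "(h \<longlongrightarrow> 0) at_top" "(h' \<longlongrightarrow> 0) at_top"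
    and b: "a \<le> b" and Q: "\<And>x. b < x \<Longrightarrow> Q x \<ge> 0"
  shows "f a * h' a = f' a * h a"
proof -
  have W: "f x * h' x - f' x * h x = f a * h' a - f' a * h a" if "x \<ge> a" for x
    by (rule ode2_wronskian_constant[OF cont der that])
  have int': "integrable lborel (\<lambda>x. indicator {b..} x * (f x)\<^sup>2)"
  proof -
    have "integrable lborel (\<lambda>x. indicator {b..} x *\<^sub>R (indicator {a..} x * (f x)\<^sup>2))"
      by (intro integrable_mult_indicator int) auto
    moreover have "(\<lambda>x. indicator {b..} x *\<^sub>R (indicator {a..} x * (f x)\<^sup>2)) = (\<lambda>x. indicator {b..} x * (f x)\<^sup>2)"
      using b by (auto simp: fun_eq_iff indicator_def)
    ultimately show ?thesis by simp
  qed
  have bd: "(f x)\<^sup>2 \<le> (f b)\<^sup>2" "(f' x)\<^sup>2 \<le> (f' b)\<^sup>2" if "x \<ge> b" for x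
    using b that by (auto intro!: ode2_L2_bounded[where a=b and Q=Q and f=f and f'=f'] int' Q der
        intro: continuous_on_subset[OF cont(1)] continuous_on_subset[OF cont(2)])
  have "((\<lambda>x. f x * h' x - f' x * h x) \<longlongrightarrow> 0 - 0) at_top"
  proof (intro tendsto_diff)
    have "\<forall>\<^sub>F x in at_top. norm (f x * h' x) \<le> \<bar>f b\<bar> * norm (h' x)"
      using eventually_ge_at_top[of b] by eventually_elim (use bd in \<open>auto simp: abs_mult abs_le_square_iff mult_right_mono\<close>)
    moreover have "((\<lambda>x. \<bar>f b\<bar> * norm (h' x)) \<longlongrightarrow> 0) at_top"
      using tendsto_mult_right_zero[OF tendsto_norm_zero[OF lim(2)]] by blast
    ultimately show "((\<lambda>x. f x * h' x) \<longlongrightarrow> 0) at_top" by (rule Lim_null_comparison)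
    have "\<forall>\<^sub>F x in at_top. norm (f' x * h x) \<le> \<bar>f' b\<bar> * norm (h x)"
      using eventually_ge_at_top[of b] by eventually_elim (use bd in \<open>auto simp: abs_mult abs_le_square_iff mult_right_mono\<close>)
    moreover have "((\<lambda>x. \<bar>f' b\<bar> * norm (h x)) \<longlongrightarrow> 0) at_top"
      using tendsto_mult_right_zero[OF tendsto_norm_zero[OF lim(1)]] by blast
    ultimately show "((\<lambda>x. f' x * h x) \<longlongrightarrow> 0) at_top" by (rule Lim_null_comparison)
  qed
  moreover have "\<forall>\<^sub>F x in at_top. f x * h' x - f' x * h x = f a * h' a - f' a * h a"
    using eventually_ge_at_top[of a] by eventually_elim (rule W)
  then have "((\<lambda>x. f x * h' x - f' x * h x) \<longlongrightarrow> f a * h' a - f' a * h a) at_top"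
    by (rule tendsto_eventually)
  ultimately have "f a * h' a - f' a * h a = 0 - 0"
    using tendsto_unique[OF trivial_limit_at_top_linorder] by blast
  then show ?thesis by simp
qed

text \<open>From a zero onwards \<open>h h' \<ge> 0\<close>, so \<open>h^2\<close> is nondecreasing;
  having limit 0 it vanishes throughout.\<close>

lemma ode2_decaying_zero:
  fixes h h' Q :: "real \<Rightarrow> real"
  assumes der: "\<And>x. a \<le> x \<Longrightarrow> (h has_real_derivative h' x) (at x)"
      "\<And>x. a \<le> x \<Longrightarrow> (h' has_real_derivative Q x * h x) (at x)"
    and Q: "\<And>x. a \<le> x \<Longrightarrow> Q x \<ge> 0"
    and lim: "(h \<longlongrightarrow> 0) at_top"
    and "h a = 0"
  shows "h' a = 0"
proof -
  define g where "g x = h x * h' x" for x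
  have g: "g x \<ge> 0" if "a \<le> x" for x
  proof -
    have "g a \<le> g x"
    proof (rule DERIV_nonneg_imp_nondecreasing[OF that, where f=g])
      fix y assume y: "a \<le> y" "y \<le> x"
      have "(g has_real_derivative (h' y)\<^sup>2 + Q y * (h y)\<^sup>2) (at y)"
        unfolding g_def using der[OF y(1)] by (auto intro!: derivative_eq_intros simp: power2_eq_square algebra_simps)
      then show "\<exists>w. (g has_real_derivative w) (at y) \<and> 0 \<le> w" using Q[OF y(1)] by auto
    qed
    then show ?thesis using assms by (simp add: g_def)
  qed
  have mono: "(h u)\<^sup>2 \<le> (h v)\<^sup>2" if "a \<le> u" "u \<le> v" for u v
  proof (rule DERIV_nonneg_imp_nondecreasing[OF that(2), where f="\<lambda>x. (h x)\<^sup>2"])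
    fix y assume y: "u \<le> y" "y \<le> v"
    have "((\<lambda>x. (h x)\<^sup>2) has_real_derivative 2 * g y) (at y)"
      unfolding g_def using der(1)[of y] y that by (auto intro!: derivative_eq_intros)
    then show "\<exists>w. ((\<lambda>x. (h x)\<^sup>2) has_real_derivative w) (at y) \<and> 0 \<le> w" using g[of y] y that by auto
  qed
  have "((\<lambda>x. (h x)\<^sup>2) \<longlongrightarrow> 0\<^sup>2) at_top" by (intro tendsto_power lim)
  then have h2: "(h x)\<^sup>2 \<le> 0" if "a \<le> x" for x
    using that mono[OF that] eventually_mono[OF eventually_ge_at_top[of x], of "\<lambda>i. (h x)\<^sup>2 \<le> (h i)\<^sup>2"]
    by (intro tendsto_lowerbound[of "\<lambda>x. (h x)\<^sup>2" 0 at_top]) auto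
  then have h0: "h x = 0" if "a \<le> x" for x using that by simp
  \<comment> \<open>\<open>h\<close> is known to vanish only to the right of \<open>a\<close>, so
    \<open>h' a\<close> is identified through the right-hand derivative.\<close>
  have "(h has_real_derivative 0) (at a within {a..})"
    by (rule has_field_derivative_transform_within[of "\<lambda>_. 0" _ _ _ 1]) (auto simp: h0)
  then have "((\<lambda>y. (h y - h a) / (y - a)) \<longlongrightarrow> 0) (at_right a)"
    by (simp add: has_field_derivative_iff at_within_Ici_at_right)
  moreover have "(h has_real_derivative h' a) (at a within {a..})"
    by (rule has_field_derivative_at_within[OF der(1)[OF order_refl]])
  then have "((\<lambda>y. (h y - h a) / (y - a)) \<longlongrightarrow> h' a) (at_right a)"
    by (simp add: has_field_derivative_iff at_within_Ici_at_right)
  ultimately show ?thesis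
    using tendsto_unique[OF trivial_limit_at_right_real] by blast
qed

text \<open>With \<open>w = - R' / R\<close> the decaying solution satisfies the Riccati equation \<open>w' = w\<^sup>2 - Q\<close>.\<close>

lemma riccati_lower_barrier:
  fixes R R' u u' Q :: "real \<Rightarrow> real"
  assumes der: "\<And>x. a \<le> x \<Longrightarrow> (R has_real_derivative R' x) (at x)"
      "\<And>x. a \<le> x \<Longrightarrow> (R' has_real_derivative Q x * R x) (at x)"
      "\<And>x. a \<le> x \<Longrightarrow> (u has_real_derivative u' x) (at x)"
    and ineq: "\<And>x. a \<le> x \<Longrightarrow> (u x)\<^sup>2 - u' x \<le> Q x"
    and pos: "R a > 0"
    and lim: "(R \<longlongrightarrow> 0) at_top" "((\<lambda>x. R' x + u x * R x) \<longlongrightarrow> 0) at_top"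
  shows "R' a + u a * R a \<le> 0"
proof -
  \<comment> \<open>The weight \<open>R\<close> turns the mixed terms of the derivative into a
    complete square, so the barrier inequality alone gives monotonicity.\<close>
  define h where "h x = (R' x + u x * R x) * R x" for x
  have mono: "h a \<le> h x" if "a \<le> x" for x
  proof (rule DERIV_nonneg_imp_nondecreasing[OF that, where f=h])
    fix y assume y: "a \<le> y" "y \<le> x"
    have "(h has_real_derivative (R' y + u y * R y)\<^sup>2 + (Q y + u' y - (u y)\<^sup>2) * (R y)\<^sup>2) (at y)"
      unfolding h_def using der[OF y(1)] by (auto intro!: derivative_eq_intros simp: power2_eq_square algebra_simps)
    then show "\<exists>w. (h has_real_derivative w) (at y) \<and> 0 \<le> w" using ineq[OF y(1)] by auto
  qed
  have "(h \<longlongrightarrow> 0 * 0) at_top" unfolding h_def by (intro tendsto_mult lim)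
  then have "h a \<le> 0"
    using mono eventually_mono[OF eventually_ge_at_top[of a], of "\<lambda>i. h a \<le> h i"]
    by (intro tendsto_lowerbound[of h 0 at_top]) auto
  then show ?thesis using pos by (simp add: h_def mult_le_0_iff)
qed

text \<open>Here the complete square of the lower barrier would have the wrong sign. Instead
  \<open>h = R' + u R\<close> satisfies \<open>h' = u h + (Q + u' - u^2) R\<close>: once negative,
  \<open>h\<close> keeps decreasing because \<open>u \<ge> 0\<close> and \<open>R > 0\<close>, and
  cannot return to its limit 0.\<close>

lemma riccati_upper_barrier:
  fixes R R' u u' Q :: "real \<Rightarrow> real"
  assumes der: "\<And>x. a \<le> x \<Longrightarrow> (R has_real_derivative R' x) (at x)"
      "\<And>x. a \<le> x \<Longrightarrow> (R' has_real_derivative Q x * R x) (at x)"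
      "\<And>x. a \<le> x \<Longrightarrow> (u has_real_derivative u' x) (at x)"
    and ineq: "\<And>x. a \<le> x \<Longrightarrow> Q x \<le> (u x)\<^sup>2 - u' x"
    and pos: "\<And>x. a \<le> x \<Longrightarrow> R x > 0" "\<And>x. a \<le> x \<Longrightarrow> u x \<ge> 0"
    and lim: "((\<lambda>x. R' x + u x * R x) \<longlongrightarrow> 0) at_top"
  shows "0 \<le> R' a + u a * R a"
proof (rule ccontr)
  define h where "h x = R' x + u x * R x" for x
  assume "\<not> ?thesis"
  then have neg: "h a < 0" by (simp add: h_def)
  have hd: "(h has_real_derivative u x * h x + (Q x + u' x - (u x)\<^sup>2) * R x) (at x)" if "a \<le> x" for x
    unfolding h_def using der[OF that] by (auto intro!: derivative_eq_intros simp: power2_eq_square algebra_simps)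
  have hc: "continuous_on {u..v} h" if "a \<le> u" for u v
    using that by (intro continuous_at_imp_continuous_on ballI DERIV_isCont[OF hd]) auto
  have dec: "h v \<le> h w" if "a \<le> w" "w \<le> v" "\<And>y. w \<le> y \<Longrightarrow> y \<le> v \<Longrightarrow> h y \<le> 0" for w v
  proof (rule DERIV_nonpos_imp_nonincreasing[OF that(2), where f=h])
    fix y assume y: "w \<le> y" "y \<le> v"
    then have ay: "a \<le> y" using that by simp
    have "u y * h y \<le> 0" using that(3)[OF y] pos(2)[OF ay] by (simp add: mult_nonneg_nonpos)
    moreover have "(Q y + u' y - (u y)\<^sup>2) * R y \<le> 0"
      using ineq[OF ay] pos(1)[OF ay] by (intro mult_nonpos_nonneg) auto
    ultimately show "\<exists>r. (h has_real_derivative r) (at y) \<and> r \<le> 0"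
      by (intro exI[of _ "u y * h y + (Q y + u' y - (u y)\<^sup>2) * R y"] conjI hd ay) simp
  qed
  have le: "h v \<le> h a" if v: "a \<le> v" for v
  proof (rule ccontr)
    assume n: "\<not> h v \<le> h a"
    \<comment> \<open>Continuation argument: let \<open>t\<close> be the last point where
      \<open>h \<le> h a\<close>. By continuity \<open>h\<close> is still negative slightly beyond
      \<open>t\<close>, hence decreasing there, which yields a later point of
      \<open>S\<close>.\<close>
    define S where "S = {x \<in> {a..v}. h x \<in> {..h a}}"
    have cS: "compact S"
      using continuous_closed_preimage[OF hc[of a v], of "{..h a}"]
      by (auto simp: S_def vimage_def Int_def compact_eq_bounded_closed intro: bounded_subset[of "{a..v}"])
    have "S \<noteq> {}" using v by (auto simp: S_def)
    from compact_attains_sup[OF cS this] obtain t where t: "t \<in> S" "\<And>x. x \<in> S \<Longrightarrow> x \<le> t" by auto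
    have tv: "t < v" using t(1) n by (cases "t = v") (auto simp: S_def)
    have "isCont h t" using t by (intro DERIV_isCont[OF hd]) (auto simp: S_def)
    then have "(h \<longlongrightarrow> h t) (at t)" by (simp add: isCont_def)
    moreover have "h t < 0" using t neg by (auto simp: S_def)
    ultimately have "\<forall>\<^sub>F x in at t. h x < 0" by (rule order_tendstoD(2))
    then obtain d where d: "d > 0" "\<And>x. x \<noteq> t \<Longrightarrow> dist x t < d \<Longrightarrow> h x < 0"
      unfolding eventually_at by blast
    define s where "s = min v (t + d / 2)"
    have s: "t < s" "s \<le> v" using d tv by (auto simp: s_def)
    have "h s \<le> h t"
    proof (rule dec)
      fix y assume "t \<le> y" "y \<le> s"
      then show "h y \<le> 0" using d(2)[of y] \<open>h t < 0\<close> d(1) by (cases "y = t") (auto simp: s_def dist_real_def)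
    qed (use t s in \<open>auto simp: S_def\<close>)
    then have "s \<in> S" using t s by (auto simp: S_def)
    then show False using t(2)[of s] s by simp
  qed
  have "0 \<le> h a"
    using le eventually_mono[OF eventually_ge_at_top[of a], of "\<lambda>i. h i \<le> h a"] lim
    by (intro tendsto_upperbound[of h 0 at_top]) (auto simp: h_def[abs_def])
  then show False using neg by simp
qed

section \<open>Wronskian identities in the index\<close>

text \<open>Joint continuity: the change in the index is controlled uniformly for arguments bounded
  below, and the change in the argument by differentiability at the fixed index.\<close>

lemma pcD_tendsto [tendsto_intros]:
  assumes f: "(f \<longlongrightarrow> p) F" and g: "(g \<longlongrightarrow> z) F"
  shows "((\<lambda>x. pcD (f x) (g x)) \<longlongrightarrow> pcD p z) F"
proof -
  obtain n where n: "p + 1 \<le> real n" using real_arch_simple by blast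
  obtain C where C: "C > 0" "\<And>q y. \<bar>q - p\<bar> \<le> 1 \<Longrightarrow> y \<ge> - \<bar>z - 1\<bar> \<Longrightarrow> \<bar>pcD q y - pcD p y\<bar> \<le> C * \<bar>q - p\<bar> * exp (- 2 * y)"
    using pcD_lipschitz_index[of n "\<bar>z - 1\<bar>"] n by blast
  have "((\<lambda>x. pcD (f x) (g x) - pcD p (g x)) \<longlongrightarrow> 0) F"
  proof (rule Lim_null_comparison)
    have "\<forall>\<^sub>F x in F. \<bar>f x - p\<bar> < 1" using tendstoD[OF f, of 1] by (simp add: dist_real_def)
    moreover have "\<forall>\<^sub>F x in F. \<bar>g x - z\<bar> < 1" using tendstoD[OF g, of 1] by (simp add: dist_real_def)
    ultimately show "\<forall>\<^sub>F x in F. norm (pcD (f x) (g x) - pcD p (g x)) \<le> C * \<bar>f x - p\<bar> * exp (- 2 * g x)"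
    proof eventually_elim
      case (elim x) then show ?case using C(2)[of "f x" "g x"] by simp
    qed
    have "((\<lambda>x. C * \<bar>f x - p\<bar> * exp (- 2 * g x)) \<longlongrightarrow> C * \<bar>p - p\<bar> * exp (- 2 * z)) F"
      by (intro tendsto_intros f g)
    then show "((\<lambda>x. C * \<bar>f x - p\<bar> * exp (- 2 * g x)) \<longlongrightarrow> 0) F" by simp
  qed
  moreover have "((\<lambda>x. pcD p (g x)) \<longlongrightarrow> pcD p z) F"
    using DERIV_isCont[OF pcD_deriv] g by (rule isCont_tendsto_compose)
  ultimately show ?thesis using tendsto_add[of "\<lambda>x. pcD (f x) (g x) - pcD p (g x)" 0 F] by fastforce
qed

lemma pcD'_tendsto [tendsto_intros]:
  assumes f: "(f \<longlongrightarrow> p) F" and g: "(g \<longlongrightarrow> z) F"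
  shows "((\<lambda>x. pcD' (f x) (g x)) \<longlongrightarrow> pcD' p z) F"
  unfolding pcD'_eq by (intro tendsto_intros f g) simp

lemma continuous_on_pcD [continuous_intros]:
  "continuous_on S f \<Longrightarrow> continuous_on S g \<Longrightarrow> continuous_on S (\<lambda>x. pcD (f x) (g x))"
  unfolding continuous_on_def by (auto intro: pcD_tendsto)

lemma continuous_on_pcD' [continuous_intros]:
  "continuous_on S f \<Longrightarrow> continuous_on S g \<Longrightarrow> continuous_on S (\<lambda>x. pcD' (f x) (g x))"
  unfolding continuous_on_def by (auto intro: pcD'_tendsto)

lemma pcD_exp_bound: obtains C where "C > 0" "\<And>z. z \<ge> b \<Longrightarrow> \<bar>pcD \<nu> z\<bar> \<le> C * exp (- 2 * z)"
proof -
  obtain n where "\<nu> \<le> real n" using real_arch_simple by blast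
  then show ?thesis using pcD_bound[of n "- b"] that by auto
qed

lemma pcD'_exp_bound: obtains C where "C > 0" "\<And>z. z \<ge> b \<Longrightarrow> \<bar>pcD' \<nu> z\<bar> \<le> C * exp (- z)"
proof -
  obtain C1 where C1: "C1 > 0" "\<And>z. z \<ge> min b 0 \<Longrightarrow> \<bar>pcD \<nu> z\<bar> \<le> C1 * exp (- 2 * z)" using pcD_exp_bound by blast
  obtain C2 where C2: "C2 > 0" "\<And>z. z \<ge> min b 0 \<Longrightarrow> \<bar>pcD (\<nu> + 1) z\<bar> \<le> C2 * exp (- 2 * z)" using pcD_exp_bound by blast
  define m where "m = \<bar>b\<bar> * exp \<bar>b\<bar> + 1"
  define e where "e = exp \<bar>b\<bar>"
  have "\<bar>pcD' \<nu> z\<bar> \<le> (m * C1 + e * C2) * exp (- z)" if z: "z \<ge> b" for z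
  proof -
    have b: "\<bar>z\<bar> * exp (- z) \<le> m"
    proof (cases "z \<ge> 0")
      case True
      have "z \<le> exp z" using exp_ge_add_one_self[of z] by linarith
      then have "\<bar>z\<bar> * exp (- z) \<le> 1" using True by (simp add: exp_minus field_simps)
      moreover have "1 \<le> m" by (simp add: m_def)
      ultimately show ?thesis by linarith
    next
      case False
      then have "\<bar>z\<bar> * exp (- z) \<le> \<bar>b\<bar> * exp \<bar>b\<bar>" using z by (intro mult_mono) auto
      then show ?thesis by (simp add: m_def)
    qed
    have e: "exp (- z) \<le> e" using z by (auto simp: e_def)
    have z': "z \<ge> min b 0" using z by simp
    have "\<bar>pcD' \<nu> z\<bar> \<le> \<bar>z / 2 * pcD \<nu> z\<bar> + \<bar>pcD (\<nu> + 1) z\<bar>" unfolding pcD'_eq by (rule abs_triangle_ineq4)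
    also have "\<bar>z / 2 * pcD \<nu> z\<bar> \<le> \<bar>z\<bar> * (C1 * exp (- 2 * z))"
      unfolding abs_mult by (intro mult_mono C1(2)[OF z']) simp_all
    also have "\<bar>pcD (\<nu> + 1) z\<bar> \<le> C2 * exp (- 2 * z)" by (rule C2(2)[OF z'])
    \<comment> \<open>One of the two exponentials is spent on the factor z in
      \<open>D' = z / 2 D - D_(\<nu>+1)\<close>.\<close>
    also have "exp (- 2 * z) = exp (- z) * exp (- z)" by (simp flip: exp_add)
    also have "\<bar>z\<bar> * (C1 * (exp (- z) * exp (- z))) + C2 * (exp (- z) * exp (- z)) =
       (\<bar>z\<bar> * exp (- z)) * (C1 * exp (- z)) + exp (- z) * (C2 * exp (- z))" by (simp add: algebra_simps)
    also have "\<dots> \<le> m * (C1 * exp (- z)) + e * (C2 * exp (- z))"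
      using b e C1(1) C2(1) by (intro add_mono mult_right_mono) simp_all
    finally show ?thesis by (simp add: algebra_simps)
  qed
  moreover have "m > 0" "e > 0" by (simp_all add: m_def e_def add_nonneg_pos)
  then have "m * C1 + e * C2 > 0" using C1(1) C2(1) by (intro add_pos_pos mult_pos_pos)
  ultimately show ?thesis using that by blast
qed

lemma pcD_at_top: "(pcD \<nu> \<longlongrightarrow> 0) at_top" "((\<lambda>z. z * pcD \<nu> z) \<longlongrightarrow> 0) at_top" "(pcD' \<nu> \<longlongrightarrow> 0) at_top"
proof -
  obtain C where C: "C > 0" "\<And>z. z \<ge> 0 \<Longrightarrow> \<bar>pcD \<nu> z\<bar> \<le> C * exp (- 2 * z)" using pcD_exp_bound[of 0] by blast
  obtain C' where C': "C' > 0" "\<And>z. z \<ge> 0 \<Longrightarrow> \<bar>pcD' \<nu> z\<bar> \<le> C' * exp (- z)" using pcD'_exp_bound[of 0] by blast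
  have 1: "((\<lambda>z. C * exp (- 2 * z)) \<longlongrightarrow> 0) at_top" by real_asymp
  have 2: "((\<lambda>z. z * (C * exp (- 2 * z))) \<longlongrightarrow> 0) at_top" by real_asymp
  have 3: "((\<lambda>z. C' * exp (- z)) \<longlongrightarrow> 0) at_top" by real_asymp
  show "(pcD \<nu> \<longlongrightarrow> 0) at_top"
    by (rule Lim_null_comparison[OF _ 1]) (use C(2) eventually_mono[OF eventually_ge_at_top[of "0::real"]] in simp)
  show "((\<lambda>z. z * pcD \<nu> z) \<longlongrightarrow> 0) at_top"
    by (rule Lim_null_comparison[OF _ 2], rule eventually_mono[OF eventually_ge_at_top[of "0::real"]])
      (use C(2) in \<open>simp add: abs_mult mult_left_mono\<close>)
  show "(pcD' \<nu> \<longlongrightarrow> 0) at_top"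
    by (rule Lim_null_comparison[OF _ 3]) (use C'(2) eventually_mono[OF eventually_ge_at_top[of "0::real"]] in simp)
qed

lemma integrable_exp_tail:
  fixes b :: real
  shows "integrable lborel (\<lambda>z. indicator {b..} z * exp (- 4 * z))"
proof -
  have "integrable lebesgue (\<lambda>z. indicat_real {b..} z *\<^sub>R exp (- 4 * z))"
    by (intro nonnegative_absolutely_integrable_1[unfolded set_integrable_def] integrable_on_exp_minus_to_infinity) auto
  moreover have "(\<lambda>z. indicat_real {b..} z *\<^sub>R exp (- 4 * z)) \<in> borel_measurable lborel" by simp
  ultimately show ?thesis by (subst (asm) integrable_completion) simp_all
qed

definition pc_inner :: "real \<Rightarrow> real \<Rightarrow> real \<Rightarrow> real" where
  "pc_inner p q a = (LINT z|lborel. indicator {a..} z * (pcD p z * pcD q z))"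

lemma borel_measurable_pcD [measurable]: "pcD \<nu> \<in> borel_measurable borel"
  by (intro borel_measurable_continuous_onI DERIV_continuous_on[OF has_field_derivative_at_within[OF pcD_deriv]])

lemma integrable_pc_inner: "integrable lborel (\<lambda>z. indicator {a..} z * (pcD p z * pcD q z))"
proof -
  obtain C1 where C1: "C1 > 0" "\<And>z. z \<ge> a \<Longrightarrow> \<bar>pcD p z\<bar> \<le> C1 * exp (- 2 * z)" using pcD_exp_bound by blast
  obtain C2 where C2: "C2 > 0" "\<And>z. z \<ge> a \<Longrightarrow> \<bar>pcD q z\<bar> \<le> C2 * exp (- 2 * z)" using pcD_exp_bound by blast
  show ?thesis
  proof (rule Bochner_Integration.integrable_bound[OF integrable_mult_right[OF integrable_exp_tail[of a], of "C1 * C2"]])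
    show "AE z in lborel. norm (indicator {a..} z * (pcD p z * pcD q z)) \<le> norm (C1 * C2 * (indicator {a..} z * exp (- 4 * z)))"
    proof (rule AE_I2)
      fix z
      show "norm (indicator {a..} z * (pcD p z * pcD q z)) \<le> norm (C1 * C2 * (indicator {a..} z * exp (- 4 * z)))"
      proof (cases "z \<ge> a")
        case True
        have "\<bar>pcD p z\<bar> * \<bar>pcD q z\<bar> \<le> (C1 * exp (- 2 * z)) * (C2 * exp (- 2 * z))"
          using True C1(1) by (intro mult_mono C1 C2) auto
        also have "\<dots> = C1 * C2 * (exp (- 2 * z) * exp (- 2 * z))" by (simp only: mult_ac)
        also have "exp (- 2 * z) * exp (- 2 * z) = exp (- 4 * z)" by (simp flip: exp_add)
        finally show ?thesis using True C1(1) C2(1) by (simp add: abs_mult)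
      next
        case False
        then show ?thesis by (simp add: indicator_def)
      qed
    qed
  qed measurable
qed

text \<open>By Weber's equation \<open>D_q D_p' - D_p D_q'\<close> has derivative
  \<open>(q - p) D_p D_q\<close>; integrate from \<open>a\<close> to infinity, where the boundary
  term vanishes.\<close>

lemma pc_wronskian:
  "pcD p a * pcD' q a - pcD q a * pcD' p a = (q - p) * pc_inner p q a"
proof -
  define G where "G z = pcD q z * pcD' p z - pcD p z * pcD' q z" for z
  define f where "f z = (q - p) * (pcD p z * pcD q z)" for z
  have int: "integrable lborel (\<lambda>z. indicator {a..} z * f z)"
    using integrable_mult_right[OF integrable_pc_inner[of a p q], of "q - p"] by (simp add: f_def mult.left_commute)
  have G': "(G has_real_derivative f z) (at z)" for z
    unfolding G_def f_def by (auto intro!: derivative_eq_intros pcD_deriv pcD'_deriv simp: algebra_simps)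
  have "((\<lambda>y. LINT z|lborel. indicator {..y} z *\<^sub>R (indicator {a..} z * f z)) \<longlongrightarrow> (LINT z|lborel. indicator {a..} z * f z)) at_top"
    by (rule tendsto_integral_at_top[OF _ int]) simp
  moreover have "\<forall>\<^sub>F y in at_top. (LINT z|lborel. indicator {..y} z *\<^sub>R (indicator {a..} z * f z)) = G y - G a"
    using eventually_ge_at_top[of a]
  proof eventually_elim
    case (elim y)
    have "(\<lambda>z. indicator {..y} z *\<^sub>R (indicator {a..} z * f z)) = (\<lambda>z. indicator {a..y} z *\<^sub>R f z)"
      by (auto simp: fun_eq_iff indicator_def)
    moreover have "(LINT z|lborel. indicator {a..y} z *\<^sub>R f z) = G y - G a"
    proof (rule integral_FTC_Icc[OF elim])
      show "continuous_on {a..y} f" unfolding f_def by (intro continuous_intros)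
      show "(G has_vector_derivative f z) (at z within {a..y})" for z
        using has_field_derivative_at_within[OF G'[of z]] by (simp add: has_real_derivative_iff_has_vector_derivative)
    qed
    ultimately show ?case by simp
  qed
  ultimately have "((\<lambda>y. G y - G a) \<longlongrightarrow> (LINT z|lborel. indicator {a..} z * f z)) at_top"
    by (rule Lim_transform_eventually)
  moreover have "((\<lambda>y. G y - G a) \<longlongrightarrow> (0 * 0 - 0 * 0) - G a) at_top"
    unfolding G_def by (intro tendsto_intros pcD_at_top)
  ultimately have "(LINT z|lborel. indicator {a..} z * f z) = - G a"
    using tendsto_unique[OF trivial_limit_at_top_linorder] by fastforce
  moreover have "(LINT z|lborel. indicator {a..} z * f z) = (q - p) * pc_inner p q a"
    unfolding pc_inner_def f_def integral_mult_right_zero[symmetric]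
    by (rule Bochner_Integration.integral_cong) (auto simp: algebra_simps)
  ultimately show ?thesis by (simp add: G_def)
qed

lemma pc_inner_self_nonneg_mono:
  assumes "a \<le> b" shows "pc_inner p p b \<le> pc_inner p p a"
  unfolding pc_inner_def
  by (intro integral_mono integrable_pc_inner) (use assms in \<open>auto simp: indicator_def\<close>)

lemma pc_inner_self_pos: "pc_inner p p a > 0"
proof -
  have "\<exists>c>a. pcD p c \<noteq> 0"
  proof (rule ccontr)
    assume n: "\<not> (\<exists>c>a. pcD p c \<noteq> 0)"
    have "(pcD p has_real_derivative 0) (at (a + 1))"
      by (rule has_field_derivative_transform_within_open[of "\<lambda>_. 0" 0 "a + 1" "{a<..}"]) (use n in auto)
    then have "pcD' p (a + 1) = 0" using DERIV_unique[OF pcD_deriv] by blast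
    then show False using n pcD_or_pcD'_nonzero[of p "a + 1"] by simp
  qed
  then obtain c where c: "c > a" "pcD p c \<noteq> 0" by blast
  define e where "e = (pcD p c)\<^sup>2 / 2"
  have e: "e > 0" "e < (pcD p c)\<^sup>2" using c by (auto simp: e_def)
  have "((\<lambda>z. (pcD p z)\<^sup>2) \<longlongrightarrow> (pcD p c)\<^sup>2) (at c)" by (intro tendsto_intros)
  from order_tendstoD(1)[OF this e(2)] obtain d where d: "d > 0" "\<And>z. z \<noteq> c \<Longrightarrow> dist z c < d \<Longrightarrow> (pcD p z)\<^sup>2 > e"
    unfolding eventually_at by blast
  have d': "(pcD p z)\<^sup>2 \<ge> e" if "\<bar>z - c\<bar> < d" for z using d(2)[of z] that e by (cases "z = c") (auto simp: dist_real_def)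
  have "(LINT z|lborel. e * indicator {c..c + d / 2} z) \<le> pc_inner p p a"
    unfolding pc_inner_def
  proof (rule integral_mono)
    show "integrable lborel (\<lambda>z. e * indicator {c..c + d / 2} z)"
      by (intro integrable_mult_right integrable_real_indicator) (use d(1) in simp_all)
    show "e * indicator {c..c + d / 2} z \<le> indicator {a..} z * (pcD p z * pcD p z)" for z
      using d'[of z] d(1) c(1) by (simp add: indicator_def power2_eq_square)
  qed (rule integrable_pc_inner)
  moreover have "(LINT z|lborel. e * indicator {c..c + d / 2} z) = e * (d / 2)" using d(1) by simp
  moreover have "e * (d / 2) > 0" using e(1) d(1) by simp
  ultimately show ?thesis by linarith
qed

lemma pc_inner_lipschitz:
  obtains C where "C > 0" "\<And>q a. \<bar>q - p\<bar> \<le> 1 \<Longrightarrow> b \<le> a \<Longrightarrow> \<bar>pc_inner p q a - pc_inner p p a\<bar> \<le> C * \<bar>q - p\<bar>"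
proof -
  obtain n where n: "p + 1 \<le> real n" using real_arch_simple by blast
  obtain C1 where C1: "C1 > 0" "\<And>q z. \<bar>q - p\<bar> \<le> 1 \<Longrightarrow> z \<ge> b \<Longrightarrow> \<bar>pcD q z - pcD p z\<bar> \<le> C1 * \<bar>q - p\<bar> * exp (- 2 * z)"
    using pcD_lipschitz_index[of n "- b"] n by auto
  obtain C2 where C2: "C2 > 0" "\<And>z. z \<ge> b \<Longrightarrow> \<bar>pcD p z\<bar> \<le> C2 * exp (- 2 * z)" using pcD_exp_bound by blast
  define E where "E = (LINT z|lborel. indicator {b..} z * exp (- 4 * z))"
  have E: "E \<ge> 0" unfolding E_def by (intro integral_nonneg_AE) auto
  have "\<bar>pc_inner p q a - pc_inner p p a\<bar> \<le> C1 * C2 * (E + 1) * \<bar>q - p\<bar>" if h: "\<bar>q - p\<bar> \<le> 1" "b \<le> a" for q a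
  proof -
    have eq: "pc_inner p q a - pc_inner p p a = (LINT z|lborel. indicator {a..} z * (pcD p z * pcD q z) - indicator {a..} z * (pcD p z * pcD p z))"
      unfolding pc_inner_def by (simp add: integrable_pc_inner)
    have "\<bar>pc_inner p q a - pc_inner p p a\<bar> \<le> (LINT z|lborel. C1 * C2 * \<bar>q - p\<bar> * (indicator {b..} z * exp (- 4 * z)))"
      unfolding eq
    proof (rule Bochner_Integration.integral_abs_bound_integral)
      show "integrable lborel (\<lambda>z. C1 * C2 * \<bar>q - p\<bar> * (indicator {b..} z * exp (- 4 * z)))"
        using integrable_exp_tail by (rule integrable_mult_right)
      fix z
      show "\<bar>indicator {a..} z * (pcD p z * pcD q z) - indicator {a..} z * (pcD p z * pcD p z)\<bar> \<le>
          C1 * C2 * \<bar>q - p\<bar> * (indicator {b..} z * exp (- 4 * z))"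
      proof (cases "z \<ge> a")
        case True
        have "\<bar>pcD p z * pcD q z - pcD p z * pcD p z\<bar> = \<bar>pcD q z - pcD p z\<bar> * \<bar>pcD p z\<bar>"
          by (subst abs_mult[symmetric]) (simp add: algebra_simps)
        also have "\<dots> \<le> (C1 * \<bar>q - p\<bar> * exp (- 2 * z)) * (C2 * exp (- 2 * z))"
          using True h C1(1) C2(1) by (intro mult_mono C1(2) C2(2)) auto
        also have "\<dots> = C1 * C2 * \<bar>q - p\<bar> * (exp (- 2 * z) * exp (- 2 * z))" by (simp only: mult_ac)
        also have "exp (- 2 * z) * exp (- 2 * z) = exp (- 4 * z)" by (simp flip: exp_add)
        finally show ?thesis using True h by simp
      next
        case False then show ?thesis using C1(1) C2(1) by (simp add: indicator_def)
      qed
    qed (intro Bochner_Integration.integrable_diff integrable_pc_inner)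
    also have "\<dots> = C1 * C2 * \<bar>q - p\<bar> * E" unfolding E_def by (rule integral_mult_right_zero)
    also have "\<dots> \<le> C1 * C2 * \<bar>q - p\<bar> * (E + 1)" using C1(1) C2(1) by (intro mult_left_mono) simp_all
    finally show ?thesis by (simp only: mult_ac)
  qed
  moreover have "C1 * C2 * (E + 1) > 0" using C1(1) C2(1) E by simp
  ultimately show ?thesis using that by blast
qed

text \<open>Positivity must be uniform in the endpoint, since on the threshold curve index and
  endpoint move together. The norm integral shrinks as the endpoint grows, so its value at
  \<open>c\<close> is a lower bound, and the Lipschitz constant does not depend on the
  endpoint.\<close>

lemma pc_inner_eventually_pos:
  obtains d where "d > 0" "\<And>q a. \<bar>q - p\<bar> < d \<Longrightarrow> b \<le> a \<Longrightarrow> a \<le> c \<Longrightarrow> pc_inner p q a > 0"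
proof -
  obtain C where C: "C > 0" "\<And>q a. \<bar>q - p\<bar> \<le> 1 \<Longrightarrow> b \<le> a \<Longrightarrow> \<bar>pc_inner p q a - pc_inner p p a\<bar> \<le> C * \<bar>q - p\<bar>"
    using pc_inner_lipschitz by blast
  define d where "d = min 1 (pc_inner p p c / C)"
  have "pc_inner p q a > 0" if h: "\<bar>q - p\<bar> < d" "b \<le> a" "a \<le> c" for q a
  proof -
    have "C * \<bar>q - p\<bar> < pc_inner p p c" using h(1) C(1) by (simp add: d_def field_simps)
    moreover have "pc_inner p p c \<le> pc_inner p p a" by (rule pc_inner_self_nonneg_mono[OF h(3)])
    moreover have "\<bar>pc_inner p q a - pc_inner p p a\<bar> \<le> C * \<bar>q - p\<bar>" using C(2)[of q a] h by (simp add: d_def)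
    ultimately show ?thesis by linarith
  qed
  moreover have "d > 0" using C(1) pc_inner_self_pos[of p c] by (simp add: d_def)
  ultimately show ?thesis using that by blast
qed

section \<open>Index zero and small positive index\<close>

lemma pcD_1: "pcD 1 z = z * pcD 0 z" and pcD_2: "pcD 2 z = (z\<^sup>2 - 1) * pcD 0 z"
proof -
  \<comment> \<open>At index -1 the coefficient of the last term of the recurrence is zero.\<close>
  show 1: "pcD 1 z = z * pcD 0 z" using pcD_recurrence[of "-1" z] by simp
  show "pcD 2 z = (z\<^sup>2 - 1) * pcD 0 z" using pcD_recurrence[of 0 z] 1 by (simp add: power2_eq_square algebra_simps)
qed

lemma pcD'_0: "pcD' 0 z = - z / 2 * pcD 0 z"
  using pcD'_eq[of 0 z] by (simp add: pcD_1)

text \<open>\<open>D_0\<close> obeys the first-order equation \<open>D' = - z / 2 D\<close> (it is a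
  Gaussian), so a zero would be a common zero of D and D'. The sign is read off at
  \<open>z = 1\<close>, where the integrand on Re u = 1 is real and positive.\<close>

lemma pcD_0_pos: "pcD 0 z > 0"
proof -
  have nz: "pcD 0 y \<noteq> 0" for y using pcD_or_pcD'_nonzero[of 0 y] by (auto simp: pcD'_0)
  have "pc_kernel 0 1 (Complex 1 t) = of_real (exp (- 1 / 2) * exp (- t\<^sup>2 / 2))" for t
  proof -
    have "Complex 1 t \<noteq> 0" by (simp add: complex_eq_iff)
    then have "pc_kernel 0 1 (Complex 1 t) = exp (- Complex 1 t + (Complex 1 t)\<^sup>2 / 2)"
      unfolding exp_add by (simp add: pc_kernel_def)
    also have "- Complex 1 t + (Complex 1 t)\<^sup>2 / 2 = of_real (- 1 / 2 + - t\<^sup>2 / 2)"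
      by (simp add: complex_eq_iff power2_eq_square diff_divide_distrib)
    finally show ?thesis by (simp only: exp_of_real exp_add)
  qed
  then have "pc_int 0 1 1 = of_real (exp (- 1 / 2) * (LINT t|lborel. exp (- t\<^sup>2 / 2)))"
    unfolding pc_int_def by simp
  then have one: "pcD 0 1 > 0" using gauss_integral_pos by (simp add: pcD_eq_pc_int)
  show ?thesis
  proof (rule ccontr)
    assume "\<not> ?thesis"
    then have neg: "pcD 0 z \<le> 0" by simp
    have c: "continuous_on S (pcD 0)" for S
      by (intro DERIV_continuous_on[OF has_field_derivative_at_within[OF pcD_deriv]])
    show False
    proof (cases "z \<le> 1")
      case True
      from IVT'[OF neg _ True c, of] one nz show False by force
    next
      case False
      then have "1 \<le> z" by simp
      from IVT2'[OF neg _ this c] one nz show False by force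
    qed
  qed
qed

text \<open>At index 0 the matching holds exactly with slope \<open>b / 2\<close>: this is the
  trivial root. The Wronskian with \<open>D_0\<close> shows that a small positive index pushes the
  left slope strictly above \<open>b / 2\<close>, while the slopes on the right never exceed
  \<open>b / 2\<close>.\<close>

lemma pcD_small_index:
  obtains e where "e > 0" "\<And>q. 0 < q \<Longrightarrow> q < e \<Longrightarrow> pcD q (- b) > 0 \<and> pcD' q (- b) > b / 2 * pcD q (- b)"
proof -
  obtain d where d: "d > 0" "\<And>q a. \<bar>q - 0\<bar> < d \<Longrightarrow> - b \<le> a \<Longrightarrow> a \<le> - b \<Longrightarrow> pc_inner 0 q a > 0"
    using pc_inner_eventually_pos[of 0 "- b" "- b"] by blast
  have "((\<lambda>q. pcD q (- b)) \<longlongrightarrow> pcD 0 (- b)) (at 0)" by (intro tendsto_intros)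
  from order_tendstoD(1)[OF this pcD_0_pos] obtain d' where d': "d' > 0" "\<And>q. q \<noteq> 0 \<Longrightarrow> dist q 0 < d' \<Longrightarrow> pcD q (- b) > 0"
    unfolding eventually_at by blast
  have "pcD q (- b) > 0 \<and> pcD' q (- b) > b / 2 * pcD q (- b)" if q: "0 < q" "q < min d d'" for q
  proof -
    have "pcD 0 (- b) * (pcD' q (- b) - b / 2 * pcD q (- b)) = q * pc_inner 0 q (- b)"
      using pc_wronskian[of 0 "- b" q] by (simp add: pcD'_0 algebra_simps)
    moreover have "q * pc_inner 0 q (- b) > 0" using q d(2)[of q "- b"] by simp
    ultimately have "pcD' q (- b) - b / 2 * pcD q (- b) > 0"
      using pcD_0_pos[of "- b"] by (metis zero_less_mult_pos)
    then show ?thesis using d'(2)[of q] q by (simp add: dist_real_def)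
  qed
  then show ?thesis using that[of "min d d'"] d d' by simp
qed

lemma derivative_pos_local_sign:
  fixes f :: "real \<Rightarrow> real"
  assumes "(f has_real_derivative l) (at x)" "f x = 0" "l > 0"
  obtains d where "d > 0" "\<And>y. x < y \<Longrightarrow> y < x + d \<Longrightarrow> f y > 0" "\<And>y. x - d < y \<Longrightarrow> y < x \<Longrightarrow> f y < 0"
proof -
  obtain d1 where d1: "d1 > 0" "\<And>h. 0 < h \<Longrightarrow> h < d1 \<Longrightarrow> f x < f (x + h)"
    using DERIV_pos_inc_right[OF assms(1,3)] by blast
  obtain d2 where d2: "d2 > 0" "\<And>h. 0 < h \<Longrightarrow> h < d2 \<Longrightarrow> f (x - h) < f x"
    using DERIV_pos_inc_left[OF assms(1,3)] by blast
  show ?thesis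
  proof (rule that[of "min d1 d2"])
    fix y assume "x < y" "y < x + min d1 d2"
    then show "f y > 0" using d1(2)[of "y - x"] assms(2) by simp
  next
    fix y assume "x - min d1 d2 < y" "y < x"
    then show "f y < 0" using d2(2)[of "x - y"] assms(2) by simp
  qed (use d1(1) d2(1) in simp)
qed

section \<open>Zeros of D' on the curve of index b^2/4 and argument -b\<close>

definition threshold_slope :: "real \<Rightarrow> real" where
  "threshold_slope b = pcD' (b\<^sup>2 / 4) (- b)"

lemma mult_neg_imp_neg: "0 < a \<Longrightarrow> a * b < 0 \<Longrightarrow> b < (0::real)"
  by (simp add: mult_less_0_iff)

text \<open>On the curve \<open>\<nu> = b\<^sup>2 / 4\<close> the coefficient of the equation at \<open>z = - b\<close> is \<open>- 1 / 2\<close>,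
  so both moving the index and moving the argument turn \<open>(D, D')\<close> in the same direction
  whenever \<open>D' = 0\<close>.\<close>

lemma threshold_slope_crossing:
  assumes b0: "b0 \<ge> 0" and zero: "threshold_slope b0 = 0"
  obtains d where "d > 0"
    "\<And>b. b0 < b \<Longrightarrow> b < b0 + d \<Longrightarrow> threshold_slope b * pcD (b0\<^sup>2 / 4) (- b0) > 0"
    "\<And>b. 0 \<le> b \<Longrightarrow> b0 - d < b \<Longrightarrow> b < b0 \<Longrightarrow> threshold_slope b * pcD (b0\<^sup>2 / 4) (- b0) < 0"
proof -
  define p0 where "p0 = b0\<^sup>2 / 4"
  define D where "D = pcD p0 (- b0)"
  have D: "D \<noteq> 0" using pcD_or_pcD'_nonzero[of p0 "- b0"] zero by (auto simp: D_def threshold_slope_def p0_def)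
  have "((\<lambda>b. D * pcD' p0 (- b)) has_real_derivative D * (((- b0)\<^sup>2 / 4 - p0 - 1 / 2) * pcD p0 (- b0) * - 1)) (at b0)"
    by (intro DERIV_cmult DERIV_chain2[OF pcD'_deriv]) (auto intro!: derivative_eq_intros)
  moreover have "D * (((- b0)\<^sup>2 / 4 - p0 - 1 / 2) * pcD p0 (- b0) * - 1) = D\<^sup>2 / 2"
    by (simp add: p0_def D_def power2_eq_square)
  ultimately have "((\<lambda>b. D * pcD' p0 (- b)) has_real_derivative D\<^sup>2 / 2) (at b0)" by (simp only:)
  moreover have "D * pcD' p0 (- b0) = 0" using zero by (simp add: p0_def threshold_slope_def)
  ultimately obtain d1 where d1: "d1 > 0" "\<And>b. b0 < b \<Longrightarrow> b < b0 + d1 \<Longrightarrow> D * pcD' p0 (- b) > 0"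
     "\<And>b. b0 - d1 < b \<Longrightarrow> b < b0 \<Longrightarrow> D * pcD' p0 (- b) < 0"
    using derivative_pos_local_sign[of "\<lambda>b. D * pcD' p0 (- b)" "D\<^sup>2 / 2" b0] D by auto
  obtain d2 where d2: "d2 > 0" "\<And>q a. \<bar>q - p0\<bar> < d2 \<Longrightarrow> - b0 - 1 \<le> a \<Longrightarrow> a \<le> - b0 + 1 \<Longrightarrow> pc_inner p0 q a > 0"
    using pc_inner_eventually_pos by blast
  have "((\<lambda>b. \<bar>b\<^sup>2 / 4 - p0\<bar>) \<longlongrightarrow> \<bar>b0\<^sup>2 / 4 - p0\<bar>) (at b0)" by (intro tendsto_intros) auto
  then have "((\<lambda>b. \<bar>b\<^sup>2 / 4 - p0\<bar>) \<longlongrightarrow> 0) (at b0)" by (simp add: p0_def)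
  from order_tendstoD(2)[OF this d2(1)] obtain d3 where d3: "d3 > 0" "\<And>b. b \<noteq> b0 \<Longrightarrow> dist b b0 < d3 \<Longrightarrow> \<bar>b\<^sup>2 / 4 - p0\<bar> < d2"
    unfolding eventually_at by blast
  have DD: "D * D > 0" using D by (simp add: zero_less_mult_iff) linarith
  have "((\<lambda>b. D * pcD (b\<^sup>2 / 4) (- b)) \<longlongrightarrow> D * pcD (b0\<^sup>2 / 4) (- b0)) (at b0)" by (intro tendsto_intros) auto
  then have "((\<lambda>b. D * pcD (b\<^sup>2 / 4) (- b)) \<longlongrightarrow> D * D) (at b0)" by (simp add: p0_def D_def)
  from order_tendstoD(1)[OF this DD] obtain d4 where d4: "d4 > 0" "\<And>b. b \<noteq> b0 \<Longrightarrow> dist b b0 < d4 \<Longrightarrow> D * pcD (b\<^sup>2 / 4) (- b) > 0"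
    unfolding eventually_at by blast
  have "((\<lambda>b. D * pcD p0 (- b)) \<longlongrightarrow> D * pcD p0 (- b0)) (at b0)" by (intro tendsto_intros)
  then have "((\<lambda>b. D * pcD p0 (- b)) \<longlongrightarrow> D * D) (at b0)" by (simp add: D_def)
  from order_tendstoD(1)[OF this DD] obtain d5 where d5: "d5 > 0" "\<And>b. b \<noteq> b0 \<Longrightarrow> dist b b0 < d5 \<Longrightarrow> D * pcD p0 (- b) > 0"
    unfolding eventually_at by blast
  define d where "d = min (min (min d1 d3) (min d4 d5)) 1"
  \<comment> \<open>The Wronskian identity between the indices \<open>p0\<close> and
    \<open>b^2 / 4\<close>, multiplied by \<open>D^2\<close> so that the sign of each factor near
    \<open>b0\<close> is known. The first term on the right is the effect of moving the argument,
    the second that of moving the index.\<close>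
  have key: "(D * pcD p0 (- b)) * (threshold_slope b * D) =
      (D * pcD (b\<^sup>2 / 4) (- b)) * (D * pcD' p0 (- b)) + (b\<^sup>2 / 4 - p0) * (D * D * pc_inner p0 (b\<^sup>2 / 4) (- b))" for b
  proof -
    have w: "pcD p0 (- b) * threshold_slope b = pcD (b\<^sup>2 / 4) (- b) * pcD' p0 (- b) + (b\<^sup>2 / 4 - p0) * pc_inner p0 (b\<^sup>2 / 4) (- b)"
      using pc_wronskian[of p0 "- b" "b\<^sup>2 / 4"] unfolding threshold_slope_def by linarith
    have "(D * pcD p0 (- b)) * (threshold_slope b * D) = D * D * (pcD p0 (- b) * threshold_slope b)"
      by (simp only: mult_ac)
    then show ?thesis unfolding w by (simp only: distrib_left mult_ac)
  qed
  have near: "D * pcD p0 (- b) > 0" "D * pcD (b\<^sup>2 / 4) (- b) > 0" "D * D * pc_inner p0 (b\<^sup>2 / 4) (- b) > 0"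
    if "\<bar>b - b0\<bar> < d" "b \<noteq> b0" for b
  proof -
    show "D * pcD p0 (- b) > 0" using d5(2)[of b] that by (simp add: d_def dist_real_def)
    show "D * pcD (b\<^sup>2 / 4) (- b) > 0" using d4(2)[of b] that by (simp add: d_def dist_real_def)
    have "pc_inner p0 (b\<^sup>2 / 4) (- b) > 0"
    proof (rule d2(2))
      show "\<bar>b\<^sup>2 / 4 - p0\<bar> < d2" using d3(2)[of b] that by (simp add: d_def dist_real_def)
      have "\<bar>b - b0\<bar> < 1" using that(1) by (simp add: d_def)
      then show "- b0 - 1 \<le> - b" "- b \<le> - b0 + 1" by linarith+
    qed
    then show "D * D * pc_inner p0 (b\<^sup>2 / 4) (- b) > 0" using DD by simp
  qed
  show ?thesis
  proof (rule that[of d])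
    show "d > 0" using d1(1) d3(1) d4(1) d5(1) by (simp add: d_def)
    fix b assume b: "b0 < b" "b < b0 + d"
    have n: "\<bar>b - b0\<bar> < d" "b \<noteq> b0" using b by auto
    have "b0\<^sup>2 < b\<^sup>2" using b b0 by (intro power_strict_mono) auto
    then have "(b\<^sup>2 / 4 - p0) * (D * D * pc_inner p0 (b\<^sup>2 / 4) (- b)) > 0" using near(3)[OF n] by (simp add: p0_def)
    moreover have "D * pcD' p0 (- b) > 0" using d1(2)[of b] b by (simp add: d_def)
    then have "(D * pcD (b\<^sup>2 / 4) (- b)) * (D * pcD' p0 (- b)) > 0" using near(2)[OF n] by simp
    ultimately have "(D * pcD p0 (- b)) * (threshold_slope b * D) > 0" unfolding key by linarith
    then have "threshold_slope b * D > 0" using near(1)[OF n] by (simp only: zero_less_mult_pos)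
    then show "threshold_slope b * pcD (b0\<^sup>2 / 4) (- b0) > 0" by (simp only: D_def p0_def)
  next
    fix b assume b: "0 \<le> b" "b0 - d < b" "b < b0"
    have n: "\<bar>b - b0\<bar> < d" "b \<noteq> b0" using b by auto
    have "b\<^sup>2 < b0\<^sup>2" using b b0 by (intro power_strict_mono) auto
    then have "(b\<^sup>2 / 4 - p0) * (D * D * pc_inner p0 (b\<^sup>2 / 4) (- b)) < 0" using near(3)[OF n] by (intro mult_neg_pos) (auto simp: p0_def)
    moreover have "D * pcD' p0 (- b) < 0" using d1(3)[of b] b by (simp add: d_def)
    from mult_pos_neg[OF near(2)[OF n] this]
    have "(D * pcD (b\<^sup>2 / 4) (- b)) * (D * pcD' p0 (- b)) < 0" .
    ultimately have "(D * pcD p0 (- b)) * (threshold_slope b * D) < 0" unfolding key by linarith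
    then have "threshold_slope b * D < 0" using near(1)[OF n] by (rule mult_neg_imp_neg[rotated])
    then show "threshold_slope b * pcD (b0\<^sup>2 / 4) (- b0) < 0" by (simp only: D_def p0_def)
  qed
qed

text \<open>The cut-off \<open>e\<close> makes the set of candidate zeros compact; it is needed
  because 0 itself is a zero of the functions in question.\<close>

lemma least_positive_zero_exists:
  fixes g :: "real \<Rightarrow> real"
  assumes cont: "continuous_on {0..b} g" and e: "e > 0" "\<And>x. 0 < x \<Longrightarrow> x < e \<Longrightarrow> x \<le> b \<Longrightarrow> g x \<noteq> 0"
    and x0: "0 < x0" "x0 \<le> b" "g x0 = 0"
  obtains x where "0 < x" "x \<le> x0" "g x = 0" "\<And>y. 0 < y \<Longrightarrow> y < x \<Longrightarrow> g y \<noteq> 0"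
proof -
  define S where "S = {x \<in> {e..x0}. g x \<in> {0}}"
  have sub: "{e..x0} \<subseteq> {0..b}" using e x0 by auto
  have "closed S" unfolding S_def
    using continuous_closed_preimage[OF continuous_on_subset[OF cont sub] _ closed_singleton[of 0]]
    by (simp add: vimage_def Int_def)
  moreover have "bounded S" by (rule bounded_subset[of "{e..x0}"]) (auto simp: S_def)
  ultimately have cS: "compact S" by (simp add: compact_eq_bounded_closed)
  have "e \<le> x0" using e(2)[of x0] x0 by force
  then have "S \<noteq> {}" using x0 by (auto simp: S_def)
  from compact_attains_inf[OF cS this] obtain x where x: "x \<in> S" "\<And>y. y \<in> S \<Longrightarrow> x \<le> y" by auto
  show ?thesis
  proof (rule that[of x])
    fix y assume y: "0 < y" "y < x"
    show "g y \<noteq> 0"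
    proof
      assume "g y = 0"
      have "x \<le> x0" using x(1) by (simp add: S_def)
      then have "y \<le> b" "y \<le> x0" using y x0(2) by simp_all
      then have "y \<ge> e" using e(2)[of y] y(1) \<open>g y = 0\<close> by (meson not_le)
      then have "y \<in> S" using \<open>y \<le> x0\<close> \<open>g y = 0\<close> by (simp add: S_def)
      then show False using x(2)[of y] y by simp
    qed
  qed (use x e in \<open>auto simp: S_def\<close>)
qed

lemma least_positive_eqI: "is_least_positive P x \<Longrightarrow> least_positive P = x"
  unfolding least_positive_def is_least_positive_def by (rule the_equality) (auto intro: antisym)

lemma continuous_threshold_slope: "continuous_on S threshold_slope"
  unfolding threshold_slope_def[abs_def] by (intro continuous_intros) auto

lemma threshold_slope_0: "threshold_slope 0 = 0"
  by (simp add: threshold_slope_def pcD'_0)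

text \<open>At \<open>b = 2\<close> the index is the integer 1, so everything reduces to
  \<open>D_0\<close>: the value is \<open>- D_1 - D_2 = (2 - 3) D_0\<close> at \<open>- 2\<close>.
  This gives the sign change that makes \<open>beta_star\<close> exist, at most 2.\<close>

lemma threshold_slope_2: "threshold_slope 2 < 0"
  using pcD'_eq[of 1 "- 2"] pcD_0_pos[of "- 2"] by (simp add: threshold_slope_def pcD_1 pcD_2)

lemma threshold_slope_pos_near_0: obtains d where "d > 0" "\<And>b. 0 < b \<Longrightarrow> b < d \<Longrightarrow> threshold_slope b > 0"
proof -
  obtain d where d: "d > 0" "\<And>b. 0 < b \<Longrightarrow> b < 0 + d \<Longrightarrow> threshold_slope b * pcD (0\<^sup>2 / 4) (- 0) > 0"
    by (rule threshold_slope_crossing[OF order_refl threshold_slope_0]) (rule that)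
  show ?thesis
  proof (rule that[OF d(1)])
    fix b :: real assume "0 < b" "b < d"
    then have "threshold_slope b * pcD 0 0 > 0" using d(2)[of b] by simp
    then show "threshold_slope b > 0" using pcD_0_pos[of 0] by (rule zero_less_mult_pos2)
  qed
qed

lemma beta_star_is_least: "is_least_positive (\<lambda>b. threshold_slope b = 0) beta_star"
proof -
  obtain d where d: "d > 0" "\<And>b. 0 < b \<Longrightarrow> b < d \<Longrightarrow> threshold_slope b > 0"
    using threshold_slope_pos_near_0 by blast
  define b1 where "b1 = min (d / 2) 1"
  have b1: "0 < b1" "b1 \<le> 2" "threshold_slope b1 > 0" using d by (auto simp: b1_def)
  obtain x0 where x0: "b1 \<le> x0" "x0 \<le> 2" "threshold_slope x0 = 0"
    using IVT2'[of threshold_slope 2 0 b1] threshold_slope_2 b1 continuous_threshold_slope by auto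
  obtain x where "0 < x" "x \<le> x0" "threshold_slope x = 0" "\<And>y. 0 < y \<Longrightarrow> y < x \<Longrightarrow> threshold_slope y \<noteq> 0"
  proof (rule least_positive_zero_exists[of 2 threshold_slope d x0])
    show "threshold_slope y \<noteq> 0" if "0 < y" "y < d" for y using d(2)[OF that] by simp
  qed (use x0 b1 d(1) continuous_threshold_slope in auto)
  then have "is_least_positive (\<lambda>b. threshold_slope b = 0) x"
    unfolding is_least_positive_def by (meson not_le)
  then show ?thesis
    using least_positive_eqI unfolding beta_star_def threshold_slope_def by metis
qed

section \<open>The phase and the root \<open>r0\<close>\<close>

text \<open>\<open>D + i D'\<close> is continuous and nowhere zero on the contractible
  \<open>(\<nu>, z)\<close>-plane, so it has a continuous logarithm; its imaginary part is the
  phase. A single phase on the whole plane is what allows the curve and the segment of fixed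
  argument to be compared.\<close>

lemma pcD_phase:
  obtains th rho :: "real \<times> real \<Rightarrow> real" where
    "continuous_on UNIV th" "\<And>x. rho x > 0" "th (0, 0) = 0"
    "\<And>p z. pcD p z = rho (p, z) * cos (th (p, z))" "\<And>p z. pcD' p z = rho (p, z) * sin (th (p, z))"
proof -
  define f where "f x = complex_of_real (pcD (fst x) (snd x)) + \<i> * complex_of_real (pcD' (fst x) (snd x))" for x :: "real \<times> real"
  have Re_f: "Re (f x) = pcD (fst x) (snd x)" and Im_f: "Im (f x) = pcD' (fst x) (snd x)" for x
    by (simp_all add: f_def)
  have "continuous_on UNIV f" unfolding f_def by (intro continuous_intros)
  moreover have "contractible (UNIV :: (real \<times> real) set)" by (rule convex_imp_contractible) simp
  moreover have "f x \<noteq> 0" for x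
    using pcD_or_pcD'_nonzero[of "fst x" "snd x"] Re_f[of x] Im_f[of x] by auto
  ultimately obtain g where g: "continuous_on UNIV g" "\<And>x. f x = exp (g x)"
    using continuous_logarithm_on_contractible[of UNIV f] by auto
  define t0 where "t0 = Im (g (0, 0))"
  define th where "th x = Im (g x) - t0" for x
  define rho where "rho x = exp (Re (g x))" for x
  have 1: "pcD p z = rho (p, z) * cos (Im (g (p, z)))" for p z
    using Re_f[of "(p, z)"] by (simp add: g(2) Re_exp rho_def)
  have 2: "pcD' p z = rho (p, z) * sin (Im (g (p, z)))" for p z
    using Im_f[of "(p, z)"] by (simp add: g(2) Im_exp rho_def)
  \<comment> \<open>At \<open>(0, 0)\<close> D' vanishes and D is positive, so \<open>t0\<close> is
    a multiple of 2 pi, and subtracting it changes neither sine nor cosine.\<close>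
  have s0: "sin t0 = 0" using 2[of 0 0] by (simp add: pcD'_0 t0_def rho_def)
  have "cos t0 > 0" using 1[of 0 0] pcD_0_pos[of 0] by (simp add: t0_def rho_def zero_less_mult_iff)
  moreover have "\<bar>cos t0\<bar> = 1" by (rule sin_zero_abs_cos_one[OF s0])
  ultimately have c0: "cos t0 = 1" by linarith
  show ?thesis
  proof (rule that[of th rho])
    show "continuous_on UNIV th" unfolding th_def by (intro continuous_intros g(1))
    show "th (0, 0) = 0" by (simp add: th_def t0_def)
    show "rho x > 0" for x by (simp add: rho_def)
    show "pcD p z = rho (p, z) * cos (th (p, z))" for p z by (simp add: 1 th_def cos_diff s0 c0)
    show "pcD' p z = rho (p, z) * sin (th (p, z))" for p z by (simp add: 2 th_def sin_diff s0 c0)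
  qed
qed

text \<open>A level that can only be crossed upwards is never recrossed: at the first return to
  \<open>c\<close> the function would have to lie below \<open>c\<close> immediately before, yet it
  is above \<open>c\<close> there by minimality.\<close>

lemma stays_above_level:
  fixes h :: "real \<Rightarrow> real"
  assumes cont: "continuous_on {a..} h"
    and cross: "\<And>t. t \<ge> a \<Longrightarrow> h t = c \<Longrightarrow> \<exists>d>0. (\<forall>x. t < x \<and> x < t + d \<longrightarrow> h x > c) \<and> (\<forall>x. a \<le> x \<and> t - d < x \<and> x < t \<longrightarrow> h x < c)"
    and a: "h a \<ge> c" and t: "t > a"
  shows "h t > c"
proof (rule ccontr)
  assume n: "\<not> h t > c"
  obtain t1 where t1: "a < t1" "t1 < t" "h t1 > c"
  proof (cases "h a = c")
    case True
    then obtain d where "d > 0" "\<forall>x. a < x \<and> x < a + d \<longrightarrow> h x > c" using cross[of a] by auto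
    then show ?thesis using t that[of "min (a + d / 2) ((a + t) / 2)"] by (auto simp: min_def)
  next
    case False
    then have "h a > c" using a by simp
    moreover have "(h \<longlongrightarrow> h a) (at_right a)"
      using cont by (auto simp: continuous_on_def at_within_Ici_at_right[symmetric])
    ultimately have "\<forall>\<^sub>F x in at_right a. h x > c" by (rule order_tendstoD(1)[rotated])
    then obtain b where b: "b > a" "\<And>y. a < y \<Longrightarrow> y < b \<Longrightarrow> h y > c" by (auto simp: eventually_at_right_field)
    then show ?thesis using t that[of "min ((a + b) / 2) ((a + t) / 2)"] by (auto simp: min_def)
  qed
  define S where "S = {x \<in> {t1..t}. h x \<in> {..c}}"
  have cont1: "continuous_on {t1..t} h" using t1 by (intro continuous_on_subset[OF cont]) auto
  have "closed S" unfolding S_def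
    using continuous_closed_preimage[OF cont1 _ closed_atMost[of c]] by (simp add: vimage_def Int_def)
  moreover have "bounded S" by (rule bounded_subset[of "{t1..t}"]) (auto simp: S_def)
  ultimately have cS: "compact S" by (simp add: compact_eq_bounded_closed)
  have "S \<noteq> {}" using t1 n by (auto simp: S_def)
  from compact_attains_inf[OF cS this] obtain x where x: "x \<in> S" "\<And>y. y \<in> S \<Longrightarrow> x \<le> y" by auto
  have xt: "t1 < x" "x \<le> t" "h x \<le> c" using x(1) t1(3) by (auto simp: S_def less_le)
  have above: "h y > c" if "t1 \<le> y" "y < x" for y
    using x(2)[of y] that xt by (force simp: S_def)
  have "h x = c"
  proof (rule ccontr)
    assume "h x \<noteq> c"
    then have "h x \<le> (h x + c) / 2" "(h x + c) / 2 \<le> h t1" using xt t1 by auto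
    from IVT2'[OF this less_imp_le[OF xt(1)] continuous_on_subset[OF cont1]]
    obtain y where y: "t1 \<le> y" "y \<le> x" "h y = (h x + c) / 2" using xt by auto
    then have "y \<noteq> x" using \<open>h x \<noteq> c\<close> by auto
    then show False using above[of y] y xt by simp
  qed
  then obtain d where d: "d > 0" "\<forall>y. a \<le> y \<and> x - d < y \<and> y < x \<longrightarrow> h y < c" using cross[of x] xt t1 by auto
  define y where "y = max t1 (x - d / 2)"
  have y: "t1 \<le> y" "y < x" "x - d < y" using xt d(1) by (auto simp: y_def)
  then have "h y < c" using d(2) t1(1) by auto
  then show False using above[OF y(1,2)] by simp
qed

lemma r0_equation_root_exists:
  assumes "b > beta_star"
  obtains p where "0 < p" "p < b\<^sup>2 / 4" "pcD' p (- b) = sqrt (b\<^sup>2 / 4 - p) * pcD p (- b)"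
proof -
  note bs = beta_star_is_least[unfolded is_least_positive_def]
  have b0: "b > 0" using bs assms by linarith
  obtain th rho where th: "continuous_on UNIV th" "\<And>x. rho x > 0" "th (0, 0) = 0"
    "\<And>p z. pcD p z = rho (p, z) * cos (th (p, z))" "\<And>p z. pcD' p z = rho (p, z) * sin (th (p, z))"
    using pcD_phase by blast
  define T where "T x = th (x\<^sup>2 / 4, - x)" for x
  have contT: "continuous_on S T" for S
    unfolding T_def by (rule continuous_on_compose2[OF th(1)]) (auto intro!: continuous_intros)
  have N: "threshold_slope x = rho (x\<^sup>2 / 4, - x) * sin (T x)" for x
    unfolding threshold_slope_def T_def by (rule th(5))
  have cross: "\<exists>d>0. (\<forall>x. t < x \<and> x < t + d \<longrightarrow> T x > c) \<and> (\<forall>x. a \<le> x \<and> t - d < x \<and> x < t \<longrightarrow> T x < c)"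
    if t: "t \<ge> a" and a: "a \<ge> 0" and Tt: "T t = c" and c: "sin c = 0" for t a c
  proof -
    have "threshold_slope t = 0" "t \<ge> 0" using t a by (simp_all add: N Tt c)
    from threshold_slope_crossing[OF this(2) this(1)]
    obtain d1 where d1: "d1 > 0"
      "\<And>x. t < x \<Longrightarrow> x < t + d1 \<Longrightarrow> threshold_slope x * pcD (t\<^sup>2 / 4) (- t) > 0"
      "\<And>x. 0 \<le> x \<Longrightarrow> t - d1 < x \<Longrightarrow> x < t \<Longrightarrow> threshold_slope x * pcD (t\<^sup>2 / 4) (- t) < 0" by blast
    have "(T \<longlongrightarrow> T t) (at t)" using contT[of UNIV] by (auto simp: continuous_on_def)
    from tendstoD[OF this pi_gt_zero] obtain d2 where d2: "d2 > 0" "\<And>x. x \<noteq> t \<Longrightarrow> dist x t < d2 \<Longrightarrow> \<bar>T x - c\<bar> < pi"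
      unfolding eventually_at by (auto simp: Tt dist_real_def)
    \<comment> \<open>Because \<open>sin c = 0\<close>, the product in the crossing lemma is a
      positive multiple of \<open>sin (T x - c)\<close>; as long as \<open>T x\<close> is within pi
      of \<open>c\<close>, the sign of the sine is the sign of \<open>T x - c\<close>.\<close>
    have eq: "threshold_slope x * pcD (t\<^sup>2 / 4) (- t) = (rho (x\<^sup>2 / 4, - x) * rho (t\<^sup>2 / 4, - t)) * sin (T x - c)" for x
      using Tt by (simp add: N th(4) sin_diff c flip: T_def)
    have rr: "rho (x\<^sup>2 / 4, - x) * rho (t\<^sup>2 / 4, - t) > 0" for x by (intro mult_pos_pos th(2))
    show ?thesis
    proof (intro exI[of _ "min d1 d2"] conjI allI impI)
      show "min d1 d2 > 0" using d1(1) d2(1) by simp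
      fix x assume x: "t < x \<and> x < t + min d1 d2"
      then have "threshold_slope x * pcD (t\<^sup>2 / 4) (- t) > 0" by (intro d1(2)) auto
      then have s: "sin (T x - c) > 0" unfolding eq using rr[of x] by (rule zero_less_mult_pos)
      have "\<bar>T x - c\<bar> < pi" using x by (intro d2(2)) (auto simp: dist_real_def)
      then show "T x > c" using s sin_ge_zero[of "c - T x"] sin_minus[of "T x - c"] by fastforce
    next
      fix x assume x: "a \<le> x \<and> t - min d1 d2 < x \<and> x < t"
      then have "threshold_slope x * pcD (t\<^sup>2 / 4) (- t) < 0" using a by (intro d1(3)) auto
      then have s: "sin (T x - c) < 0" unfolding eq using rr[of x] by (rule mult_neg_imp_neg[rotated])
      have "\<bar>T x - c\<bar> < pi" using x by (intro d2(2)) (auto simp: dist_real_def)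
      then show "T x < c" using s sin_ge_zero[of "T x - c"] by fastforce
    qed
  qed
  have T0: "T 0 = 0" by (simp add: T_def th(3))
  have bs0: "beta_star > 0" "threshold_slope beta_star = 0" using bs by auto
  have "T beta_star > 0"
    by (rule stays_above_level[OF contT cross _ bs0(1)]) (use T0 in auto)
  moreover have "sin (T beta_star) = 0" using bs0(2) th(2)[of "(beta_star\<^sup>2 / 4, - beta_star)"] by (simp add: N)
  \<comment> \<open>A positive phase with vanishing sine is at least pi.\<close>
  ultimately have "T beta_star \<ge> pi" using sin_gt_zero[of "T beta_star"] by force
  then have Tb: "T b > pi"
    by (intro stays_above_level[OF contT[of "{beta_star..}"] cross _ assms]) (use bs0 in auto)
  \<comment> \<open>The matching equation says that \<open>H p\<close> is a multiple of pi. Level 0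
    belongs to the trivial root \<open>p = 0\<close>, so the level sought is pi.\<close>
  define H where "H p = th (p, - b) - arctan (sqrt (b\<^sup>2 / 4 - p))" for p
  have contH: "continuous_on S H" for S
    unfolding H_def
    by (intro continuous_intros continuous_on_compose2[OF th(1)]) auto
  have H1: "H (b\<^sup>2 / 4) > pi" using Tb by (simp add: H_def T_def)
  \<comment> \<open>On the line of index 0 the cosine of the phase never vanishes, so the phase,
    starting from 0 at \<open>z = 0\<close>, cannot reach \<open>pi / 2\<close>.\<close>
  have thz: "th (0, z) < pi / 2" for z
  proof (rule ccontr)
    assume n: "\<not> th (0, z) < pi / 2"
    have cz: "continuous_on S (\<lambda>z. th (0, z))" for S
      by (rule continuous_on_compose2[OF th(1)]) (auto intro!: continuous_intros)
    have "\<exists>y. th (0, y) = pi / 2"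
    proof (cases "z \<ge> 0")
      case True
      show ?thesis using IVT'[of "\<lambda>z. th (0, z)" 0 "pi / 2" z, OF _ _ True cz] n th(3) by auto
    next
      case False
      then have "z \<le> 0" by simp
      then show ?thesis using IVT2'[of "\<lambda>z. th (0, z)" 0 "pi / 2" z, OF _ _ _ cz] n th(3) by auto
    qed
    then obtain y where y: "th (0, y) = pi / 2" by blast
    show False using th(4)[of 0 y] pcD_0_pos[of y] unfolding y cos_pi_half by simp
  qed
  have "0 \<le> arctan (sqrt (b\<^sup>2 / 4))" by simp
  then have "th (0, - b) - arctan (sqrt (b\<^sup>2 / 4)) < pi" using thz[of "- b"] pi_gt_zero by linarith
  then have H0: "H 0 < pi" by (simp only: H_def diff_zero)
  obtain p where p: "0 \<le> p" "p \<le> b\<^sup>2 / 4" "H p = pi"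
    using IVT'[of H 0 pi "b\<^sup>2 / 4"] H0 H1 contH by auto
  define s where "s = sqrt (b\<^sup>2 / 4 - p)"
  have th_p: "th (p, - b) = pi + arctan s" using p(3) by (simp add: H_def s_def)
  have "pcD' p (- b) = s * pcD p (- b)"
    unfolding th(4,5) th_p by (simp add: cos_add sin_add cos_arctan sin_arctan)
  moreover have "p \<noteq> 0" "p \<noteq> b\<^sup>2 / 4" using H0 H1 p(3) by (metis less_irrefl)+
  ultimately show ?thesis using that[of p] p by (simp add: s_def)
qed

lemma r0_props:
  assumes "b > beta_star"
  shows "is_least_positive (r0_equation b) (r0 b)" "0 < r0 b" "r0 b < b\<^sup>2 / 4" "b > 0"
    "pcD' (r0 b) (- b) = sqrt (b\<^sup>2 / 4 - r0 b) * pcD (r0 b) (- b)"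
proof -
  show b0: "b > 0" using beta_star_is_least assms unfolding is_least_positive_def by linarith
  define g where "g p = pcD' p (- b) - sqrt (b\<^sup>2 / 4 - p) * pcD p (- b)" for p
  obtain p0 where p0: "0 < p0" "p0 < b\<^sup>2 / 4" "g p0 = 0"
    using r0_equation_root_exists[OF assms] unfolding g_def by auto
  obtain e where e: "e > 0" "\<And>q. 0 < q \<Longrightarrow> q < e \<Longrightarrow> pcD q (- b) > 0 \<and> pcD' q (- b) > b / 2 * pcD q (- b)"
    using pcD_small_index by blast
  have gpos: "g q > 0" if q: "0 < q" "q < e" for q
  proof -
    have "sqrt (b\<^sup>2 / 4 - q) \<le> sqrt ((b / 2)\<^sup>2)" using q by (intro real_sqrt_le_mono) (simp add: power_divide)
    then have "sqrt (b\<^sup>2 / 4 - q) \<le> b / 2" using b0 by simp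
    then have "sqrt (b\<^sup>2 / 4 - q) * pcD q (- b) \<le> b / 2 * pcD q (- b)" using e(2)[OF q] by (intro mult_right_mono) auto
    then show ?thesis using e(2)[OF q] unfolding g_def by linarith
  qed
  have contg: "continuous_on {0..p0} g" unfolding g_def by (intro continuous_intros)
  obtain x where x: "0 < x" "x \<le> p0" "g x = 0" "\<And>y. 0 < y \<Longrightarrow> y < x \<Longrightarrow> g y \<noteq> 0"
  proof (rule least_positive_zero_exists[OF contg e(1) _ p0(1) order_refl p0(3)])
    show "g q \<noteq> 0" if "0 < q" "q < e" for q using gpos[OF that] by simp
  qed auto
  have "is_least_positive (r0_equation b) x"
    unfolding is_least_positive_def r0_equation_def
  proof (intro conjI allI impI)
    show "x \<le> b\<^sup>2 / 4" "0 < x" using x p0 by auto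
    show "pcD' x (- b) = sqrt (b\<^sup>2 / 4 - x) * pcD x (- b)" using x(3) by (simp add: g_def)
    fix y assume y: "0 < y \<and> y \<le> b\<^sup>2 / 4 \<and> pcD' y (- b) = sqrt (b\<^sup>2 / 4 - y) * pcD y (- b)"
    then have "g y = 0" by (simp add: g_def)
    then show "x \<le> y" using x(4)[of y] y by (meson not_le)
  qed
  moreover from this have "r0 b = x" unfolding r0_def by (rule least_positive_eqI)
  ultimately show "is_least_positive (r0_equation b) (r0 b)" "0 < r0 b" "r0 b < b\<^sup>2 / 4"
    "pcD' (r0 b) (- b) = sqrt (b\<^sup>2 / 4 - r0 b) * pcD (r0 b) (- b)"
    using x p0 by (auto simp: g_def)
qed

section \<open>The decaying solution to the right of the origin\<close>

text \<open>The substitution \<open>z = (b + h x) / sqrt h\<close> turns the eigenvalue equation on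
  \<open>x > 0\<close> into Weber's equation of index \<open>l / h\<close>.\<close>

definition right_sol :: "real \<Rightarrow> real \<Rightarrow> real \<Rightarrow> real \<Rightarrow> real" where
  "right_sol b h l x = pcD (l / h) ((b + h * x) / sqrt h)"

definition right_sol' :: "real \<Rightarrow> real \<Rightarrow> real \<Rightarrow> real \<Rightarrow> real" where
  "right_sol' b h l x = sqrt h * pcD' (l / h) ((b + h * x) / sqrt h)"

definition right_coeff :: "real \<Rightarrow> real \<Rightarrow> real \<Rightarrow> real \<Rightarrow> real" where
  "right_coeff b h l x = (b + h * x)\<^sup>2 / 4 - h / 2 - l"

definition right_slope :: "real \<Rightarrow> real \<Rightarrow> real \<Rightarrow> real" where
  "right_slope b h l = - right_sol' b h l 0 / right_sol b h l 0"

lemma right_arg_deriv: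
  assumes "h > 0" shows "((\<lambda>x. (b + h * x) / sqrt h) has_real_derivative sqrt h) (at x)"
proof -
  have "((\<lambda>x. b + h * x) has_real_derivative h) (at x)"
    by (auto intro!: derivative_eq_intros)
  from DERIV_cdivide[OF this, of "sqrt h"]
  have "((\<lambda>x. (b + h * x) / sqrt h) has_real_derivative h / sqrt h) (at x)" .
  then show ?thesis using assms by (simp add: real_div_sqrt)
qed

lemma right_sol_deriv: "h > 0 \<Longrightarrow> (right_sol b h l has_real_derivative right_sol' b h l x) (at x)"
  unfolding right_sol_def[abs_def] right_sol'_def
  by (subst mult.commute) (rule DERIV_chain2[OF pcD_deriv right_arg_deriv])

lemma right_sol'_deriv:
  assumes "h > 0"
  shows "(right_sol' b h l has_real_derivative right_coeff b h l x * right_sol b h l x) (at x)"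
proof -
  define z where "z = (b + h * x) / sqrt h"
  have "((\<lambda>x. sqrt h * pcD' (l / h) ((b + h * x) / sqrt h)) has_real_derivative
    sqrt h * ((z\<^sup>2 / 4 - l / h - 1 / 2) * pcD (l / h) z * sqrt h)) (at x)"
    unfolding z_def by (intro DERIV_cmult DERIV_chain2[OF pcD'_deriv right_arg_deriv] assms)
  moreover have "sqrt h * ((z\<^sup>2 / 4 - l / h - 1 / 2) * pcD (l / h) z * sqrt h) = (sqrt h)\<^sup>2 * (z\<^sup>2 / 4 - l / h - 1 / 2) * pcD (l / h) z"
    by (simp only: power2_eq_square mult_ac)
  moreover have "(sqrt h)\<^sup>2 * (z\<^sup>2 / 4 - l / h - 1 / 2) = right_coeff b h l x"
    using assms by (simp add: z_def right_coeff_def power_divide field_simps)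
  ultimately show ?thesis unfolding right_sol'_def[abs_def] right_sol_def by (simp only: z_def)
qed

lemma right_arg_at_top: "h > 0 \<Longrightarrow> filterlim (\<lambda>x. (b + h * x) / sqrt h) at_top at_top"
  by real_asymp

text \<open>The product with \<open>x\<close> is included because the barriers grow
  linearly.\<close>

lemma right_sol_at_top:
  assumes h: "h > 0"
  shows "(right_sol b h l \<longlongrightarrow> 0) at_top" "(right_sol' b h l \<longlongrightarrow> 0) at_top" "((\<lambda>x. x * right_sol b h l x) \<longlongrightarrow> 0) at_top"
proof -
  note comp = filterlim_compose[OF _ right_arg_at_top[OF h, of b]]
  show 1: "(right_sol b h l \<longlongrightarrow> 0) at_top"
    using comp[OF pcD_at_top(1)] by (simp add: right_sol_def[abs_def])
  show "(right_sol' b h l \<longlongrightarrow> 0) at_top"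
    using tendsto_mult_right_zero[OF comp[OF pcD_at_top(3)], of "sqrt h"] by (simp add: right_sol'_def[abs_def])
  have "((\<lambda>x. (sqrt h * (((b + h * x) / sqrt h) * right_sol b h l x) - b * right_sol b h l x) / h) \<longlongrightarrow> (sqrt h * 0 - b * 0) / h) at_top"
    using comp[OF pcD_at_top(2)] 1 h by (intro tendsto_intros) (simp_all add: right_sol_def[abs_def])
  moreover have "(sqrt h * (((b + h * x) / sqrt h) * right_sol b h l x) - b * right_sol b h l x) / h = x * right_sol b h l x" for x
    using h by (simp add: field_simps)
  ultimately show "((\<lambda>x. x * right_sol b h l x) \<longlongrightarrow> 0) at_top" by simp
qed

text \<open>The margin \<open>t\<close> below \<open>b^2 / 4\<close> also absorbs the term
  \<open>h / 2\<close>: there is no turning point on the right half-line.\<close>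

lemma right_coeff_nonneg:
  assumes "b > 0" "h > 0" "h \<le> t" "l \<le> b\<^sup>2 / 4 - t" "x \<ge> 0"
  shows "right_coeff b h l x \<ge> 0"
proof -
  have "b\<^sup>2 \<le> (b + h * x)\<^sup>2" using assms by (intro power_mono) auto
  then show ?thesis using assms unfolding right_coeff_def by linarith
qed

text \<open>At a zero the derivative would vanish too, since the solution decays and the coefficient
  is nonnegative. In particular \<open>right_slope\<close> is a genuine quotient.\<close>

lemma right_sol_nonzero:
  assumes "b > 0" "h > 0" "h \<le> t" "l \<le> b\<^sup>2 / 4 - t" "x \<ge> 0"
  shows "right_sol b h l x \<noteq> 0"
proof
  assume z: "right_sol b h l x = 0"
  have "right_sol' b h l x = 0"
    by (rule ode2_decaying_zero[where a=x and h="right_sol b h l" and Q="right_coeff b h l"])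
      (use assms z right_sol_deriv right_sol'_deriv right_sol_at_top right_coeff_nonneg[OF assms(1-4)] in auto)
  then show False
    using z pcD_or_pcD'_nonzero[of "l / h" "(b + h * x) / sqrt h"] assms(2) by (simp add: right_sol_def right_sol'_def)
qed

lemma right_sol_ratio_pos:
  assumes "b > 0" "h > 0" "h \<le> t" "l \<le> b\<^sup>2 / 4 - t" "x \<ge> 0"
  shows "right_sol b h l x / right_sol b h l 0 > 0"
proof (rule ccontr)
  let ?R = "\<lambda>x. right_sol b h l x / right_sol b h l 0"
  assume n: "\<not> ?R x > 0"
  have c: "continuous_on {0..x} ?R"
    using right_sol_deriv[OF assms(2)] right_sol_nonzero[OF assms(1-4)]
    by (intro continuous_on_divide continuous_on_const DERIV_continuous_on[OF has_field_derivative_at_within]) auto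
  obtain y where "0 \<le> y" "y \<le> x" "?R y = 0"
    using IVT2'[of ?R x 0 0, OF _ _ assms(5) c] n right_sol_nonzero[OF assms(1-4), of 0] by auto
  then show False using right_sol_nonzero[OF assms(1-4)] by simp
qed

text \<open>Dividing by the value at 0 makes the solution positive whatever its sign, and turns its
  derivative at 0 into minus the slope. The linear growth bound ensures that \<open>u R\<close>
  still tends to 0.\<close>

lemma right_slope_barriers:
  assumes par: "b > 0" "h > 0" "h \<le> t" "l \<le> b\<^sup>2 / 4 - t"
    and u: "\<And>x. x \<ge> 0 \<Longrightarrow> (u has_real_derivative u' x) (at x)" "\<And>x. x \<ge> 0 \<Longrightarrow> \<bar>u x\<bar> \<le> A + B * x"
  shows "(\<And>x. x \<ge> 0 \<Longrightarrow> right_coeff b h l x \<le> (u x)\<^sup>2 - u' x) \<Longrightarrow> (\<And>x. x \<ge> 0 \<Longrightarrow> u x \<ge> 0) \<Longrightarrow> right_slope b h l \<le> u 0"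
    and "(\<And>x. x \<ge> 0 \<Longrightarrow> (u x)\<^sup>2 - u' x \<le> right_coeff b h l x) \<Longrightarrow> u 0 \<le> right_slope b h l"
proof -
  define c where "c = right_sol b h l 0"
  have c: "c \<noteq> 0" using right_sol_nonzero[OF par, of 0] by (simp add: c_def)
  define R where "R x = right_sol b h l x / c" for x
  define R' where "R' x = right_sol' b h l x / c" for x
  have dR: "(R has_real_derivative R' x) (at x)" for x
    unfolding R_def R'_def by (intro DERIV_cdivide right_sol_deriv par)
  have dR': "(R' has_real_derivative right_coeff b h l x * R x) (at x)" for x
    unfolding R_def R'_def[abs_def] times_divide_eq_right
    by (rule DERIV_cdivide[OF right_sol'_deriv[OF par(2)]])
  have pos: "R x > 0" if "x \<ge> 0" for x using right_sol_ratio_pos[OF par that] by (simp add: R_def c_def)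
  have R0: "R 0 = 1" using c by (simp add: R_def c_def)
  have slope: "R' 0 = - right_slope b h l" by (simp add: R'_def right_slope_def c_def)
  have lR: "(R \<longlongrightarrow> 0) at_top"
    using tendsto_divide_zero[OF right_sol_at_top(1)[OF par(2)]] by (simp add: R_def[abs_def])
  have lR': "(R' \<longlongrightarrow> 0) at_top"
    using tendsto_divide_zero[OF right_sol_at_top(2)[OF par(2)]] by (simp add: R'_def[abs_def])
  have lxR: "((\<lambda>x. x * R x) \<longlongrightarrow> 0) at_top"
    using tendsto_divide_zero[OF right_sol_at_top(3)[OF par(2)]] by (simp add: R_def[abs_def])
  have "((\<lambda>x. u x * R x) \<longlongrightarrow> 0) at_top"
  proof (rule Lim_null_comparison)
    have "((\<lambda>x. A * R x + B * (x * R x)) \<longlongrightarrow> A * 0 + B * 0) at_top" by (intro tendsto_intros lR lxR)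
    then show "((\<lambda>x. A * R x + B * (x * R x)) \<longlongrightarrow> 0) at_top" by simp
    show "\<forall>\<^sub>F x in at_top. norm (u x * R x) \<le> A * R x + B * (x * R x)"
      using eventually_ge_at_top[of 0]
    proof eventually_elim
      case (elim x)
      have "norm (u x * R x) = \<bar>u x\<bar> * R x" using pos[OF elim] by (simp add: abs_mult)
      also have "\<dots> \<le> (A + B * x) * R x" using pos[OF elim] u(2)[OF elim] by (intro mult_right_mono) auto
      finally show ?case by (simp add: algebra_simps)
    qed
  qed
  from tendsto_add[OF lR' this] have lim: "((\<lambda>x. R' x + u x * R x) \<longlongrightarrow> 0) at_top" by simp
  show "right_slope b h l \<le> u 0"
    if "\<And>x. x \<ge> 0 \<Longrightarrow> right_coeff b h l x \<le> (u x)\<^sup>2 - u' x" "\<And>x. x \<ge> 0 \<Longrightarrow> u x \<ge> 0"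
    using riccati_upper_barrier[where R=R and R'=R' and u=u and u'=u' and a=0 and Q="right_coeff b h l", OF dR dR' u(1) that(1) pos that(2) lim]
    by (simp add: R0 slope)
  show "u 0 \<le> right_slope b h l"
    if "\<And>x. x \<ge> 0 \<Longrightarrow> (u x)\<^sup>2 - u' x \<le> right_coeff b h l x"
    using riccati_lower_barrier[where R=R and R'=R' and u=u and u'=u' and a=0 and Q="right_coeff b h l", OF dR dR' u(1) that(1) _ lR lim]
    by (simp add: R0 slope)
qed

text \<open>The barrier \<open>(b + h x) / 2\<close> solves the Riccati equation exactly for
  \<open>l = 0\<close>, and a larger \<open>l\<close> only lowers the coefficient. With
  \<open>pcD_small_index\<close> this excludes small positive eigenvalues.\<close>

lemma right_slope_le_half:
  assumes par: "b > 0" "h > 0" "h \<le> t" "l \<le> b\<^sup>2 / 4 - t" and l: "l \<ge> 0"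
  shows "right_slope b h l \<le> b / 2"
proof -
  define u where "u x = (b + h * x) / 2" for x
  have "right_slope b h l \<le> u 0"
  proof (rule right_slope_barriers(1)[OF par])
    fix x :: real assume x: "x \<ge> 0"
    show "(u has_real_derivative h / 2) (at x)" unfolding u_def by (auto intro!: derivative_eq_intros)
    show "u x \<ge> 0" using par x by (simp add: u_def)
    then show "\<bar>u x\<bar> \<le> b / 2 + h / 2 * x" by (simp add: u_def add_divide_distrib)
    show "right_coeff b h l x \<le> (u x)\<^sup>2 - h / 2" using l by (simp add: u_def right_coeff_def power_divide)
  qed
  then show ?thesis by (simp add: u_def)
qed

text \<open>The barriers are the first two WKB terms \<open>\<surd>Q + Q' / (4 Q)\<close>, corrected by a constant of
  size \<open>h\<^sup>2\<close> that makes the residual of the Riccati equation one-signed.\<close>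

lemma right_slope_expansion:
  assumes b: "b > 0" and s1: "s1 > 0"
  obtains K h0 where "K > 0" "h0 > 0" "h0 \<le> s1\<^sup>2"
    "\<And>h l. 0 < h \<Longrightarrow> h < h0 \<Longrightarrow> 0 \<le> l \<Longrightarrow> l \<le> b\<^sup>2 / 4 - s1\<^sup>2 \<Longrightarrow>
       \<bar>right_slope b h l - (sqrt (b\<^sup>2 / 4 - l) + h * ((b - 2 * sqrt (b\<^sup>2 / 4 - l)) / (8 * (b\<^sup>2 / 4 - l))))\<bar> \<le> K * h\<^sup>2"
proof -
  \<comment> \<open>\<open>k\<close> bounds \<open>B / G\<close>, \<open>c1\<close> bounds
    \<open>G1\<close> and \<open>c2\<close> bounds \<open>\<bar>G1'\<bar>\<close>, uniformly in
    \<open>l\<close>, \<open>h\<close> and \<open>x\<close>. \<open>K\<close> is the value for which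
    \<open>2 (K h^2) G\<close> outweighs all residual terms; the bound \<open>1 / K\<close> in
    \<open>h0\<close> gives \<open>K h \<le> 1\<close> for the lower barrier.\<close>
  define k where "k = b / s1"
  define c1 where "c1 = k / s1 / 8 + 1 / s1 / 4"
  define c2 where "c2 = (1 / s1)\<^sup>2 / 8 + k\<^sup>2 * (1 / s1)\<^sup>2 / 16 + k * (1 / s1)\<^sup>2 / 16"
  define K where "K = (c2 + (c1 + 1)\<^sup>2) / (2 * s1)"
  have k: "k > 0" using b s1 by (simp add: k_def)
  have c1: "c1 > 0" using k s1 unfolding c1_def by (intro add_pos_pos) auto
  have c2: "c2 > 0" using k s1 unfolding c2_def by (intro add_pos_pos) auto
  have K: "K > 0" using c1 c2 s1 unfolding K_def by (intro divide_pos_pos add_pos_pos) auto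
  define h0 where "h0 = min (s1\<^sup>2) (1 / K)"
  have h0: "h0 > 0" using K s1 by (simp add: h0_def)
  have main: "\<bar>right_slope b h l - (sqrt (b\<^sup>2 / 4 - l) + h * ((b - 2 * sqrt (b\<^sup>2 / 4 - l)) / (8 * (b\<^sup>2 / 4 - l))))\<bar> \<le> K * h\<^sup>2"
    if hl: "0 < h" "h < h0" "0 \<le> l" "l \<le> b\<^sup>2 / 4 - s1\<^sup>2" for h l
  proof -
    have par: "b > 0" "h > 0" "h \<le> s1\<^sup>2" "l \<le> b\<^sup>2 / 4 - s1\<^sup>2" using b hl by (auto simp: h0_def)
    have Kh: "K * h \<le> 1" using hl(2) K by (simp add: h0_def field_simps)
    define B where "B x = b + h * x" for x
    define G where "G x = sqrt ((B x)\<^sup>2 / 4 - l)" for x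
    define G1 where "G1 x = B x / (8 * (G x)\<^sup>2) - 1 / (4 * G x)" for x
    define G1' where "G1' x = 1 / (8 * (G x)\<^sup>2) - (B x)\<^sup>2 / (16 * (G x) ^ 4) + B x / (16 * (G x) ^ 3)" for x
    define u where "u c x = G x + h * G1 x + c" for c x
    define u' where "u' x = h * (B x / (4 * G x)) + h * (h * G1' x)" for x
    have facts: "B x \<ge> b" "(G x)\<^sup>2 = (B x)\<^sup>2 / 4 - l" "G x \<ge> s1" "G x \<le> B x / 2" "B x \<le> k * G x" "(B x)\<^sup>2 / 4 - l > 0"
      if x: "x \<ge> 0" for x
    proof -
      show B: "B x \<ge> b" using x hl by (simp add: B_def)
      then have B2: "b\<^sup>2 \<le> (B x)\<^sup>2" using b by (intro power_mono) auto
      have ge: "(B x)\<^sup>2 / 4 - l \<ge> s1\<^sup>2" using B2 hl(4) by simp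
      then show pos: "(B x)\<^sup>2 / 4 - l > 0" using s1 by (smt (verit) zero_less_power)
      then show G2: "(G x)\<^sup>2 = (B x)\<^sup>2 / 4 - l" by (simp add: G_def)
      show "G x \<ge> s1" unfolding G_def using ge by (rule real_le_rsqrt)
      have "G x \<le> sqrt ((B x / 2)\<^sup>2)" unfolding G_def using hl(3) by (intro real_sqrt_le_mono) (simp add: power_divide)
      then show "G x \<le> B x / 2" using B b by simp
      \<comment> \<open>The ratio \<open>B^2 / (B^2 / 4 - l)\<close> does not increase with B, so
        its value at \<open>B = b\<close>, at most \<open>k^2\<close>, bounds it everywhere.\<close>
      have "b\<^sup>2 * l \<le> (B x)\<^sup>2 * l" using B2 hl(3) by (rule mult_right_mono)
      also have "(B x)\<^sup>2 * l \<le> (B x)\<^sup>2 * (b\<^sup>2 / 4 - s1\<^sup>2)" using hl(4) by (intro mult_left_mono) auto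
      finally have "(B x)\<^sup>2 * s1\<^sup>2 \<le> b\<^sup>2 * (G x)\<^sup>2" unfolding G2 by (simp add: algebra_simps)
      then have "(B x * s1)\<^sup>2 \<le> (b * G x)\<^sup>2" by (simp add: power_mult_distrib)
      then have "B x * s1 \<le> b * G x" by (rule power2_le_imp_le) (use b \<open>G x \<ge> s1\<close> s1 in simp)
      then show "B x \<le> k * G x" using s1 by (simp add: k_def field_simps)
    qed
    have bounds: "0 \<le> G1 x" "G1 x \<le> c1" "\<bar>G1' x\<bar> \<le> c2" if x: "x \<ge> 0" for x
    proof -
      define w where "w = B x / G x"
      define y where "y = 1 / G x"
      have Gp: "G x > 0" using facts(3)[OF x] s1 by simp
      have w: "w \<ge> 2" "w \<le> k" using facts(4,5)[OF x] Gp by (simp_all add: w_def field_simps)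
      have y: "y > 0" "y \<le> 1 / s1" using facts(3)[OF x] Gp s1 by (simp_all add: y_def field_simps)
      have G1: "G1 x = y * (w - 2) / 8" using Gp by (simp add: G1_def w_def y_def field_simps power2_eq_square)
      show "0 \<le> G1 x" unfolding G1 using y w by simp
      have "y * (w - 2) \<le> (1 / s1) * k" using y w s1 by (intro mult_mono) auto
      then show "G1 x \<le> c1" unfolding G1 c1_def using s1 by (simp add: field_simps add_increasing2)
      have G1': "G1' x = y\<^sup>2 / 8 - w\<^sup>2 * y\<^sup>2 / 16 + w * y\<^sup>2 / 16"
        using Gp by (simp add: G1'_def w_def y_def field_simps power2_eq_square power3_eq_cube power4_eq_xxxx)
      have y2: "y\<^sup>2 \<le> (1 / s1)\<^sup>2" using y by (intro power_mono) auto
      have w2: "w\<^sup>2 \<le> k\<^sup>2" using w by (intro power_mono) auto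
      have "w\<^sup>2 * y\<^sup>2 \<le> k\<^sup>2 * (1 / s1)\<^sup>2" "w * y\<^sup>2 \<le> k * (1 / s1)\<^sup>2"
        using y2 w2 w k by (intro mult_mono; simp)+
      moreover have "0 \<le> w\<^sup>2 * y\<^sup>2" "0 \<le> w * y\<^sup>2" "0 \<le> y\<^sup>2" using w by simp_all
      ultimately show "\<bar>G1' x\<bar> \<le> c2" unfolding G1' c2_def using y2 by linarith
    qed
    have dG: "(G has_real_derivative h * (B x / (4 * G x))) (at x)" if x: "x \<ge> 0" for x
    proof -
      have "((\<lambda>x. (B x)\<^sup>2 / 4 - l) has_real_derivative h * B x / 2) (at x)"
        unfolding B_def by (auto intro!: derivative_eq_intros simp: algebra_simps)
      from DERIV_chain2[OF DERIV_real_sqrt[OF facts(6)[OF x]] this]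
      show ?thesis by (simp add: G_def[abs_def] field_simps)
    qed
    have dB: "(B has_real_derivative h) (at x)" for x
      unfolding B_def by (auto intro!: derivative_eq_intros)
    have dG1: "(G1 has_real_derivative h * G1' x) (at x)" if x: "x \<ge> 0" for x
    proof -
      have Gp: "G x > 0" using facts(3)[OF x] s1 by simp
      have "((\<lambda>x. B x / (8 * (G x)\<^sup>2)) has_real_derivative
          (h * (8 * (G x)\<^sup>2) - B x * (8 * (2 * G x * (h * (B x / (4 * G x)))))) / ((8 * (G x)\<^sup>2) * (8 * (G x)\<^sup>2))) (at x)"
        using Gp by (auto intro!: derivative_eq_intros dB dG[OF x])
      moreover have "((\<lambda>x. 1 / (4 * G x)) has_real_derivative
          - (4 * (h * (B x / (4 * G x)))) / ((4 * G x) * (4 * G x))) (at x)"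
        using Gp by (auto intro!: derivative_eq_intros dG[OF x])
      ultimately have "(G1 has_real_derivative
         (h * (8 * (G x)\<^sup>2) - B x * (8 * (2 * G x * (h * (B x / (4 * G x)))))) / ((8 * (G x)\<^sup>2) * (8 * (G x)\<^sup>2))
         - - (4 * (h * (B x / (4 * G x)))) / ((4 * G x) * (4 * G x))) (at x)"
        unfolding G1_def[abs_def] by (rule DERIV_diff)
      moreover have "(h * (8 * (G x)\<^sup>2) - B x * (8 * (2 * G x * (h * (B x / (4 * G x)))))) / ((8 * (G x)\<^sup>2) * (8 * (G x)\<^sup>2))
         - - (4 * (h * (B x / (4 * G x)))) / ((4 * G x) * (4 * G x)) = h * G1' x"
        using Gp by (simp add: G1'_def field_simps power2_eq_square power3_eq_cube power4_eq_xxxx)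
      ultimately show ?thesis by simp
    qed
    have du: "(u c has_real_derivative u' x) (at x)" if x: "x \<ge> 0" for c x
      unfolding u_def[abs_def] u'_def by (auto intro!: derivative_eq_intros dG[OF x] dG1[OF x])
    \<comment> \<open>\<open>G1\<close> is the solution of \<open>2 G (h G1) - G' = - h / 2\<close>,
      where \<open>- h / 2\<close> is the term of \<open>right_coeff\<close> missing from
      \<open>G^2\<close>. All terms of order \<open>h\<close> therefore cancel.\<close>
    have residual: "(u c x)\<^sup>2 - u' x - right_coeff b h l x = 2 * c * G x - h\<^sup>2 * G1' x + (h * G1 x + c)\<^sup>2" if x: "x \<ge> 0" for c x
    proof -
      have Gp: "G x > 0" using facts(3)[OF x] s1 by simp
      have rc: "right_coeff b h l x = (G x)\<^sup>2 - h / 2" by (simp add: facts(2)[OF x] right_coeff_def B_def)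
      have "2 * (G x * G1 x) = B x / (4 * G x) - 1 / 2" using Gp by (simp add: G1_def field_simps power2_eq_square)
      then have e: "h * (2 * (G x * G1 x)) = h * (B x / (4 * G x)) - h / 2"
        by (simp only: right_diff_distrib times_divide_eq_right mult_1_right)
      have "(u c x)\<^sup>2 = (G x)\<^sup>2 + h * (2 * (G x * G1 x)) + 2 * c * G x + (h * G1 x + c)\<^sup>2"
        by (simp add: u_def power2_eq_square algebra_simps)
      then show ?thesis unfolding e rc u'_def by (simp add: power2_eq_square[of h] mult.assoc)
    qed
    have growth: "\<bar>u c x\<bar> \<le> (b / 2 + h * c1 + \<bar>c\<bar>) + h / 2 * x" if x: "x \<ge> 0" for c x
    proof -
      have "\<bar>u c x\<bar> \<le> \<bar>G x\<bar> + \<bar>h * G1 x\<bar> + \<bar>c\<bar>" unfolding u_def by linarith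
      moreover have "\<bar>G x\<bar> \<le> b / 2 + h / 2 * x" using facts(3,4)[OF x] s1 by (simp add: B_def add_divide_distrib)
      moreover have "\<bar>h * G1 x\<bar> \<le> h * c1" using bounds(1,2)[OF x] hl(1) by (simp add: abs_mult)
      ultimately show ?thesis by linarith
    qed
    have u0: "u c 0 = (sqrt (b\<^sup>2 / 4 - l) + h * ((b - 2 * sqrt (b\<^sup>2 / 4 - l)) / (8 * (b\<^sup>2 / 4 - l)))) + c" for c
    proof -
      have G0: "G 0 = sqrt (b\<^sup>2 / 4 - l)" by (simp add: G_def B_def)
      have Gp: "G 0 > 0" using facts(3)[of 0] s1 by simp
      have "G1 0 = (b - 2 * G 0) / (8 * (G 0)\<^sup>2)"
        using Gp by (simp add: G1_def B_def field_simps power2_eq_square)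
      also have "(G 0)\<^sup>2 = b\<^sup>2 / 4 - l" using facts(2)[of 0] by (simp add: B_def)
      finally show ?thesis by (simp add: u_def G0)
    qed
    have K2: "2 * K * s1 = c2 + (c1 + 1)\<^sup>2" using s1 by (simp add: K_def)
    have GK: "2 * K * s1 * h\<^sup>2 \<le> 2 * (K * h\<^sup>2) * G x" if x: "x \<ge> 0" for x
      using mult_left_mono[OF facts(3)[OF x], of "2 * K * h\<^sup>2"] K by (simp add: mult_ac)
    have hG: "h\<^sup>2 * \<bar>G1' x\<bar> \<le> c2 * h\<^sup>2" if x: "x \<ge> 0" for x
      using mult_left_mono[OF bounds(3)[OF x], of "h\<^sup>2"] by (simp add: mult_ac)
    have GK': "(c2 + (c1 + 1)\<^sup>2) * h\<^sup>2 \<le> 2 * (K * h\<^sup>2) * G x" if x: "x \<ge> 0" for x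
      using GK[OF x] unfolding K2 .
    have hG': "- (c2 * h\<^sup>2) \<le> h\<^sup>2 * G1' x" "h\<^sup>2 * G1' x \<le> c2 * h\<^sup>2" if x: "x \<ge> 0" for x
      using hG[OF x] abs_mult[of "h\<^sup>2" "G1' x"] by (simp_all add: abs_le_iff)
    have "right_slope b h l \<le> u (K * h\<^sup>2) 0"
    proof (rule right_slope_barriers(1)[OF par du growth])
      fix x :: real assume x: "x \<ge> 0"
      have "0 \<le> (c1 + 1)\<^sup>2 * h\<^sup>2" "0 \<le> (h * G1 x + K * h\<^sup>2)\<^sup>2" by simp_all
      then show "right_coeff b h l x \<le> (u (K * h\<^sup>2) x)\<^sup>2 - u' x"
        using residual[OF x, of "K * h\<^sup>2"] GK'[OF x] hG'[OF x] by (simp only: distrib_right)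
      show "u (K * h\<^sup>2) x \<ge> 0" using facts(3)[OF x] bounds(1)[OF x] s1 K hl(1) by (simp add: u_def)
    qed
    moreover have "u (- (K * h\<^sup>2)) 0 \<le> right_slope b h l"
    proof (rule right_slope_barriers(2)[OF par du growth])
      fix x :: real assume x: "x \<ge> 0"
      \<comment> \<open>For the lower barrier the square in the residual has the unfavourable sign;
        \<open>K h \<le> 1\<close> bounds it independently of \<open>K\<close>, which keeps the
        choice of \<open>K\<close> from being circular.\<close>
      have "\<bar>G1 x - K * h\<bar> \<le> c1 + 1" using bounds(1,2)[OF x] Kh mult_pos_pos[OF K hl(1)] c1
        by (simp add: abs_le_iff)
      then have "(G1 x - K * h)\<^sup>2 \<le> (c1 + 1)\<^sup>2" using c1 by (simp add: abs_le_square_iff[symmetric])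
      then have "h\<^sup>2 * (G1 x - K * h)\<^sup>2 \<le> (c1 + 1)\<^sup>2 * h\<^sup>2"
        by (subst mult.commute) (rule mult_right_mono, assumption, simp)
      moreover have "(h * G1 x + - (K * h\<^sup>2))\<^sup>2 = h\<^sup>2 * (G1 x - K * h)\<^sup>2" by (simp add: power2_eq_square algebra_simps)
      ultimately have "(h * G1 x + - (K * h\<^sup>2))\<^sup>2 \<le> (c1 + 1)\<^sup>2 * h\<^sup>2" by simp
      then show "(u (- (K * h\<^sup>2)) x)\<^sup>2 - u' x \<le> right_coeff b h l x"
        using residual[OF x, of "- (K * h\<^sup>2)"] GK'[OF x] hG'[OF x] by (simp only: distrib_right mult_minus_left mult_minus_right)
    qed
    ultimately show ?thesis unfolding u0 by linarith
  qed
  show ?thesis by (rule that[OF K h0 _ main]) (auto simp: h0_def)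
qed

section \<open>Eigenvalues as roots of the matching equation\<close>

text \<open>The agreement conditions are guarded by \<open>x = a\<close>, so the same rule covers
  points away from the junction, including functions whose derivatives disagree there.\<close>

lemma has_real_derivative_piecewise:
  fixes f g :: "real \<Rightarrow> real"
  assumes f: "(f has_real_derivative f' x) (at x)" and g: "(g has_real_derivative g' x) (at x)"
    and eq: "x = a \<Longrightarrow> f a = g a" "x = a \<Longrightarrow> f' a = g' a"
  shows "((\<lambda>x. if x < a then f x else g x) has_real_derivative (if x < a then f' x else g' x)) (at x)"
proof -
  consider "x < a" | "x > a" | "x = a" by linarith
  then show ?thesis
  proof cases
    case 1
    then show ?thesis
      using has_field_derivative_transform_within_open[OF f open_lessThan[of a], of "\<lambda>x. if x < a then f x else g x"] by simp
  next
    case 2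
    then show ?thesis
      using has_field_derivative_transform_within_open[OF g open_greaterThan[of a], of "\<lambda>x. if x < a then f x else g x"] by simp
  next
    case 3
    let ?h = "\<lambda>x. if x < a then f x else g x"
    have "((\<lambda>y. (?h y - ?h a) / (y - a)) \<longlongrightarrow> g' a) (at a)"
    proof (rule filterlim_split_at)
      have "((\<lambda>y. (f y - f a) / (y - a)) \<longlongrightarrow> g' a) (at_left a)"
        using f eq 3 by (auto simp: has_field_derivative_iff intro: filterlim_at_split[THEN iffD1, THEN conjunct1])
      moreover have "\<forall>\<^sub>F y in at_left a. (f y - f a) / (y - a) = (?h y - ?h a) / (y - a)"
        unfolding eventually_at_filter using eq 3 by (intro always_eventually) auto
      ultimately show "((\<lambda>y. (?h y - ?h a) / (y - a)) \<longlongrightarrow> g' a) (at_left a)"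
        by (rule Lim_transform_eventually)
      have "((\<lambda>y. (g y - g a) / (y - a)) \<longlongrightarrow> g' a) (at_right a)"
        using g eq 3 by (auto simp: has_field_derivative_iff intro: filterlim_at_split[THEN iffD1, THEN conjunct2])
      moreover have "\<forall>\<^sub>F y in at_right a. (g y - g a) / (y - a) = (?h y - ?h a) / (y - a)"
        unfolding eventually_at_filter by (intro always_eventually) auto
      ultimately show "((\<lambda>y. (?h y - ?h a) / (y - a)) \<longlongrightarrow> g' a) (at_right a)"
        by (rule Lim_transform_eventually)
    qed
    then show ?thesis using 3 by (simp add: has_field_derivative_iff)
  qed
qed

lemma isCont_piecewise:
  fixes f g :: "real \<Rightarrow> real"
  assumes f: "isCont f a" and g: "isCont g a" and eq: "f a = g a"
  shows "isCont (\<lambda>x. if x < a then f x else g x) a"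
proof -
  let ?h = "\<lambda>x. if x < a then f x else g x"
  have "(?h \<longlongrightarrow> g a) (at a)"
  proof (rule filterlim_split_at)
    have "(f \<longlongrightarrow> g a) (at_left a)"
      using f unfolding isCont_def eq by (rule tendsto_within_subset) simp
    moreover have "\<forall>\<^sub>F y in at_left a. f y = ?h y"
      unfolding eventually_at_filter by (intro always_eventually) auto
    ultimately show "(?h \<longlongrightarrow> g a) (at_left a)" by (rule Lim_transform_eventually)
    have "(g \<longlongrightarrow> g a) (at_right a)"
      using g unfolding isCont_def by (rule tendsto_within_subset) simp
    moreover have "\<forall>\<^sub>F y in at_right a. g y = ?h y"
      unfolding eventually_at_filter by (intro always_eventually) auto
    ultimately show "(?h \<longlongrightarrow> g a) (at_right a)" by (rule Lim_transform_eventually)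
  qed
  then show ?thesis by (simp add: isCont_def)
qed

lemma continuous_on_Icc_bounded:
  fixes f :: "real \<Rightarrow> real"
  assumes "continuous_on {a..b} f"
  obtains K where "K > 0" "\<And>x. a \<le> x \<Longrightarrow> x \<le> b \<Longrightarrow> \<bar>f x\<bar> \<le> K"
proof -
  have "bounded (f ` {a..b})" by (intro compact_imp_bounded compact_continuous_image assms) auto
  then obtain K where K: "\<forall>y\<in>f ` {a..b}. norm y \<le> K" unfolding bounded_iff by blast
  show ?thesis
  proof (rule that[of "max K 1"])
    fix x assume "a \<le> x" "x \<le> b"
    then have "norm (f x) \<le> K" using K by (intro bspec[OF K]) auto
    then show "\<bar>f x\<bar> \<le> max K 1" by simp
  qed simp
qed

lemma integrable_pcD_square_affine:
  assumes "c \<noteq> 0"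
  shows "integrable lborel (\<lambda>x. indicator {a..} (t + c * x) * (pcD \<nu> (t + c * x))\<^sup>2)"
  using lborel_integrable_real_affine[OF integrable_pc_inner[of a \<nu> \<nu>] assms, of t]
  by (simp add: power2_eq_square)

lemma right_sol_alt:
  assumes "h > 0" shows "right_sol b h l x = pcD (l / h) (b / sqrt h + sqrt h * x)"
proof -
  have "h * x / sqrt h = h / sqrt h * x" by simp
  then show ?thesis unfolding right_sol_def add_divide_distrib using assms by (simp only: real_div_sqrt less_imp_le)
qed

text \<open>Glue the reflected \<open>D_l\<close> to a multiple of the right solution:
  \<open>c\<close> matches the values at 0, and the matching equation then matches the
  derivatives.\<close>

lemma is_eigenvalueI:
  assumes par: "b > 0" "h > 0" "h \<le> t" "l \<le> b\<^sup>2 / 4 - t"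
    and eq: "pcD' l (- b) = right_slope b h l * pcD l (- b)"
  shows "is_eigenvalue b h l"
proof -
  define c where "c = pcD l (- b) / right_sol b h l 0"
  have R0: "right_sol b h l 0 \<noteq> 0" using right_sol_nonzero[OF par, of 0] by simp
  \<comment> \<open>If D vanished here, the matching equation would force D' to vanish as
    well.\<close>
  have L0: "pcD l (- b) \<noteq> 0" using pcD_or_pcD'_nonzero[of l "- b"] eq by auto
  define \<psi> where "\<psi> x = (if x < 0 then pcD l (- b - x) else c * right_sol b h l x)" for x
  define \<psi>' where "\<psi>' x = (if x < 0 then - pcD' l (- b - x) else c * right_sol' b h l x)" for x
  define \<psi>'' where "\<psi>'' x = (if x < 0 then ((- b - x)\<^sup>2 / 4 - l - 1 / 2) * pcD l (- b - x) else c * (right_coeff b h l x * right_sol b h l x))" for x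
  have neg: "((\<lambda>x. - b - x) has_real_derivative - 1) (at x)" for x
    by (auto intro!: derivative_eq_intros)
  have dl: "((\<lambda>x. pcD l (- b - x)) has_real_derivative - pcD' l (- b - x)) (at x)" for x
    using DERIV_chain2[OF pcD_deriv neg] by simp
  have dl': "((\<lambda>x. - pcD' l (- b - x)) has_real_derivative ((- b - x)\<^sup>2 / 4 - l - 1 / 2) * pcD l (- b - x)) (at x)" for x
    using DERIV_minus[OF DERIV_chain2[OF pcD'_deriv neg]] by simp
  have dr: "((\<lambda>x. c * right_sol b h l x) has_real_derivative c * right_sol' b h l x) (at x)" for x
    by (intro DERIV_cmult right_sol_deriv par)
  have dr': "((\<lambda>x. c * right_sol' b h l x) has_real_derivative c * (right_coeff b h l x * right_sol b h l x)) (at x)" for x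
    by (intro DERIV_cmult right_sol'_deriv par)
  have c0: "pcD l (- b - 0) = c * right_sol b h l 0" using R0 by (simp add: c_def)
  have c1: "- pcD' l (- b - 0) = c * right_sol' b h l 0" using R0 eq by (simp add: c_def right_slope_def)
  have d: "(\<psi> has_real_derivative \<psi>' x) (at x)" for x
    unfolding \<psi>_def[abs_def] \<psi>'_def by (rule has_real_derivative_piecewise[where f="\<lambda>x. pcD l (- b - x)" and f'="\<lambda>x. - pcD' l (- b - x)"
          and g="\<lambda>x. c * right_sol b h l x" and g'="\<lambda>x. c * right_sol' b h l x", OF dl dr c0 c1])
  have d': "(\<psi>' has_real_derivative \<psi>'' x) (at x)" if "x \<noteq> 0" for x
    unfolding \<psi>'_def[abs_def] \<psi>''_def
    by (rule has_real_derivative_piecewise[where f="\<lambda>x. - pcD' l (- b - x)" and f'="\<lambda>x. ((- b - x)\<^sup>2 / 4 - l - 1 / 2) * pcD l (- b - x)"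
          and g="\<lambda>x. c * right_sol' b h l x" and g'="\<lambda>x. c * (right_coeff b h l x * right_sol b h l x)", OF dl' dr']) (use that in auto)
  have cont': "isCont \<psi>' 0"
    unfolding \<psi>'_def[abs_def]
    by (rule isCont_piecewise[where f="\<lambda>x. - pcD' l (- b - x)" and g="\<lambda>x. c * right_sol' b h l x", OF DERIV_isCont[OF dl'] DERIV_isCont[OF dr'] c1])
  have int: "integrable lborel (\<lambda>x. (\<psi> x)\<^sup>2)"
  proof (rule Bochner_Integration.integrable_bound)
    have "sqrt h \<noteq> 0" using par by simp
    show "integrable lborel (\<lambda>x. indicator {- b..} (- b + - 1 * x) * (pcD l (- b + - 1 * x))\<^sup>2 +
        c\<^sup>2 * (indicator {b / sqrt h..} (b / sqrt h + sqrt h * x) * (pcD (l / h) (b / sqrt h + sqrt h * x))\<^sup>2))"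
      by (intro Bochner_Integration.integrable_add integrable_mult_right integrable_pcD_square_affine) (use par in auto)
    have "continuous_on UNIV \<psi>" by (rule DERIV_continuous_on[OF has_field_derivative_at_within[OF d]])
    then show "(\<lambda>x. (\<psi> x)\<^sup>2) \<in> borel_measurable lborel"
      by (simp add: borel_measurable_continuous_onI continuous_on_power)
    show "AE x in lborel. norm ((\<psi> x)\<^sup>2) \<le> norm (indicator {- b..} (- b + - 1 * x) * (pcD l (- b + - 1 * x))\<^sup>2 +
        c\<^sup>2 * (indicator {b / sqrt h..} (b / sqrt h + sqrt h * x) * (pcD (l / h) (b / sqrt h + sqrt h * x))\<^sup>2))"
    proof (rule AE_I2)
      fix x :: real
      show "norm ((\<psi> x)\<^sup>2) \<le> norm (indicator {- b..} (- b + - 1 * x) * (pcD l (- b + - 1 * x))\<^sup>2 +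
        c\<^sup>2 * (indicator {b / sqrt h..} (b / sqrt h + sqrt h * x) * (pcD (l / h) (b / sqrt h + sqrt h * x))\<^sup>2))"
      proof (cases "x < 0")
        case True
        then have "\<psi> x = pcD l (- b + - 1 * x)" by (simp add: \<psi>_def)
        then show ?thesis using True by (simp add: indicator_def)
      next
        case False
        then have "\<psi> x = c * pcD (l / h) (b / sqrt h + sqrt h * x)"
          using right_sol_alt[OF par(2)] by (simp add: \<psi>_def)
        moreover have "sqrt h * x \<ge> 0" using par False by simp
        ultimately show ?thesis using False by (simp add: indicator_def power_mult_distrib)
      qed
    qed
  qed
  have "- \<psi>'' x + potential b h x * \<psi> x = (l + 1 / 2) * \<psi> x" for x
    by (simp add: \<psi>''_def \<psi>_def potential_def right_coeff_def field_simps power2_eq_square)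
  moreover have "\<psi> 0 \<noteq> 0" using c0 L0 by (simp add: \<psi>_def)
  ultimately show ?thesis
    unfolding is_eigenvalue_def using d d' cont' int DERIV_isCont[OF d]
    by (intro exI[of _ \<psi>] exI[of _ \<psi>'] exI[of _ \<psi>'']) auto
qed

text \<open>On each half-line the Wronskian of the eigenfunction with the decaying solution is zero,
  the left half after the reflection \<open>z = - b - x\<close>. Both relations give the logarithmic
  derivative at 0, and \<open>\<psi> 0\<close> can be cancelled.\<close>

lemma is_eigenvalueD:
  assumes par: "b > 0" "h > 0" "h \<le> t" "l \<le> b\<^sup>2 / 4 - t" and ev: "is_eigenvalue b h l"
  shows "pcD' l (- b) = right_slope b h l * pcD l (- b)"
proof -
  obtain \<psi> \<psi>' \<psi>'' :: "real \<Rightarrow> real" where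
    d: "\<And>x. (\<psi> has_real_derivative \<psi>' x) (at x)" and c0: "isCont \<psi>' 0"
    and d': "\<And>x. x \<noteq> 0 \<Longrightarrow> (\<psi>' has_real_derivative \<psi>'' x) (at x)"
    and eq: "\<And>x. x \<noteq> 0 \<Longrightarrow> - \<psi>'' x + potential b h x * \<psi> x = (l + 1 / 2) * \<psi> x"
    and int: "integrable lborel (\<lambda>x. (\<psi> x)\<^sup>2)" and nz: "\<exists>x. \<psi> x \<noteq> 0"
    using ev unfolding is_eigenvalue_def by blast
  have cont: "continuous_on S \<psi>" for S by (rule DERIV_continuous_on[OF has_field_derivative_at_within[OF d]])
  have "isCont \<psi>' x" for x using c0 DERIV_isCont[OF d'] by (cases "x = 0") auto
  then have cont': "continuous_on S \<psi>'" for S by (intro continuous_at_imp_continuous_on) auto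
  have ll: "\<psi>'' x = ((- b - x)\<^sup>2 / 4 - l - 1 / 2) * \<psi> x" if "x < 0" for x
    using eq[of x] that by (simp add: potential_def power2_eq_square algebra_simps)
  have rr: "\<psi>'' x = right_coeff b h l x * \<psi> x" if "x > 0" for x
    using eq[of x] that by (simp add: potential_def right_coeff_def algebra_simps diff_divide_distrib)
  have dr: "(\<psi>' has_real_derivative right_coeff b h l x * \<psi> x) (at x)" if "x > 0" for x
    using d'[of x] rr[OF that] that by simp
  have neg: "((\<lambda>x. - b - x) has_real_derivative - 1) (at x)" for x
    by (auto intro!: derivative_eq_intros)
  have cn: "continuous_on S (\<lambda>x. \<psi> (- b - x))" "continuous_on S (\<lambda>x. - \<psi>' (- b - x))" for S
    by (rule continuous_on_compose2[OF cont[of UNIV]] continuous_on_minus[OF continuous_on_compose2[OF cont'[of UNIV]]],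
        (intro continuous_intros)[1], simp)+
  have cD: "continuous_on S (pcD l)" "continuous_on S (pcD' l)" for S
    by (rule DERIV_continuous_on[OF has_field_derivative_at_within[OF pcD_deriv]]
             DERIV_continuous_on[OF has_field_derivative_at_within[OF pcD'_deriv]])+
  have "\<psi> (- b - - b) * pcD' l (- b) = - \<psi>' (- b - - b) * pcD l (- b)"
  proof (rule ode2_L2_wronskian_eq_0[where f="\<lambda>z. \<psi> (- b - z)" and f'="\<lambda>z. - \<psi>' (- b - z)" and h="pcD l" and h'="pcD' l"
        and Q="\<lambda>z. z\<^sup>2 / 4 - l - 1 / 2" and a="- b" and b="max (- b) (2 * (\<bar>l\<bar> + 1))"])
    fix z :: real assume z: "- b < z"
    show "((\<lambda>z. \<psi> (- b - z)) has_real_derivative - \<psi>' (- b - z)) (at z)"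
      using DERIV_chain2[OF d neg] by simp
    have "((\<lambda>z. - \<psi>' (- b - z)) has_real_derivative \<psi>'' (- b - z)) (at z)"
      using DERIV_minus[OF DERIV_chain2[OF d'[of "- b - z"] neg]] z by simp
    then show "((\<lambda>z. - \<psi>' (- b - z)) has_real_derivative (z\<^sup>2 / 4 - l - 1 / 2) * \<psi> (- b - z)) (at z)"
      using ll[of "- b - z"] z by simp
  next
    have "integrable lborel (\<lambda>x. (\<psi> (- b + - 1 * x))\<^sup>2)"
      using lborel_integrable_real_affine[OF int, of "- 1" "- b"] by simp
    then have "integrable lborel (\<lambda>z. indicator {- b..} z *\<^sub>R (\<psi> (- b + - 1 * z))\<^sup>2)"
      by (intro integrable_mult_indicator) auto
    then show "integrable lborel (\<lambda>z. indicator {- b..} z * (\<psi> (- b - z))\<^sup>2)" by simp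
  next
    \<comment> \<open>Beyond \<open>2 (\<bar>l\<bar> + 1)\<close> one has
      \<open>z^2 / 4 \<ge> (\<bar>l\<bar> + 1)^2 \<ge> \<bar>l\<bar> + 1\<close>, which exceeds
      \<open>l + 1 / 2\<close>.\<close>
    fix z :: real assume "max (- b) (2 * (\<bar>l\<bar> + 1)) < z"
    then have "(2 * (\<bar>l\<bar> + 1))\<^sup>2 \<le> z\<^sup>2" by (intro power_mono) auto
    moreover have "(\<bar>l\<bar> + 1) * 1 \<le> (\<bar>l\<bar> + 1) * (\<bar>l\<bar> + 1)" by (intro mult_left_mono) auto
    moreover have "(2 * (\<bar>l\<bar> + 1))\<^sup>2 = 4 * ((\<bar>l\<bar> + 1) * (\<bar>l\<bar> + 1))" by (simp add: power2_eq_square algebra_simps)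
    ultimately have "4 * (\<bar>l\<bar> + 1) \<le> z\<^sup>2" by linarith
    then show "0 \<le> z\<^sup>2 / 4 - l - 1 / 2" using abs_ge_self[of l] by (simp add: field_simps)
  qed (use cn cD pcD_deriv pcD'_deriv pcD_at_top in auto)
  then have L: "\<psi> 0 * pcD' l (- b) = - \<psi>' 0 * pcD l (- b)" by simp
  have cR: "continuous_on S (right_sol b h l)" "continuous_on S (right_sol' b h l)" for S
    by (rule DERIV_continuous_on[OF has_field_derivative_at_within[OF right_sol_deriv[OF par(2)]]]
             DERIV_continuous_on[OF has_field_derivative_at_within[OF right_sol'_deriv[OF par(2)]]])+
  have R: "\<psi> 0 * right_sol' b h l 0 = \<psi>' 0 * right_sol b h l 0"
  proof (rule ode2_L2_wronskian_eq_0[where f=\<psi> and f'=\<psi>' and h="right_sol b h l" and h'="right_sol' b h l"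
        and Q="right_coeff b h l" and a=0 and b=0])
    have "integrable lborel (\<lambda>z. indicator {0..} z *\<^sub>R (\<psi> z)\<^sup>2)"
      by (intro integrable_mult_indicator int) auto
    then show "integrable lborel (\<lambda>z. indicator {0..} z * (\<psi> z)\<^sup>2)" by simp
    show "(\<psi>' has_real_derivative right_coeff b h l x * \<psi> x) (at x)" if "0 < x" for x
      by (rule dr[OF that])
    show "right_coeff b h l x \<ge> 0" if "0 < x" for x using right_coeff_nonneg[OF par] that by simp
  qed (use d cont cont' cR right_sol_deriv[OF par(2)] right_sol'_deriv[OF par(2)] right_sol_at_top[OF par(2)] in auto)
  have R0: "right_sol b h l 0 \<noteq> 0" using right_sol_nonzero[OF par, of 0] by simp
  have s: "\<psi>' 0 = - right_slope b h l * \<psi> 0" using R R0 by (simp add: right_slope_def field_simps)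
  \<comment> \<open>Otherwise the slope relation gives \<open>\<psi>' 0 = 0\<close> too, and
    uniqueness on both sides of 0 annihilates the eigenfunction.\<close>
  have "\<psi> 0 \<noteq> 0"
  proof
    assume z: "\<psi> 0 = 0"
    then have z': "\<psi>' 0 = 0" using s by simp
    obtain x where x: "\<psi> x \<noteq> 0" using nz by blast
    then consider "x > 0" | "x < 0" using z by (cases "x = 0") force+
    then show False
    proof cases
      case 1
      have "continuous_on {0..x} (right_coeff b h l)" unfolding right_coeff_def[abs_def] by (intro continuous_intros) auto
      then obtain K where K: "\<And>y. 0 \<le> y \<Longrightarrow> y \<le> x \<Longrightarrow> \<bar>right_coeff b h l y\<bar> \<le> K" by (rule continuous_on_Icc_bounded) blast
      have "\<psi> x = 0"
        by (rule ode2_zero_forward(1)[where f=\<psi> and f'=\<psi>' and a=0 and b=x and Q="right_coeff b h l" and K=K])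
          (use 1 d cont cont' z z' K dr in auto)
      then show False using x by simp
    next
      case 2
      have "continuous_on {x..0} (\<lambda>y. (- b - y)\<^sup>2 / 4 - l - 1 / 2)" by (intro continuous_intros) auto
      then obtain K where K: "\<And>y. x \<le> y \<Longrightarrow> y \<le> 0 \<Longrightarrow> \<bar>(- b - y)\<^sup>2 / 4 - l - 1 / 2\<bar> \<le> K" by (rule continuous_on_Icc_bounded) blast
      have "\<psi> x = 0"
      proof (rule ode2_zero_backward(1)[where f=\<psi> and f'=\<psi>' and a=x and b=0 and Q="\<lambda>y. (- b - y)\<^sup>2 / 4 - l - 1 / 2" and K=K])
        fix y assume y: "x < y" "y < 0"
        show "(\<psi>' has_real_derivative ((- b - y)\<^sup>2 / 4 - l - 1 / 2) * \<psi> y) (at y)" using d'[of y] ll[OF y(2)] y by simp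
        show "\<bar>(- b - y)\<^sup>2 / 4 - l - 1 / 2\<bar> \<le> K" using K y by simp
      qed (use 2 d cont cont' z z' in auto)
      then show False using x by simp
    qed
  qed
  moreover have "\<psi> 0 * pcD' l (- b) = \<psi> 0 * (right_slope b h l * pcD l (- b))" unfolding L s by simp
  ultimately show ?thesis by simp
qed

section \<open>First order behaviour of the matching function\<close>

text \<open>A one-point Lipschitz condition: closed under sums and products, implied by
  differentiability, and available for \<open>pcD\<close> and \<open>pc_inner\<close> as functions
  of the index. It is just strong enough for an error of second order.\<close>

definition lipschitz_at :: "(real \<Rightarrow> real) \<Rightarrow> real \<Rightarrow> bool" where
  "lipschitz_at f x \<longleftrightarrow> (\<exists>C\<ge>0. \<forall>\<^sub>F y in nhds x. \<bar>f y - f x\<bar> \<le> C * \<bar>y - x\<bar>)"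

lemma lipschitz_at_const: "lipschitz_at (\<lambda>_. c) x"
  unfolding lipschitz_at_def by (intro exI[of _ 0]) simp

lemma eventually_nhds_ball: "d > 0 \<Longrightarrow> \<forall>\<^sub>F y in nhds x. \<bar>y - x\<bar> < (d::real)"
  unfolding eventually_nhds_metric by (auto simp: dist_real_def)

lemma lipschitz_at_add:
  assumes "lipschitz_at f x" "lipschitz_at g x" shows "lipschitz_at (\<lambda>y. f y + g y) x"
proof -
  obtain C D where CD: "C \<ge> 0" "D \<ge> 0" "\<forall>\<^sub>F y in nhds x. \<bar>f y - f x\<bar> \<le> C * \<bar>y - x\<bar>" "\<forall>\<^sub>F y in nhds x. \<bar>g y - g x\<bar> \<le> D * \<bar>y - x\<bar>"
    using assms unfolding lipschitz_at_def by blast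
  from CD(3,4) have "\<forall>\<^sub>F y in nhds x. \<bar>f y + g y - (f x + g x)\<bar> \<le> (C + D) * \<bar>y - x\<bar>"
  proof eventually_elim
    case (elim y) then show ?case by (simp only: distrib_right)
  qed
  then show ?thesis unfolding lipschitz_at_def using CD(1,2) by (intro exI[of _ "C + D"]) simp
qed

lemma lipschitz_at_mult:
  assumes "lipschitz_at f x" "lipschitz_at g x" shows "lipschitz_at (\<lambda>y. f y * g y) x"
proof -
  obtain C D where CD: "C \<ge> 0" "D \<ge> 0" "\<forall>\<^sub>F y in nhds x. \<bar>f y - f x\<bar> \<le> C * \<bar>y - x\<bar>" "\<forall>\<^sub>F y in nhds x. \<bar>g y - g x\<bar> \<le> D * \<bar>y - x\<bar>"
    using assms unfolding lipschitz_at_def by blast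
  have "\<forall>\<^sub>F y in nhds x. \<bar>y - x\<bar> < 1" by (rule eventually_nhds_ball) simp
  with CD(3,4) have "\<forall>\<^sub>F y in nhds x. \<bar>f y * g y - f x * g x\<bar> \<le> (C * (\<bar>g x\<bar> + D) + \<bar>f x\<bar> * D) * \<bar>y - x\<bar>"
  proof eventually_elim
    case (elim y)
    have "D * \<bar>y - x\<bar> \<le> D * 1" using CD(2) elim(3) by (intro mult_left_mono) auto
    then have gy: "\<bar>g y\<bar> \<le> \<bar>g x\<bar> + D" using elim(2) by linarith
    have "f y * g y - f x * g x = (f y - f x) * g y + f x * (g y - g x)" by (simp add: algebra_simps)
    then have "\<bar>f y * g y - f x * g x\<bar> \<le> \<bar>f y - f x\<bar> * \<bar>g y\<bar> + \<bar>f x\<bar> * \<bar>g y - g x\<bar>"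
      by (metis abs_mult abs_triangle_ineq)
    also have "\<dots> \<le> (C * \<bar>y - x\<bar>) * (\<bar>g x\<bar> + D) + \<bar>f x\<bar> * (D * \<bar>y - x\<bar>)"
      using elim gy CD(1) by (intro add_mono mult_mono) auto
    also have "\<dots> = (C * (\<bar>g x\<bar> + D) + \<bar>f x\<bar> * D) * \<bar>y - x\<bar>" by (simp add: algebra_simps)
    finally show ?case .
  qed
  moreover have "0 \<le> C * (\<bar>g x\<bar> + D) + \<bar>f x\<bar> * D" using CD(1,2) by simp
  ultimately show ?thesis unfolding lipschitz_at_def by blast
qed

lemma DERIV_lipschitz_at:
  assumes "(f has_real_derivative D) (at x)" shows "lipschitz_at f x"
proof -
  have "((\<lambda>y. (f y - f x) / (y - x)) \<longlongrightarrow> D) (at x)" using assms by (simp add: has_field_derivative_iff)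
  then have "\<forall>\<^sub>F y in at x. \<bar>(f y - f x) / (y - x) - D\<bar> < 1" using tendstoD[of _ D "at x" 1] by (simp add: dist_real_def)
  then have "\<forall>\<^sub>F y in nhds x. y \<noteq> x \<longrightarrow> \<bar>(f y - f x) / (y - x) - D\<bar> < 1" by (simp add: eventually_at_filter)
  then have "\<forall>\<^sub>F y in nhds x. \<bar>f y - f x\<bar> \<le> (\<bar>D\<bar> + 1) * \<bar>y - x\<bar>"
  proof eventually_elim
    case (elim y)
    show ?case
    proof (cases "y = x")
      case False
      then have "\<bar>(f y - f x) / (y - x)\<bar> \<le> \<bar>D\<bar> + 1" using elim by linarith
      then show ?thesis using False by (simp add: abs_divide divide_le_eq)
    qed simp
  qed
  then show ?thesis unfolding lipschitz_at_def by (intro exI[of _ "\<bar>D\<bar> + 1"]) simp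
qed

lemma lipschitz_at_tendsto:
  assumes "lipschitz_at f x" shows "(f \<longlongrightarrow> f x) (nhds x)"
proof -
  obtain C where C: "\<forall>\<^sub>F y in nhds x. \<bar>f y - f x\<bar> \<le> C * \<bar>y - x\<bar>" using assms unfolding lipschitz_at_def by blast
  have "((\<lambda>y. f y - f x) \<longlongrightarrow> 0) (nhds x)"
  proof (rule Lim_null_comparison)
    show "\<forall>\<^sub>F y in nhds x. norm (f y - f x) \<le> C * \<bar>y - x\<bar>" using C by simp
    have "((\<lambda>y. C * \<bar>y - x\<bar>) \<longlongrightarrow> C * \<bar>x - x\<bar>) (nhds x)" by (intro tendsto_intros filterlim_ident)
    then show "((\<lambda>y. C * \<bar>y - x\<bar>) \<longlongrightarrow> 0) (nhds x)" by simp
  qed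
  then show ?thesis by (simp add: LIM_zero_cancel tendsto_iff dist_real_def)
qed

lemma lipschitz_at_pcD: "lipschitz_at (\<lambda>p. pcD p z) r"
proof -
  obtain n where n: "r + 1 \<le> real n" using real_arch_simple by blast
  obtain C where C: "C > 0" "\<And>p. \<bar>p - r\<bar> \<le> 1 \<Longrightarrow> \<bar>pcD p z - pcD r z\<bar> \<le> C * \<bar>p - r\<bar> * exp (- 2 * z)"
    using pcD_lipschitz_index[of n "- z"] n by auto
  have "\<forall>\<^sub>F p in nhds r. \<bar>p - r\<bar> < 1" by (rule eventually_nhds_ball) simp
  then have "\<forall>\<^sub>F p in nhds r. \<bar>pcD p z - pcD r z\<bar> \<le> (C * exp (- 2 * z)) * \<bar>p - r\<bar>"
  proof eventually_elim
    case (elim p) then show ?case using C(2)[of p] by (simp add: mult_ac)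
  qed
  then show ?thesis unfolding lipschitz_at_def using C(1) by (intro exI[of _ "C * exp (- 2 * z)"]) simp
qed

lemma lipschitz_at_pc_inner: "lipschitz_at (\<lambda>p. pc_inner r p a) r"
proof -
  obtain C where C: "C > 0" "\<And>q. \<bar>q - r\<bar> \<le> 1 \<Longrightarrow> \<bar>pc_inner r q a - pc_inner r r a\<bar> \<le> C * \<bar>q - r\<bar>"
    using pc_inner_lipschitz[of r a] by (metis order_refl)
  have "\<forall>\<^sub>F p in nhds r. \<bar>p - r\<bar> < 1" by (rule eventually_nhds_ball) simp
  then have "\<forall>\<^sub>F p in nhds r. \<bar>pc_inner r p a - pc_inner r r a\<bar> \<le> C * \<bar>p - r\<bar>"
  proof eventually_elim
    case (elim p) then show ?case using C(2)[of p] by simp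
  qed
  then show ?thesis unfolding lipschitz_at_def using C(1) by (intro exI[of _ C]) simp
qed

section \<open>The difference quotient of the matching function and the coefficient A\<close>

definition slope_coeff :: "real \<Rightarrow> real \<Rightarrow> real" where
  "slope_coeff b l = (b - 2 * sqrt (b\<^sup>2 / 4 - l)) / (8 * (b\<^sup>2 / 4 - l))"

text \<open>The difference quotient of the matching function \<open>V_tilde\<close> at \<open>r0\<close>, up to the factor
  \<open>pcD (r0 b) (- b)\<close>.\<close>

definition match_quot :: "real \<Rightarrow> real \<Rightarrow> real" where
  "match_quot b l = pc_inner (r0 b) l (- b) +
     pcD (r0 b) (- b) * (pcD l (- b) * (1 / (sqrt (b\<^sup>2 / 4 - l) + sqrt (b\<^sup>2 / 4 - r0 b))))"

text \<open>The Wronskian of \<open>r0\<close> and \<open>l\<close>, with the matching equation at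
  \<open>r0\<close> inserted; the difference of the square roots is rationalised. The slope
  \<open>m\<close> is free: \<open>m = sqrt (b^2 / 4 - l)\<close> gives \<open>V_tilde\<close>, the
  right slope gives the eigenvalue condition.\<close>

lemma match_quot_identity:
  assumes b: "b > beta_star" and l: "l < b\<^sup>2 / 4"
  shows "pcD (r0 b) (- b) * (pcD' l (- b) - m * pcD l (- b)) =
    (l - r0 b) * match_quot b l - pcD (r0 b) (- b) * pcD l (- b) * (m - sqrt (b\<^sup>2 / 4 - l))"
proof -
  define D E where "D = pcD (r0 b) (- b)" and "E = pcD l (- b)"
  define s t where "s = sqrt (b\<^sup>2 / 4 - l)" and "t = sqrt (b\<^sup>2 / 4 - r0 b)"
  have st: "s > 0" "t > 0" "s * s = b\<^sup>2 / 4 - l" "t * t = b\<^sup>2 / 4 - r0 b"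
    using l r0_props(3)[OF b] by (simp_all add: s_def t_def)
  have W: "D * pcD' l (- b) = (l - r0 b) * pc_inner (r0 b) l (- b) + E * (t * D)"
    using pc_wronskian[of "r0 b" "- b" l] r0_props(5)[OF b] by (simp add: D_def E_def t_def)
  have "(l - r0 b) * (1 / (s + t)) = t - s"
  proof -
    have "l - r0 b = (t - s) * (s + t)" using st(3,4) by (simp add: algebra_simps)
    then show ?thesis using st(1,2) by simp
  qed
  then have "(l - r0 b) * (D * (E * (1 / (s + t)))) = D * (E * (t - s))" by (metis mult.left_commute)
  then have "(l - r0 b) * match_quot b l = (l - r0 b) * pc_inner (r0 b) l (- b) + D * (E * (t - s))"
    unfolding match_quot_def distrib_left D_def E_def s_def t_def by simp
  then have "(l - r0 b) * match_quot b l - D * E * (m - s) = D * (pcD' l (- b) - m * E)"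
    using W by (simp add: algebra_simps)
  then show ?thesis by (simp add: D_def E_def s_def)
qed

text \<open>At \<open>l = r0\<close> the first summand is the integral of \<open>D^2\<close> over
  the half-line and the second is \<open>D^2\<close> over twice the square root, so the root is
  simple.\<close>

lemma match_quot_pos:
  assumes b: "b > beta_star" shows "match_quot b (r0 b) > 0"
proof -
  have "sqrt (b\<^sup>2 / 4 - r0 b) > 0" using r0_props(3)[OF b] by simp
  then have "pcD (r0 b) (- b) * (pcD (r0 b) (- b) * (1 / (sqrt (b\<^sup>2 / 4 - r0 b) + sqrt (b\<^sup>2 / 4 - r0 b)))) \<ge> 0"
    by (simp flip: mult.assoc)
  then show ?thesis unfolding match_quot_def using pc_inner_self_pos[of "r0 b" "- b"] by linarith
qed

lemma pcD_r0_nonzero: assumes b: "b > beta_star" shows "pcD (r0 b) (- b) \<noteq> 0"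
  using pcD_or_pcD'_nonzero[of "r0 b" "- b"] r0_props(5)[OF b] by auto

lemma sqrt_shift_deriv:
  assumes "l < c" shows "((\<lambda>l. sqrt (c - l)) has_real_derivative - (1 / (2 * sqrt (c - l)))) (at l)"
proof -
  have "((\<lambda>l. c - l) has_real_derivative - 1) (at l)" by (auto intro!: derivative_eq_intros)
  from DERIV_chain2[OF DERIV_real_sqrt this, of] assms show ?thesis by (simp add: field_simps)
qed

lemma lipschitz_at_match_quot:
  assumes b: "b > beta_star" shows "lipschitz_at (match_quot b) (r0 b)"
proof -
  have r: "r0 b < b\<^sup>2 / 4" by (rule r0_props(3)[OF b])
  define t where "t = sqrt (b\<^sup>2 / 4 - r0 b)"
  have t: "t > 0" using r by (simp add: t_def)
  have "sqrt (b\<^sup>2 / 4 - r0 b) + t \<noteq> 0" using t by (simp flip: t_def)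
  note DERIV_divide[OF DERIV_const DERIV_add[OF sqrt_shift_deriv[OF r] DERIV_const] this]
  from DERIV_lipschitz_at[OF this] show ?thesis
    unfolding match_quot_def[abs_def] t_def
    by (intro lipschitz_at_add lipschitz_at_mult lipschitz_at_pc_inner lipschitz_at_const lipschitz_at_pcD)
qed

lemma lipschitz_at_slope_coeff:
  assumes b: "b > beta_star" shows "lipschitz_at (slope_coeff b) (r0 b)"
proof -
  have r: "r0 b < b\<^sup>2 / 4" by (rule r0_props(3)[OF b])
  have d1: "((\<lambda>l. b - 2 * sqrt (b\<^sup>2 / 4 - l)) has_real_derivative 0 - 2 * - (1 / (2 * sqrt (b\<^sup>2 / 4 - r0 b)))) (at (r0 b))"
    by (intro DERIV_diff DERIV_const DERIV_cmult sqrt_shift_deriv[OF r])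
  have d2: "((\<lambda>l. 8 * (b\<^sup>2 / 4 - l)) has_real_derivative - 8) (at (r0 b))"
    by (auto intro!: derivative_eq_intros)
  have "8 * (b\<^sup>2 / 4 - r0 b) \<noteq> 0" using r by simp
  from DERIV_divide[OF d1 d2 this] show ?thesis
    unfolding slope_coeff_def[abs_def] by (rule DERIV_lipschitz_at)
qed

text \<open>The identity with \<open>m\<close> equal to the square root displays the difference
  quotient as \<open>match_quot b l / D\<close>, so continuity of \<open>match_quot\<close> at
  \<open>r0\<close> is enough.\<close>

lemma V_tilde_deriv:
  assumes b: "b > beta_star"
  shows "((\<lambda>p. V_tilde p b) has_real_derivative match_quot b (r0 b) / pcD (r0 b) (- b)) (at (r0 b))"
  unfolding has_field_derivative_iff
proof (rule Lim_transform_eventually)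
  have D: "pcD (r0 b) (- b) \<noteq> 0" by (rule pcD_r0_nonzero[OF b])
  have "(match_quot b \<longlongrightarrow> match_quot b (r0 b)) (at (r0 b))"
    using lipschitz_at_tendsto[OF lipschitz_at_match_quot[OF b]] by (rule tendsto_mono[rotated]) (simp add: at_within_le_nhds)
  then show "((\<lambda>l. match_quot b l / pcD (r0 b) (- b)) \<longlongrightarrow> match_quot b (r0 b) / pcD (r0 b) (- b)) (at (r0 b))"
    using D by (intro tendsto_intros)
  have V0: "V_tilde (r0 b) b = 0" using r0_props(5)[OF b] by (simp add: V_tilde_def)
  have "\<forall>\<^sub>F l in at (r0 b). l \<in> {..<b\<^sup>2 / 4}" by (rule eventually_at_in_open') (use r0_props(3)[OF b] in auto)
  moreover have "\<forall>\<^sub>F l in at (r0 b). l \<noteq> r0 b" by (rule eventually_neq_at_within)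
  ultimately show "\<forall>\<^sub>F l in at (r0 b). match_quot b l / pcD (r0 b) (- b) = (V_tilde l b - V_tilde (r0 b) b) / (l - r0 b)"
  proof eventually_elim
    case (elim l)
    have "pcD (r0 b) (- b) * V_tilde l b = (l - r0 b) * match_quot b l"
      using match_quot_identity[OF b, of l "sqrt (b\<^sup>2 / 4 - l)"] elim(1) by (simp add: V_tilde_def mult.commute)
    then show ?case using D elim(2) unfolding V0 by (simp add: field_simps)
  qed
qed

text \<open>Replacing the inverse derivative by \<open>D / match_quot\<close> makes D enter squared,
  so the sign of the coefficient no longer depends on that of D.\<close>

lemma A_coeff_eq:
  assumes b: "b > beta_star"
  shows "A_coeff b = slope_coeff b (r0 b) * (pcD (r0 b) (- b))\<^sup>2 / match_quot b (r0 b)"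
proof -
  define t where "t = sqrt (b\<^sup>2 / 4 - r0 b)"
  have q: "b\<^sup>2 - 4 * r0 b = 4 * (b\<^sup>2 / 4 - r0 b)" by simp
  have s: "sqrt (b\<^sup>2 - 4 * r0 b) = 2 * t" unfolding q real_sqrt_mult t_def by simp
  have "deriv (\<lambda>p. V_tilde p b) (r0 b) = match_quot b (r0 b) / pcD (r0 b) (- b)"
    by (rule DERIV_imp_deriv[OF V_tilde_deriv[OF b]])
  then have "A_coeff b = 1 / 2 * ((b - 2 * t) / (4 * (b\<^sup>2 / 4 - r0 b))) * pcD (r0 b) (- b) * inverse (match_quot b (r0 b) / pcD (r0 b) (- b))"
    unfolding A_coeff_def s by (simp only: q)
  also have "\<dots> = slope_coeff b (r0 b) * (pcD (r0 b) (- b))\<^sup>2 / match_quot b (r0 b)"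
  proof -
    have "1 / 2 * (n / (4 * c)) * d * inverse (p / d) = n / (8 * c) * d\<^sup>2 / p" for n c d p :: real
      by (simp add: power2_eq_square)
    then show ?thesis unfolding slope_coeff_def t_def[symmetric] .
  qed
  finally show ?thesis .
qed

lemma A_coeff_pos: assumes b: "b > beta_star" shows "A_coeff b > 0"
proof -
  note r = r0_props[OF b]
  have "sqrt (b\<^sup>2 / 4 - r0 b) < sqrt ((b / 2)\<^sup>2)" using r(2) by (intro real_sqrt_less_mono) (simp add: power_divide)
  then have "b - 2 * sqrt (b\<^sup>2 / 4 - r0 b) > 0" using r(4) by simp
  then have "slope_coeff b (r0 b) > 0" unfolding slope_coeff_def using r(3) by (intro divide_pos_pos) auto
  then show ?thesis unfolding A_coeff_eq[OF b] using match_quot_pos[OF b] pcD_r0_nonzero[OF b] by simp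
qed

lemma slope_coeff_bound:
  assumes "b > 0" "s1 > 0" "0 \<le> l" "l \<le> b\<^sup>2 / 4 - s1\<^sup>2"
  shows "\<bar>slope_coeff b l\<bar> \<le> b / (8 * s1\<^sup>2)"
proof -
  have "sqrt (b\<^sup>2 / 4 - l) \<le> sqrt ((b / 2)\<^sup>2)" using assms(3) by (intro real_sqrt_le_mono) (simp add: power_divide)
  then have "sqrt (b\<^sup>2 / 4 - l) \<le> b / 2" using assms(1) by simp
  have s: "s1\<^sup>2 \<le> b\<^sup>2 / 4 - l" using assms(4) by simp
  have "s1\<^sup>2 > 0" using assms(2) by simp
  have "0 \<le> b\<^sup>2 / 4 - l" "b - 2 * sqrt (b\<^sup>2 / 4 - l) \<ge> 0"
    using \<open>sqrt (b\<^sup>2 / 4 - l) \<le> b / 2\<close> s \<open>s1\<^sup>2 > 0\<close> by linarith+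
  then have n: "0 \<le> b - 2 * sqrt (b\<^sup>2 / 4 - l)" "b - 2 * sqrt (b\<^sup>2 / 4 - l) \<le> b" by simp_all
  have s0: "0 \<le> 8 * (b\<^sup>2 / 4 - l)" "8 * s1\<^sup>2 \<le> 8 * (b\<^sup>2 / 4 - l)" "0 < 8 * s1\<^sup>2"
    using mult_left_mono[OF s, of 8] mult_pos_pos[OF _ \<open>s1\<^sup>2 > 0\<close>, of 8]
    by (meson order_trans less_imp_le zero_less_numeral)+
  have "slope_coeff b l \<le> b / (8 * s1\<^sup>2)"
    unfolding slope_coeff_def by (rule frac_le[OF less_imp_le[OF assms(1)] n(2) s0(3,2)])
  moreover have "0 \<le> slope_coeff b l"
    unfolding slope_coeff_def by (rule divide_nonneg_nonneg[OF n(1) s0(1)])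
  ultimately show ?thesis by simp
qed

section \<open>The least positive eigenvalue and its expansion\<close>

lemma continuous_on_right_slope:
  assumes "b > 0" "h > 0" "h \<le> t"
  shows "continuous_on {..b\<^sup>2 / 4 - t} (right_slope b h)"
proof -
  have "continuous_on {..b\<^sup>2 / 4 - t} (\<lambda>l. right_sol b h l 0)" "continuous_on {..b\<^sup>2 / 4 - t} (\<lambda>l. right_sol' b h l 0)"
    unfolding right_sol_def right_sol'_def using assms(2) by (intro continuous_intros; simp)+
  then show ?thesis
    unfolding right_slope_def[abs_def] using right_sol_nonzero[OF assms, of _ 0]
    by (intro continuous_on_divide continuous_on_minus) auto
qed

text \<open>The least zero of the matching function \<open>F\<close> is located by treating small
  \<open>l\<close>, the compact range up to \<open>r - d\<close>, and a neighbourhood of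
  \<open>r\<close> separately. The exact identity then gives
  \<open>\<bar>x - r\<bar> = O(h)\<close>, and inserting this into the same identity once more gives
  the error \<open>O(h^2)\<close>.\<close>

lemma spectral_gap_expansion:
  assumes b: "b > beta_star"
  obtains C h1 where "C > 0" "h1 > 0"
    "\<And>h. 0 < h \<Longrightarrow> h < h1 \<Longrightarrow> is_least_positive (is_eigenvalue b h) (spectral_gap b h)"
    "\<And>h. 0 < h \<Longrightarrow> h < h1 \<Longrightarrow> \<bar>spectral_gap b h - (r0 b + A_coeff b * h)\<bar> \<le> C * h\<^sup>2"
proof -
  define r D where "r = r0 b" and "D = pcD r (- b)"
  note r = r0_props[OF b, folded r_def]
  \<comment> \<open>This places \<open>L\<close> halfway between \<open>r\<close> and
    \<open>b^2 / 4\<close>: beyond the root, yet with margin \<open>s1^2\<close> below the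
    threshold.\<close>
  define s1 where "s1 = sqrt ((b\<^sup>2 / 4 - r) / 2)"
  define L where "L = b\<^sup>2 / 4 - s1\<^sup>2"
  have s1: "s1 > 0" using r(3) by (simp add: s1_def)
  have s1sq: "s1\<^sup>2 = (b\<^sup>2 / 4 - r) / 2" using r(3) by (simp add: s1_def)
  have L: "r < L" "L < b\<^sup>2 / 4" using r(3) by (simp_all add: L_def s1sq field_simps)
  define s where "s l = sqrt (b\<^sup>2 / 4 - l)" for l
  obtain K h0 where K: "K > 0" "h0 > 0" "h0 \<le> s1\<^sup>2"
    "\<And>h l. 0 < h \<Longrightarrow> h < h0 \<Longrightarrow> 0 \<le> l \<Longrightarrow> l \<le> L \<Longrightarrow> \<bar>right_slope b h l - (s l + h * slope_coeff b l)\<bar> \<le> K * h\<^sup>2"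
    using right_slope_expansion[OF r(4) s1] unfolding L_def s_def slope_coeff_def by blast
  define C1 where "C1 = b / (8 * s1\<^sup>2) + K"
  have C1: "C1 > 0" using r(4) s1 K(1) by (simp add: C1_def add_pos_pos)
  have bound1: "\<bar>right_slope b h l - s l\<bar> \<le> C1 * h" if h: "0 < h" "h < h0" "h < 1" "0 \<le> l" "l \<le> L" for h l
  proof -
    have "\<bar>h * slope_coeff b l\<bar> \<le> h * (b / (8 * s1\<^sup>2))"
      using slope_coeff_bound[OF r(4) s1 h(4)] h by (simp only: abs_mult) (intro mult_mono; simp add: L_def)
    moreover have "K * h\<^sup>2 \<le> K * h" using h K(1) by (simp add: power2_eq_square)
    moreover have "C1 * h = h * (b / (8 * s1\<^sup>2)) + K * h" by (simp add: C1_def algebra_simps)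
    ultimately show ?thesis using K(4)[OF h(1,2,4,5)] by linarith
  qed
  define P where "P = match_quot b"
  define W where "W l = D * (pcD l (- b) * slope_coeff b l)" for l
  have Pr: "P r > 0" unfolding P_def r_def by (rule match_quot_pos[OF b])
  define m where "m = P r / 2"
  have m: "m > 0" "m < P r" using Pr by (simp_all add: m_def)
  \<comment> \<open>The added 1 makes \<open>E\<close> strictly larger than \<open>D^2\<close>, the
    value of the bounded quantity at \<open>r\<close>.\<close>
  define E where "E = D\<^sup>2 + 1"
  have E: "E > 0" by (simp add: E_def add_nonneg_pos)
  have lipP: "lipschitz_at P r" unfolding P_def r_def by (rule lipschitz_at_match_quot[OF b])
  have lipW: "lipschitz_at W r" unfolding W_def
    using lipschitz_at_slope_coeff[OF b, folded r_def] by (intro lipschitz_at_mult lipschitz_at_const lipschitz_at_pcD)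
  obtain Cp where Cp: "Cp \<ge> 0" "\<forall>\<^sub>F l in nhds r. \<bar>P l - P r\<bar> \<le> Cp * \<bar>l - r\<bar>" using lipP unfolding lipschitz_at_def by blast
  obtain Cw where Cw: "Cw \<ge> 0" "\<forall>\<^sub>F l in nhds r. \<bar>W l - W r\<bar> \<le> Cw * \<bar>l - r\<bar>" using lipW unfolding lipschitz_at_def by blast
  have ev1: "\<forall>\<^sub>F l in nhds r. m < P l" by (rule order_tendstoD(1)[OF lipschitz_at_tendsto[OF lipP] m(2)])
  have "((\<lambda>l. \<bar>D * pcD l (- b)\<bar>) \<longlongrightarrow> \<bar>D * pcD r (- b)\<bar>) (nhds r)"
    by (intro tendsto_rabs tendsto_mult tendsto_const lipschitz_at_tendsto[OF lipschitz_at_pcD])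
  then have ev2: "\<forall>\<^sub>F l in nhds r. \<bar>D * pcD l (- b)\<bar> < E"
    by (rule order_tendstoD(2)) (simp add: E_def D_def power2_eq_square)
  have ev3: "\<forall>\<^sub>F l in nhds r. l \<in> {0<..<L}" by (rule eventually_nhds_in_open) (use r(2) L in auto)
  from Cp(2) Cw(2) ev1 ev2 ev3 have "\<forall>\<^sub>F l in nhds r. \<bar>P l - P r\<bar> \<le> Cp * \<bar>l - r\<bar> \<and> \<bar>W l - W r\<bar> \<le> Cw * \<bar>l - r\<bar> \<and> m < P l \<and> \<bar>D * pcD l (- b)\<bar> < E \<and> l \<in> {0<..<L}"
    by eventually_elim simp
  then obtain d0 where d0: "d0 > 0" "\<And>l. \<bar>l - r\<bar> < d0 \<Longrightarrow> \<bar>P l - P r\<bar> \<le> Cp * \<bar>l - r\<bar> \<and> \<bar>W l - W r\<bar> \<le> Cw * \<bar>l - r\<bar> \<and> m < P l \<and> \<bar>D * pcD l (- b)\<bar> < E \<and> l \<in> {0<..<L}"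
    unfolding eventually_nhds_metric dist_real_def by blast
  define d where "d = d0 / 2"
  have d: "d > 0" using d0(1) by (simp add: d_def)
  have near: "\<bar>P l - P r\<bar> \<le> Cp * \<bar>l - r\<bar>" "\<bar>W l - W r\<bar> \<le> Cw * \<bar>l - r\<bar>" "m < P l" "\<bar>D * pcD l (- b)\<bar> < E" "0 < l" "l < L"
    if "\<bar>l - r\<bar> \<le> d" for l
    using d0(2)[of l] that d0(1) by (auto simp: d_def)
  have rd: "0 < r - d" "r + d < L" using near(5)[of "r - d"] near(6)[of "r + d"] d by auto
  obtain e where e: "e > 0" "\<And>q. 0 < q \<Longrightarrow> q < e \<Longrightarrow> pcD q (- b) > 0 \<and> pcD' q (- b) > b / 2 * pcD q (- b)"
    using pcD_small_index by blast
  define V where "V l = pcD' l (- b) - s l * pcD l (- b)" for l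
  have Vnz: "V l \<noteq> 0" if "0 < l" "l < r" for l
  proof
    assume "V l = 0"
    then have "r0_equation b l" using that r(3) by (simp add: r0_equation_def V_def s_def)
    then show False using r(1) that unfolding is_least_positive_def by fastforce
  qed
  \<comment> \<open>The limiting function has no zero before \<open>r\<close>, so compactness gives
    a positive lower bound; if the range is empty, 1 is a vacuous choice.\<close>
  obtain v0 where v0: "v0 > 0" "\<And>l. e \<le> l \<Longrightarrow> l \<le> r - d \<Longrightarrow> \<bar>V l\<bar> \<ge> v0"
  proof (cases "e \<le> r - d")
    case True
    have "continuous_on {e..r - d} (\<lambda>l. \<bar>V l\<bar>)" unfolding V_def s_def by (intro continuous_intros)
    then obtain x where x: "x \<in> {e..r - d}" "\<And>y. y \<in> {e..r - d} \<Longrightarrow> \<bar>V x\<bar> \<le> \<bar>V y\<bar>"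
      using continuous_attains_inf[of "{e..r - d}" "\<lambda>l. \<bar>V l\<bar>"] True by auto
    have "V x \<noteq> 0" using x(1) e(1) d by (intro Vnz) auto
    then show ?thesis using that[of "\<bar>V x\<bar>"] x(2) by auto
  next
    case False then show ?thesis using that[of 1] by auto
  qed
  have "continuous_on {0..L} (\<lambda>l. pcD l (- b))" by (intro continuous_intros)
  then obtain D1 where D1: "D1 > 0" "\<And>l. 0 \<le> l \<Longrightarrow> l \<le> L \<Longrightarrow> \<bar>pcD l (- b)\<bar> \<le> D1"
    by (rule continuous_on_Icc_bounded) blast
  \<comment> \<open>The third bound makes \<open>F\<close> differ from its limit by less than
    \<open>v0\<close>; the fourth makes the slope error smaller than \<open>d m\<close>, a lower
    bound for the main term at distance \<open>d\<close> from \<open>r\<close>.\<close>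
  define h1 where "h1 = min (min h0 1) (min (v0 / (C1 * D1)) (d * m / (E * C1)))"
  have h1: "h1 > 0" using K(2) v0(1) C1 D1(1) d m(1) E by (simp add: h1_def)
  define C2 where "C2 = E * C1 / m"
  have C2: "C2 > 0" using E C1 m(1) by (simp add: C2_def)
  define C3 where "C3 = Cp * C2\<^sup>2 + E * K + Cw * C2"
  have C3: "C3 > 0" using Cp(1) Cw(1) C2 E K(1) unfolding C3_def by (intro add_pos_nonneg add_nonneg_pos) auto
  have A: "A_coeff b * P r = W r"
    unfolding A_coeff_eq[OF b] W_def P_def D_def r_def using Pr[unfolded P_def r_def] by (simp add: power2_eq_square)
  have ident: "D * (pcD' l (- b) - M * pcD l (- b)) = (l - r) * P l - D * pcD l (- b) * (M - s l)" if "l < L" for l M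
    unfolding D_def r_def P_def s_def by (rule match_quot_identity[OF b]) (use that L in simp)
  have gap: "is_least_positive (is_eigenvalue b h) (spectral_gap b h) \<and> \<bar>spectral_gap b h - (r + A_coeff b * h)\<bar> \<le> C3 / P r * h\<^sup>2"
    if h: "0 < h" "h < h1" for h
  proof -
    have h': "h < h0" "h < 1" "h \<le> s1\<^sup>2" using h(2) K(3) by (auto simp: h1_def)
    have hv: "C1 * h * D1 < v0" using h(2) C1 D1(1) by (simp add: h1_def field_simps)
    have hd: "E * (C1 * h) < d * m" using h(2) E C1 by (simp add: h1_def field_simps)
    note par = r(4) h(1) h'(3)
    define F where "F l = pcD' l (- b) - right_slope b h l * pcD l (- b)" for l
    have contF: "continuous_on {0..r + d} F"
      unfolding F_def using rd
      by (intro continuous_intros continuous_on_subset[OF continuous_on_right_slope[OF par]]) (auto simp: L_def)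
    have Fnz: "F l \<noteq> 0" if l: "0 < l" "l < r - d" for l
    proof (cases "l < e")
      case True
      have "right_slope b h l \<le> b / 2" using l rd d by (intro right_slope_le_half[OF par]) (auto simp: L_def)
      then have "right_slope b h l * pcD l (- b) \<le> b / 2 * pcD l (- b)" using e(2)[OF l(1) True] by (intro mult_right_mono) auto
      then show ?thesis using e(2)[OF l(1) True] unfolding F_def by linarith
    next
      case False
      then have Vl: "\<bar>V l\<bar> \<ge> v0" using l by (intro v0(2)) auto
      have "F l - V l = - (right_slope b h l - s l) * pcD l (- b)" by (simp add: F_def V_def algebra_simps)
      then have "\<bar>F l - V l\<bar> = \<bar>right_slope b h l - s l\<bar> * \<bar>pcD l (- b)\<bar>" by (simp only: abs_mult abs_minus_cancel)
      also have "\<dots> \<le> C1 * h * D1" using l rd d C1 h h' by (intro mult_mono bound1 D1(2)) auto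
      finally have "\<bar>F l - V l\<bar> < v0" using hv by linarith
      then show ?thesis using Vl by auto
    qed
    have err: "\<bar>D * pcD l (- b) * (right_slope b h l - s l)\<bar> \<le> E * (C1 * h)" if "\<bar>l - r\<bar> \<le> d" for l
      unfolding abs_mult[of "D * pcD l (- b)"] using near[OF that] h h' E by (intro mult_mono bound1) auto
    have DF: "D * F l = (l - r) * P l - D * pcD l (- b) * (right_slope b h l - s l)" if "l < L" for l
      unfolding F_def by (rule ident[OF that])
    \<comment> \<open>Multiplying by D gives \<open>F\<close> the form \<open>(l - r) P l\<close>
      plus a small error with \<open>P\<close> positive, whatever the sign of D, hence a sign change
      across \<open>r\<close>.\<close>
    have up: "D * F (r + d) \<ge> 0"
    proof -
      have "d * m \<le> d * P (r + d)" using near(3)[of "r + d"] d by (intro mult_left_mono) auto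
      moreover have "D * F (r + d) = d * P (r + d) - D * pcD (r + d) (- b) * (right_slope b h (r + d) - s (r + d))"
        using DF[OF rd(2)] by simp
      moreover have "\<bar>D * pcD (r + d) (- b) * (right_slope b h (r + d) - s (r + d))\<bar> \<le> E * (C1 * h)"
        using d by (intro err) simp
      ultimately show ?thesis using hd by linarith
    qed
    have lo: "D * F (r - d) \<le> 0"
    proof -
      have "d * m \<le> d * P (r - d)" using near(3)[of "r - d"] d by (intro mult_left_mono) auto
      moreover have "D * F (r - d) = - (d * P (r - d)) - D * pcD (r - d) (- b) * (right_slope b h (r - d) - s (r - d))"
        using DF[of "r - d"] rd d by simp
      moreover have "\<bar>D * pcD (r - d) (- b) * (right_slope b h (r - d) - s (r - d))\<bar> \<le> E * (C1 * h)"
        using d by (intro err) simp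
      ultimately show ?thesis using hd by linarith
    qed
    have D0: "D \<noteq> 0" unfolding D_def r_def by (rule pcD_r0_nonzero[OF b])
    have "continuous_on {r - d..r + d} (\<lambda>l. D * F l)"
      by (intro continuous_on_mult continuous_on_const continuous_on_subset[OF contF]) (use rd in auto)
    from IVT'[OF lo up _ this] obtain x0 where x0: "r - d \<le> x0" "x0 \<le> r + d" "D * F x0 = 0" using d by auto
    then have F0: "F x0 = 0" using D0 by simp
    have x0p: "0 < x0" using x0(1) rd(1) by simp
    obtain x where x: "0 < x" "x \<le> x0" "F x = 0" "\<And>y. 0 < y \<Longrightarrow> y < x \<Longrightarrow> F y \<noteq> 0"
      using least_positive_zero_exists[OF contF rd(1) Fnz x0p x0(2) F0] by blast
    have xL: "x \<le> b\<^sup>2 / 4 - s1\<^sup>2" "x < L" using x(2) x0(2) rd(2) by (simp_all add: L_def)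
    have ilp: "is_least_positive (is_eigenvalue b h) x"
      unfolding is_least_positive_def
    proof (intro conjI allI impI)
      show "is_eigenvalue b h x" using x(3) by (intro is_eigenvalueI[OF par xL(1)]) (simp add: F_def)
      fix y assume y: "0 < y \<and> is_eigenvalue b h y"
      show "x \<le> y"
      proof (rule ccontr)
        assume n: "\<not> x \<le> y"
        then have "y \<le> b\<^sup>2 / 4 - s1\<^sup>2" using xL by simp
        from is_eigenvalueD[OF par this] y have "F y = 0" by (simp add: F_def)
        then show False using x(4)[of y] y n by simp
      qed
    qed (rule x(1))
    then have gx: "spectral_gap b h = x" unfolding spectral_gap_def by (rule least_positive_eqI)
    have "x \<ge> r - d" using Fnz[of x] x(1,3) by force
    then have xr: "\<bar>x - r\<bar> \<le> d" using x(2) x0(2) by simp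
    define M where "M = right_slope b h x"
    have eqn: "(x - r) * P x = D * pcD x (- b) * (M - s x)" using DF[OF xL(2)] x(3) by (simp add: M_def)
    have xrC: "\<bar>x - r\<bar> \<le> C2 * h"
    proof -
      have "\<bar>x - r\<bar> * m \<le> \<bar>x - r\<bar> * P x" using near(3)[OF xr] by (intro mult_left_mono) auto
      also have "\<dots> = \<bar>(x - r) * P x\<bar>" using near(3)[OF xr] m(1) by (simp add: abs_mult)
      also have "\<dots> \<le> E * (C1 * h)" unfolding eqn M_def by (rule err[OF xr])
      finally show ?thesis using m(1) by (simp add: C2_def field_simps)
    qed
    \<comment> \<open>Each term on the right is of order \<open>h^2\<close>: a product of two
      increments of order \<open>h\<close>, the error of the slope expansion, and an increment of
      \<open>W\<close> times \<open>h\<close>.\<close>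
    have "(x - r) * P r - W r * h = - ((x - r) * (P x - P r)) + (D * pcD x (- b)) * (M - (s x + h * slope_coeff b x)) + (W x - W r) * h"
      using eqn by (simp add: W_def algebra_simps)
    moreover have "\<bar>(x - r) * (P x - P r)\<bar> \<le> Cp * C2\<^sup>2 * h\<^sup>2"
    proof -
      have "\<bar>(x - r) * (P x - P r)\<bar> \<le> \<bar>x - r\<bar> * (Cp * \<bar>x - r\<bar>)" unfolding abs_mult using near(1)[OF xr] by (rule mult_left_mono) simp
      also have "\<dots> = Cp * (\<bar>x - r\<bar> * \<bar>x - r\<bar>)" by simp
      also have "\<dots> \<le> Cp * ((C2 * h) * (C2 * h))" using xrC Cp(1) C2 h by (intro mult_left_mono mult_mono) auto
      finally show ?thesis by (simp add: power2_eq_square algebra_simps)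
    qed
    moreover have "\<bar>(D * pcD x (- b)) * (M - (s x + h * slope_coeff b x))\<bar> \<le> E * K * h\<^sup>2"
    proof -
      have "\<bar>D * pcD x (- b)\<bar> * \<bar>M - (s x + h * slope_coeff b x)\<bar> \<le> E * (K * h\<^sup>2)"
        unfolding M_def using near(4)[OF xr] E h h' x(1) xL(2) by (intro mult_mono K(4)) auto
      then show ?thesis by (simp only: abs_mult mult.assoc)
    qed
    moreover have "\<bar>(W x - W r) * h\<bar> \<le> Cw * C2 * h\<^sup>2"
    proof -
      have "\<bar>(W x - W r) * h\<bar> \<le> (Cw * \<bar>x - r\<bar>) * h" using near(2)[OF xr] h by (simp add: abs_mult mult_right_mono)
      also have "\<dots> \<le> (Cw * (C2 * h)) * h" using xrC Cw(1) h by (intro mult_right_mono mult_left_mono) auto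
      finally show ?thesis by (simp add: power2_eq_square algebra_simps)
    qed
    ultimately have "\<bar>(x - r) * P r - W r * h\<bar> \<le> Cp * C2\<^sup>2 * h\<^sup>2 + E * K * h\<^sup>2 + Cw * C2 * h\<^sup>2" by linarith
    also have "\<dots> = C3 * h\<^sup>2" by (simp add: C3_def algebra_simps)
    finally have fin: "\<bar>(x - r) * P r - W r * h\<bar> \<le> C3 * h\<^sup>2" .
    have "(x - r) * P r - W r * h = (x - (r + A_coeff b * h)) * P r" unfolding A[symmetric] by (simp add: algebra_simps)
    with fin have "\<bar>x - (r + A_coeff b * h)\<bar> * P r \<le> C3 * h\<^sup>2" using Pr by (simp add: abs_mult)
    then have "\<bar>x - (r + A_coeff b * h)\<bar> \<le> C3 / P r * h\<^sup>2" using Pr by (simp add: field_simps)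
    then show ?thesis unfolding gx using ilp by simp
  qed
  show ?thesis
    by (rule that[of "C3 / P r" h1]) (use gap C3 Pr h1 in \<open>auto simp: r_def\<close>)
qed

text \<open>The two \<open>is_least_positive\<close> conjuncts certify that the definite
  descriptions behind \<open>r0\<close> and, for small positive \<eta>, \<open>spectral_gap\<close>
  really denote least positive solutions.\<close>

theorem proposition5:
  fixes \<beta> :: real
  assumes "\<beta> > beta_star"
  shows "is_least_positive (r0_equation \<beta>) (r0 \<beta>) \<and>
    (\<forall>\<^sub>F \<eta> in at_right 0. is_least_positive (is_eigenvalue \<beta> \<eta>) (spectral_gap \<beta> \<eta>)) \<and>
    (\<lambda>\<eta>. spectral_gap \<beta> \<eta> - (r0 \<beta> + A_coeff \<beta> * \<eta>)) \<in> O[at_right 0](\<lambda>\<eta>. \<eta>\<^sup>2) \<and>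
    A_coeff \<beta> > 0 \<and>
    (\<forall>\<^sub>F \<eta> in at_right 0. spectral_gap \<beta> \<eta> - r0 \<beta> > 0)"
proof (intro conjI)
  obtain C h1 where C: "C > 0" "h1 > 0"
    "\<And>h. 0 < h \<Longrightarrow> h < h1 \<Longrightarrow> is_least_positive (is_eigenvalue \<beta> h) (spectral_gap \<beta> h)"
    "\<And>h. 0 < h \<Longrightarrow> h < h1 \<Longrightarrow> \<bar>spectral_gap \<beta> h - (r0 \<beta> + A_coeff \<beta> * h)\<bar> \<le> C * h\<^sup>2"
    using spectral_gap_expansion[OF assms] by blast
  show "is_least_positive (r0_equation \<beta>) (r0 \<beta>)" by (rule r0_props(1)[OF assms])
  show A: "A_coeff \<beta> > 0" by (rule A_coeff_pos[OF assms])
  \<comment> \<open>The third condition makes the error \<open>C \<eta>^2\<close> smaller than the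
    linear term.\<close>
  have small: "\<forall>\<^sub>F \<eta> in at_right 0. 0 < \<eta> \<and> \<eta> < h1 \<and> \<eta> < A_coeff \<beta> / C"
    using C(1,2) A unfolding eventually_at_right_field by (intro exI[of _ "min h1 (A_coeff \<beta> / C)"]) simp
  show "\<forall>\<^sub>F \<eta> in at_right 0. is_least_positive (is_eigenvalue \<beta> \<eta>) (spectral_gap \<beta> \<eta>)"
    using small by eventually_elim (use C(3) in auto)
  show "(\<lambda>\<eta>. spectral_gap \<beta> \<eta> - (r0 \<beta> + A_coeff \<beta> * \<eta>)) \<in> O[at_right 0](\<lambda>\<eta>. \<eta>\<^sup>2)"
  proof (rule bigoI[of _ C])
    show "\<forall>\<^sub>F \<eta> in at_right 0. norm (spectral_gap \<beta> \<eta> - (r0 \<beta> + A_coeff \<beta> * \<eta>)) \<le> C * norm (\<eta>\<^sup>2)"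
      using small by eventually_elim (use C(4) in auto)
  qed
  show "\<forall>\<^sub>F \<eta> in at_right 0. spectral_gap \<beta> \<eta> - r0 \<beta> > 0"
    using small
  proof eventually_elim
    case (elim \<eta>)
    then have "C * \<eta> < A_coeff \<beta>" using C(1) by (simp add: field_simps)
    then have "C * \<eta> * \<eta> < A_coeff \<beta> * \<eta>" using elim by (intro mult_strict_right_mono) auto
    moreover have "\<bar>spectral_gap \<beta> \<eta> - (r0 \<beta> + A_coeff \<beta> * \<eta>)\<bar> \<le> C * \<eta> * \<eta>"
      using C(4)[of \<eta>] elim by (simp add: power2_eq_square mult.assoc)
    ultimately show ?case by linarith
  qed
qed

end
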